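(* Let $G$ be a finite group and $P$ a $p$-subgroup of $G$. Let $M=S(G,P)$ and suppose that the fusion system $\mathcal{F}_P(G)$ is saturated. Then the following are equivalent: (1) $M$ is Brauer indecomposable. (2) For every subgroup $Q$ with $\mathrm{core}_G(P)\le Q\le P$ which is fully normalized in $\mathcal{F}_P(G)$, the module $\mathrm{Res}^{N_G(Q)}_{Q C_G(Q)} S(N_G(Q), N_P(Q))$ is indecomposable.
   Context: Throughout, $p$ is a prime and $k$ is an algebraically closed field of characteristic $p$; all modules are finite dimensional. For a finite group $G$ and a subgroup $H\le G$, $S(G,H)$ denotes the Scott module: the unique indecomposable direct summand of $\mathrm{Ind}_H^G(k)$ (with $k$ the trivial module) containing the trivial $kG$-module in its socle (equivalently, in its head). For a $kG$-module $M$ and a $p$-subgroup $Q\le G$, the Brauer construction is $M(Q)=M^Q/\sum_{R<Q}\mathrm{Tr}_R^Q(M^R)$, where $M^Q$ is the set of $Q$-fixed points and $\mathrm{Tr}_R^Q(m)=\sum_{x\in[Q/R]}xm$; it is a $kN_G(Q)$-module. $M$ is called Brauer indecomposable if for every $p$-subgroup $Q\le G$, $\mathrm{Res}^{N_G(Q)}_{QC_G(Q)} M(Q)$ is either indecomposable or zero. $\mathrm{core}_G(P)=\bigcap_{x\in G} xPx^{-1}$ is the largest normal subgroup of $G$ contained in $P$. The fusion system $\mathcal{F}_P(G)$ is the category whose objects are subgroups of $P$ and whose morphisms $Q\to R$ are the group homomorphisms induced by conjugation by elements of $G$; "saturated" is in the standard sense of saturated fusion systems (Broto–Levi–Oliver/Puig).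 A subgroup $Q\le P$ is fully normalized in $\mathcal{F}_P(G)$ if $|N_P(Q)|\ge |N_P(gQg^{-1})|$ for every $g\in G$ with $gQg^{-1}\le P$. *)

theory Defs
  imports "HOL-Algebra.Coset" "HOL-Computational_Algebra.Polynomial"
begin

definition conjg :: "('g, 'b) monoid_scheme \<Rightarrow> 'g \<Rightarrow> 'g \<Rightarrow> 'g" where
  "conjg G g x = g \<otimes>\<^bsub>G\<^esub> x \<otimes>\<^bsub>G\<^esub> inv\<^bsub>G\<^esub> g"

definition conj_set :: "('g, 'b) monoid_scheme \<Rightarrow> 'g \<Rightarrow> 'g set \<Rightarrow> 'g set" where
  "conj_set G g Q = conjg G g ` Q"

definition normalizer_in :: "('g, 'b) monoid_scheme \<Rightarrow> 'g set \<Rightarrow> 'g set \<Rightarrow> 'g set" where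
  "normalizer_in G X Q = {g \<in> X. conj_set G g Q = Q}"

definition centralizer_in :: "('g, 'b) monoid_scheme \<Rightarrow> 'g set \<Rightarrow> 'g set \<Rightarrow> 'g set" where
  "centralizer_in G X Q = {g \<in> X. \<forall>x\<in>Q. g \<otimes>\<^bsub>G\<^esub> x = x \<otimes>\<^bsub>G\<^esub> g}"

definition set_prod :: "('g, 'b) monoid_scheme \<Rightarrow> 'g set \<Rightarrow> 'g set \<Rightarrow> 'g set" where
  "set_prod G A B = {a \<otimes>\<^bsub>G\<^esub> b | a b. a \<in> A \<and> b \<in> B}"

definition core :: "('g, 'b) monoid_scheme \<Rightarrow> 'g set \<Rightarrow> 'g set" where
  "core G P = (\<Inter>g\<in>carrier G. conj_set G g P)"

definition p_subgroup :: "nat \<Rightarrow> ('g, 'b) monoid_scheme \<Rightarrow> 'g set \<Rightarrow> bool" where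
  "p_subgroup p G Q \<longleftrightarrow> subgroup Q G \<and> finite Q \<and> (\<exists>n. card Q = p ^ n)"

definition fus_hom :: "('g, 'b) monoid_scheme \<Rightarrow> 'g set \<Rightarrow> 'g set \<Rightarrow> ('g \<Rightarrow> 'g) set" where
  "fus_hom G Q R = {restrict (conjg G g) Q | g. g \<in> carrier G \<and> conj_set G g Q \<subseteq> R}"

definition aut_P :: "('g, 'b) monoid_scheme \<Rightarrow> 'g set \<Rightarrow> 'g set \<Rightarrow> ('g \<Rightarrow> 'g) set" where
  "aut_P G P Q = {restrict (conjg G g) Q | g. g \<in> normalizer_in G P Q}"

definition fully_normalized :: "('g, 'b) monoid_scheme \<Rightarrow> 'g set \<Rightarrow> 'g set \<Rightarrow> bool" where
  "fully_normalized G P Q \<longleftrightarrow> subgroup Q G \<and> Q \<subseteq> P \<and>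
     (\<forall>g\<in>carrier G. conj_set G g Q \<subseteq> P \<longrightarrow>
        card (normalizer_in G P (conj_set G g Q)) \<le> card (normalizer_in G P Q))"

definition fully_centralized :: "('g, 'b) monoid_scheme \<Rightarrow> 'g set \<Rightarrow> 'g set \<Rightarrow> bool" where
  "fully_centralized G P Q \<longleftrightarrow> subgroup Q G \<and> Q \<subseteq> P \<and>
     (\<forall>g\<in>carrier G. conj_set G g Q \<subseteq> P \<longrightarrow>
        card (centralizer_in G P (conj_set G g Q)) \<le> card (centralizer_in G P Q))"

text \<open>N_phi = {h in N_P(Q) | phi c_h phi^-1 in Aut_P(phi Q)}\<close>
definition N_phi :: "('g, 'b) monoid_scheme \<Rightarrow> 'g set \<Rightarrow> 'g set \<Rightarrow> ('g \<Rightarrow> 'g) \<Rightarrow> 'g set" where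
  "N_phi G P Q \<phi> = {h \<in> normalizer_in G P Q. \<exists>u \<in> normalizer_in G P (\<phi> ` Q).
       \<forall>x\<in>Q. \<phi> (conjg G h x) = conjg G u (\<phi> x)}"

text \<open>Saturation (Broto--Levi--Oliver): axioms (I) and (II); Sylow means order equal to
  the full p-part of the order.\<close>
definition saturated_fusion :: "nat \<Rightarrow> ('g, 'b) monoid_scheme \<Rightarrow> 'g set \<Rightarrow> bool" where
  "saturated_fusion p G P \<longleftrightarrow>
    (\<forall>Q. subgroup Q G \<and> Q \<subseteq> P \<longrightarrow>
       (fully_normalized G P Q \<longrightarrow> fully_centralized G P Q \<and>
          aut_P G P Q \<subseteq> fus_hom G Q Q \<and>
          card (aut_P G P Q) = p ^ multiplicity p (card (fus_hom G Q Q))) \<and>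
       (\<forall>\<phi> \<in> fus_hom G Q P. fully_centralized G P (\<phi> ` Q) \<longrightarrow>
          (\<exists>\<psi> \<in> fus_hom G (N_phi G P Q \<phi>) P. \<forall>x\<in>Q. \<psi> x = \<phi> x)))"

section \<open>Modules: k-subspaces of functions 'g \<Rightarrow> 'k with left translation action\<close>

definition lin_subspace :: "('g \<Rightarrow> 'k::field) set \<Rightarrow> bool" where
  "lin_subspace V \<longleftrightarrow> (\<lambda>x. 0) \<in> V \<and> (\<forall>f\<in>V. \<forall>h\<in>V. (\<lambda>x. f x + h x) \<in> V)
     \<and> (\<forall>c. \<forall>f\<in>V. (\<lambda>x. c * f x) \<in> V)"

definition lin_span :: "('g \<Rightarrow> 'k::field) set \<Rightarrow> ('g \<Rightarrow> 'k) set" where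
  "lin_span S = \<Inter>{W. lin_subspace W \<and> S \<subseteq> W}"

definition ssum :: "('g \<Rightarrow> 'k::field) set \<Rightarrow> ('g \<Rightarrow> 'k) set \<Rightarrow> ('g \<Rightarrow> 'k) set" where
  "ssum A B = {(\<lambda>x. a x + b x) | a b. a \<in> A \<and> b \<in> B}"

definition gact :: "('g, 'b) monoid_scheme \<Rightarrow> 'g \<Rightarrow> ('g \<Rightarrow> 'k::field) \<Rightarrow> ('g \<Rightarrow> 'k)" where
  "gact G g f = (\<lambda>x. if x \<in> carrier G then f (inv\<^bsub>G\<^esub> g \<otimes>\<^bsub>G\<^esub> x) else 0)"

definition submodule :: "('g, 'b) monoid_scheme \<Rightarrow> 'g set \<Rightarrow> ('g \<Rightarrow> 'k::field) set \<Rightarrow> bool" where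
  "submodule G H V \<longleftrightarrow> lin_subspace V \<and> (\<forall>g\<in>H. \<forall>f\<in>V. gact G g f \<in> V)"

text \<open>The kH-module V/W (W \<subseteq> V submodules) is indecomposable: nonzero, and not a
  direct sum A/W \<oplus> B/W of two nonzero submodules.\<close>
definition indec_quot :: "('g, 'b) monoid_scheme \<Rightarrow> 'g set \<Rightarrow> ('g \<Rightarrow> 'k::field) set \<Rightarrow> ('g \<Rightarrow> 'k) set \<Rightarrow> bool" where
  "indec_quot G H V W \<longleftrightarrow> W \<subset> V \<and>
     \<not> (\<exists>A B. submodule G H A \<and> submodule G H B \<and> W \<subseteq> A \<and> W \<subseteq> B \<and>
            ssum A B = V \<and> A \<inter> B = W \<and> A \<noteq> W \<and> B \<noteq> W)"

text \<open>Ind_R^H(k) realised as functions on H constant on left cosets xR (zero off H)\<close>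
definition ind_triv :: "('g, 'b) monoid_scheme \<Rightarrow> 'g set \<Rightarrow> 'g set \<Rightarrow> ('g \<Rightarrow> 'k::field) set" where
  "ind_triv G H R = {f. (\<forall>x. x \<notin> H \<longrightarrow> f x = 0) \<and> (\<forall>x\<in>H. \<forall>r\<in>R. f (x \<otimes>\<^bsub>G\<^esub> r) = f x)}"

text \<open>M is (a realisation of) the Scott module S(H,R): an indecomposable direct summand of
  Ind_R^H(k) containing the trivial module in its socle.\<close>
definition scott :: "('g, 'b) monoid_scheme \<Rightarrow> 'g set \<Rightarrow> 'g set \<Rightarrow> ('g \<Rightarrow> 'k::field) set \<Rightarrow> bool" where
  "scott G H R M \<longleftrightarrow> submodule G H M \<and> M \<subseteq> ind_triv G H R \<and>
     (\<exists>M'. submodule G H M' \<and> ssum M M' = ind_triv G H R \<and> M \<inter> M' = {\<lambda>x. 0}) \<and>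
     indec_quot G H M {\<lambda>x. 0} \<and>
     (\<exists>m\<in>M. m \<noteq> (\<lambda>x. 0) \<and> (\<forall>g\<in>H. gact G g m = m))"

definition fixed_pts :: "('g, 'b) monoid_scheme \<Rightarrow> 'g set \<Rightarrow> ('g \<Rightarrow> 'k::field) set \<Rightarrow> ('g \<Rightarrow> 'k) set" where
  "fixed_pts G Q M = {m \<in> M. \<forall>g\<in>Q. gact G g m = m}"

definition lcosets_in :: "('g, 'b) monoid_scheme \<Rightarrow> 'g set \<Rightarrow> 'g set \<Rightarrow> 'g set set" where
  "lcosets_in G Q R = {x <#\<^bsub>G\<^esub> R | x. x \<in> Q}"

definition trace :: "('g, 'b) monoid_scheme \<Rightarrow> 'g set \<Rightarrow> 'g set \<Rightarrow> ('g \<Rightarrow> 'k::field) \<Rightarrow> ('g \<Rightarrow> 'k)" where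
  "trace G Q R m = (\<lambda>y. \<Sum>C\<in>lcosets_in G Q R. gact G (SOME x. x \<in> C) m y)"

text \<open>M(Q) = brauer_num / brauer_den\<close>
definition brauer_num :: "('g, 'b) monoid_scheme \<Rightarrow> 'g set \<Rightarrow> ('g \<Rightarrow> 'k::field) set \<Rightarrow> ('g \<Rightarrow> 'k) set" where
  "brauer_num G Q M = fixed_pts G Q M"

definition brauer_den :: "('g, 'b) monoid_scheme \<Rightarrow> 'g set \<Rightarrow> ('g \<Rightarrow> 'k::field) set \<Rightarrow> ('g \<Rightarrow> 'k) set" where
  "brauer_den G Q M = lin_span (\<Union>{trace G Q R ` fixed_pts G R M | R. subgroup R G \<and> R \<subset> Q})"

definition brauer_indec :: "nat \<Rightarrow> ('g, 'b) monoid_scheme \<Rightarrow> ('g \<Rightarrow> 'k::field) set \<Rightarrow> bool" where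
  "brauer_indec p G M \<longleftrightarrow> (\<forall>Q. p_subgroup p G Q \<longrightarrow>
     brauer_num G Q M = brauer_den G Q M \<or>
     indec_quot G (set_prod G Q (centralizer_in G (carrier G) Q)) (brauer_num G Q M) (brauer_den G Q M))"

end

theory Submission
  imports Defs "HOL-Library.Function_Algebras"
begin

text \<open>
  Put \<open>X = G/P\<close>. The summands of \<open>kX\<close> are the images of the \<open>G\<close>-invariant idempotent matrices on
  \<open>X\<close>; let \<open>M\<close> be the image of \<open>e\<close>. For a \<open>p\<close>-subgroup \<open>Q\<close>, restriction of functions to the fixed
  points \<open>X\<^sup>Q\<close> identifies \<open>M(Q)\<close> with the image of the matrix \<open>b\<close> obtained by restricting \<open>e\<close> to
  \<open>X\<^sup>Q\<close>, and restriction of matrices is multiplicative because the nontrivial \<open>Q\<close>-orbits have length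
  divisible by \<open>p\<close>.

  If \<open>Q\<close> is fully normalized, saturation conjugates every \<open>N\<^sub>G(Q)\<close>-stabilizer of a point of \<open>X\<^sup>Q\<close>
  into \<open>N\<^sub>P(Q)\<close>, so there is an \<open>N\<^sub>G(Q)\<close>-map from \<open>X\<^sup>Q\<close> to \<open>Y = N\<^sub>G(Q)/N\<^sub>P(Q)\<close>. Composing functions on
  \<open>Y\<close> with it, applying \<open>b\<close> and restricting back to \<open>Y\<close> fixes the constant function, hence induces
  an automorphism of \<open>S(N\<^sub>G(Q), N\<^sub>P(Q))\<close> by Fitting's lemma, and this module is a summand of \<open>M(Q)\<close>.
  That gives (1) \<open>\<Longrightarrow>\<close> (2). For the converse, argue by downward induction on \<open>Q\<close>. Let \<open>a'\<close> be the
  complementary idempotent. If \<open>a'\<close> has a nonzero entry at a pair of points fixed by a \<open>p\<close>-group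
  \<open>R\<close> in \<open>N\<^sub>G(Q)\<close> larger than \<open>Q\<close>, then \<open>R\<close> may be conjugated into \<open>P\<close> and \<open>M(R)\<close> decomposes, against
  the induction hypothesis. Otherwise \<open>a'\<close> is supported on pairs with stabilizer \<open>Q\<close> and lifts to a
  \<open>G\<close>-invariant matrix, and the locality of the endomorphism ring of \<open>M\<close> forces \<open>a' = 0\<close>.
\<close>

section \<open>Subspaces of finite-dimensional function spaces\<close>

text \<open>All modules become matrices on the one set G/P, so that M, its Brauer quotients and the
  Scott modules of all normalizers can be compared by multiplying matrices. The mark of a Scott
  module is then that its idempotent fixes the constant function on the orbit. This does two jobs:
  it shows that composites are not nilpotent, and it keeps the summand a of M(Q) that comes from the
  Scott module of the normalizer nonzero after restriction to the points fixed by any subgroup of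
  \<open>N_P(Q)\<close>. If the complement a' also survives at such a subgroup R, then M(R) has two
  nonzero summands. The obstacle in the converse is that a' is invariant only under
  \<open>N_G(Q)\<close>: it can be restricted only at subgroups of \<open>N_G(Q)\<close>, and lifted
  to G only if values at conjugate pairs agree. Both points are settled by the stabilizer T of a
  pair in the support of a'. If T is larger than Q, so is the normalizer of Q in T; if T = Q
  throughout, elements carrying one such pair to another normalize Q. In the second case the lift,
  cut down by e, is invertible, so a' is all of M(Q), against a being nonzero.\<close>

lemma lin_subspace_zero: "lin_subspace V \<Longrightarrow> 0 \<in> V"
  by (simp add: lin_subspace_def zero_fun_def)

lemma lin_subspace_add: "lin_subspace V \<Longrightarrow> f \<in> V \<Longrightarrow> h \<in> V \<Longrightarrow> f + h \<in> V"
  by (simp add: lin_subspace_def plus_fun_def)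

lemma lin_subspace_scale: "lin_subspace V \<Longrightarrow> f \<in> V \<Longrightarrow> (\<lambda>x. c * f x) \<in> V"
  by (simp add: lin_subspace_def)

lemma lin_subspace_diff:
  assumes "lin_subspace V" "f \<in> V" "h \<in> V" shows "f - h \<in> V"
proof -
  have "f - h = f + (\<lambda>x. (- 1) * h x)" by (auto simp: fun_eq_iff)
  then show ?thesis using assms lin_subspace_add lin_subspace_scale by metis
qed

lemma lin_subspaceI:
  assumes "0 \<in> V" "\<And>f h. f \<in> V \<Longrightarrow> h \<in> V \<Longrightarrow> f + h \<in> V"
    "\<And>c f. f \<in> V \<Longrightarrow> (\<lambda>x. c * f x) \<in> V"
  shows "lin_subspace V"
  using assms by (simp add: lin_subspace_def zero_fun_def plus_fun_def)

lemma ssum_eq: "ssum A B = {a + b | a b. a \<in> A \<and> b \<in> B}"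
  by (simp add: ssum_def plus_fun_def)

text \<open>The rank of a subspace is its number of pivot positions with respect to an enumeration
  of the support.\<close>

lemma subspace_rank_exists:
  assumes fin: "finite (X :: 'x set)"
  shows "\<exists>d :: ('x \<Rightarrow> 'k::field) set \<Rightarrow> nat. \<forall>V W. lin_subspace V \<longrightarrow> lin_subspace W \<longrightarrow>
    V \<subset> W \<longrightarrow> (\<forall>f\<in>W. \<forall>x. x \<notin> X \<longrightarrow> f x = 0) \<longrightarrow> d V < d W"
proof -
  obtain num :: "'x \<Rightarrow> nat" where num: "inj_on num X"
    using finite_imp_inj_to_nat_seg[OF fin] by blast
  define L where "L V = {x \<in> X. \<exists>f\<in>V. f x \<noteq> 0 \<and> (\<forall>y\<in>X. num y < num x \<longrightarrow> f y = 0)}"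
    for V :: "('x \<Rightarrow> 'k) set"
  have "card (L V) < card (L W)"
    if V: "lin_subspace V" and W: "lin_subspace W" and VW: "V \<subset> W"
      and supp: "\<forall>f\<in>W. \<forall>x. x \<notin> X \<longrightarrow> f x = 0" for V W :: "('x \<Rightarrow> 'k) set"
  proof -
    have sub: "L V \<subseteq> L W" using VW by (auto simp: L_def)
    moreover have "L V \<noteq> L W"
    proof
      assume eq: "L V = L W"
      \<comment> \<open>Gaussian elimination: the first nonzero position of f is a pivot of W, hence
        of V, and subtracting a multiple of an element of V with that pivot moves the first nonzero
        position further. The \<open>Suc\<close> in the measure makes it drop even when the pivot is
        the last position.\<close>
      have zero: "f \<in> V" if "f \<in> W" "\<forall>y\<in>X. num y < n \<longrightarrow> f y = 0" for f n
        using that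
      proof (induction "Suc (Max (num ` X)) - n" arbitrary: f n rule: less_induct)
        case less
        show ?case
        proof (cases "\<exists>x\<in>X. f x \<noteq> 0")
          case False
          then have "f = 0" using less.prems supp by (auto simp: fun_eq_iff)
          then show ?thesis using lin_subspace_zero[OF V] by simp
        next
          case True
          define x where "x = arg_min num (\<lambda>x. x \<in> X \<and> f x \<noteq> 0)"
          have x: "x \<in> X" "f x \<noteq> 0" using True arg_min_natI[of "\<lambda>x. x \<in> X \<and> f x \<noteq> 0"]
            by (auto simp: x_def)
          have xmin: "f y = 0" if "y \<in> X" "num y < num x" for y
            using arg_min_nat_le[of "\<lambda>x. x \<in> X \<and> f x \<noteq> 0" y num] that by (force simp: x_def)
          have "x \<in> L W" using x xmin less.prems by (auto simp: L_def)
          then obtain v where v: "v \<in> V" "v x \<noteq> 0" "\<forall>y\<in>X. num y < num x \<longrightarrow> v y = 0"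
            unfolding eq[symmetric] unfolding L_def by blast
          define w where "w = f - (\<lambda>y. (f x / v x) * v y)"
          have "w \<in> W" unfolding w_def using v VW less.prems W
            by (intro lin_subspace_diff lin_subspace_scale) auto
          moreover have "\<forall>y\<in>X. num y < Suc (num x) \<longrightarrow> w y = 0"
          proof (intro ballI impI)
            fix y assume y: "y \<in> X" "num y < Suc (num x)"
            show "w y = 0"
            proof (cases "y = x")
              case True then show ?thesis using v by (simp add: w_def)
            next
              case False
              then have "num y < num x" using y num x(1) by (metis inj_onD less_SucE)
              then show ?thesis using v xmin y by (simp add: w_def)
            qed
          qed
          moreover have "num x \<le> Max (num ` X)" using x fin by simp
          moreover have "n \<le> num x" using x less.prems by (meson not_le_imp_less)
          ultimately have "w \<in> V"
            using less.hyps[of "Suc (num x)" w] by simp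
          moreover have "f = w + (\<lambda>y. (f x / v x) * v y)" by (simp add: w_def)
          ultimately show ?thesis
            using lin_subspace_add[OF V] lin_subspace_scale[OF V v(1)] by metis
        qed
      qed
      have "W \<subseteq> V" using zero[of _ 0] by auto
      then show False using VW by auto
    qed
    moreover have "finite (L W)" using fin by (simp add: L_def)
    ultimately show ?thesis by (meson psubsetI psubset_card_mono)
  qed
  then show ?thesis by (intro exI[of _ "\<lambda>V. card (L V)"]) simp
qed

text \<open>A member of least rank does not properly contain any later one. This is the finiteness
  that drives Fitting's lemma.\<close>

lemma subspace_chain_stable:
  fixes W :: "nat \<Rightarrow> ('x \<Rightarrow> 'k::field) set"
  assumes "finite X" and lin: "\<And>n. lin_subspace (W n)"
    and supp: "\<And>n f x. f \<in> W n \<Longrightarrow> x \<notin> X \<Longrightarrow> f x = 0" and dec: "\<And>n. W (Suc n) \<subseteq> W n"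
  shows "\<exists>n. \<forall>m\<ge>n. W m = W n"
proof -
  obtain d :: "('x \<Rightarrow> 'k) set \<Rightarrow> nat" where
    d: "\<And>V W. lin_subspace V \<Longrightarrow> lin_subspace W \<Longrightarrow> V \<subset> W \<Longrightarrow>
      (\<forall>f\<in>W. \<forall>x. x \<notin> X \<longrightarrow> f x = 0) \<Longrightarrow> d V < d W"
    using subspace_rank_exists[OF assms(1)] by meson
  obtain n where n: "\<And>m. d (W n) \<le> d (W m)"
    using ex_has_least_nat[of "\<lambda>n. True" _ "\<lambda>n. d (W n)"] by auto
  have "W m = W n" if "n \<le> m" for m
  proof (rule ccontr)
    assume "W m \<noteq> W n"
    moreover have "W m \<subseteq> W n" using that dec lift_Suc_antimono_le[of W] by blast
    ultimately have "d (W m) < d (W n)" using d lin supp by blast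
    then show False using n[of m] by simp
  qed
  then show ?thesis by blast
qed

section \<open>Finite group actions and invariant matrices\<close>

text \<open>The point set is kept arbitrary because the fixed point count for p-groups is applied
  not only to G/P but also to cosets of other subgroups, and the orbit formula to conjugation
  maps.\<close>

locale finite_action = group G for G :: "('g, 'b) monoid_scheme" (structure) +
  fixes X :: "'x set" and act :: "'g \<Rightarrow> 'x \<Rightarrow> 'x"
  assumes finite_carrier: "finite (carrier G)" and finite_points: "finite X"
    and act_closed: "\<lbrakk>g \<in> carrier G; x \<in> X\<rbrakk> \<Longrightarrow> act g x \<in> X"
    and act_one: "x \<in> X \<Longrightarrow> act \<one> x = x"
    and act_mult: "\<lbrakk>g \<in> carrier G; h \<in> carrier G; x \<in> X\<rbrakk> \<Longrightarrow> act (g \<otimes> h) x = act g (act h x)"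
begin

section \<open>Orbits and fixed points of p-groups\<close>

definition fix_points :: "'g set \<Rightarrow> 'x set" where
  "fix_points Q = {x \<in> X. \<forall>q\<in>Q. act q x = x}"

lemma act_inv_act: "\<lbrakk>g \<in> carrier G; x \<in> X\<rbrakk> \<Longrightarrow> act (inv g) (act g x) = x"
  using act_mult[of "inv g" g x] act_one by simp

lemma act_act_inv: "\<lbrakk>g \<in> carrier G; x \<in> X\<rbrakk> \<Longrightarrow> act g (act (inv g) x) = x"
  using act_mult[of g "inv g" x] act_one by simp

lemma act_bij: "g \<in> carrier G \<Longrightarrow> bij_betw (act g) X X"
  by (rule bij_betw_byWitness[where f' = "act (inv g)"])
    (auto simp: act_inv_act act_act_inv act_closed)

lemma act_inject: "\<lbrakk>g \<in> carrier G; x \<in> X; y \<in> X\<rbrakk> \<Longrightarrow> act g x = act g y \<longleftrightarrow> x = y"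
  by (metis act_inv_act)

lemma sum_reindex_act: "g \<in> carrier G \<Longrightarrow> (\<Sum>x\<in>X. F (act g x)) = (\<Sum>x\<in>X. F x)"
  using sum.reindex_bij_betw[OF act_bij] .

text \<open>Each fibre of the orbit map is a left translate of the stabilizer, so adding up the
  fibres over the orbit gives the product.\<close>

lemma card_orbit_stabilizer:
  assumes Q: "subgroup Q G" and x: "x \<in> X"
  shows "card Q = card ((\<lambda>q. act q x) ` Q) * card {q \<in> Q. act q x = x}"
proof -
  interpret Q: subgroup Q G by fact
  have finQ: "finite Q" using finite_carrier Q.subset finite_subset by blast
  have "card {q \<in> Q. act q x = act r x} = card {q \<in> Q. act q x = x}" if r: "r \<in> Q" for r
  proof (rule bij_betw_same_card[OF bij_betw_byWitness[where f = "\<lambda>q. inv r \<otimes> q" and f' = "\<lambda>q. r \<otimes> q"]])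
    show "\<forall>q\<in>{q \<in> Q. act q x = act r x}. r \<otimes> (inv r \<otimes> q) = q"
      using r by (simp add: m_assoc[symmetric])
    show "\<forall>q\<in>{q \<in> Q. act q x = x}. inv r \<otimes> (r \<otimes> q) = q"
      using r by (simp add: m_assoc[symmetric])
    show "(\<lambda>q. inv r \<otimes> q) ` {q \<in> Q. act q x = act r x} \<subseteq> {q \<in> Q. act q x = x}"
      using r x by (auto simp: act_mult act_inv_act)
    show "(\<lambda>q. r \<otimes> q) ` {q \<in> Q. act q x = x} \<subseteq> {q \<in> Q. act q x = act r x}"
      using r x by (auto simp: act_mult)
  qed
  then have "(\<Sum>y\<in>(\<lambda>q. act q x) ` Q. card {q \<in> Q. act q x = y})
      = card ((\<lambda>q. act q x) ` Q) * card {q \<in> Q. act q x = x}"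
    by (subst sum.cong[OF refl, where h = "\<lambda>_. card {q \<in> Q. act q x = x}"]) auto
  then show ?thesis
    using sum.image_gen[OF finQ, of "\<lambda>_. 1::nat" "\<lambda>q. act q x"] by simp
qed

text \<open>Orbits of a \<open>p\<close>-group that are not singletons have length divisible by \<open>p\<close>.\<close>

lemma sum_eq_sum_fixed_plus:
  fixes F :: "'x \<Rightarrow> 'r::comm_semiring_1"
  assumes p: "prime p" and Q: "p_subgroup p G Q"
    and Z: "Z \<subseteq> X" "\<And>q x. q \<in> Q \<Longrightarrow> x \<in> Z \<Longrightarrow> act q x \<in> Z"
    and F: "\<And>q x. q \<in> Q \<Longrightarrow> x \<in> Z \<Longrightarrow> F (act q x) = F x"
  shows "\<exists>r. (\<Sum>x\<in>Z. F x) = (\<Sum>x\<in>Z \<inter> fix_points Q. F x) + of_nat p * r"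
proof -
  have sQ: "subgroup Q G" using Q by (simp add: p_subgroup_def)
  interpret Q: subgroup Q G by fact
  have "finite Z" using Z(1) finite_points finite_subset by blast
  then show ?thesis using Z F
  proof (induction "card Z" arbitrary: Z rule: less_induct)
    case less
    show ?case
    proof (cases "Z \<subseteq> fix_points Q")
      case True
      then show ?thesis by (intro exI[of _ 0]) (simp add: Int_absorb2)
    next
      case False
      then obtain x where x: "x \<in> Z" "x \<notin> fix_points Q" by auto
      have xX: "x \<in> X" using x less.prems by auto
      \<comment> \<open>The whole orbit of x leaves Z: F is constant on it and its length is a
        multiple of p, so it contributes only to the remainder, and what is left of Z is still
        stable under Q.\<close>
      define Or where "Or = (\<lambda>q. act q x) ` Q"
      have xOr: "x \<in> Or" unfolding Or_def
        by (rule image_eqI[where x = \<one>]) (use act_one[OF xX] Q.one_closed in auto)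
      have OrZ: "Or \<subseteq> Z" using less.prems x by (auto simp: Or_def)
      have finOr: "finite Or" using OrZ less.prems finite_subset by blast
      have closed: "act q y \<in> Z - Or" if "q \<in> Q" "y \<in> Z - Or" for q y
      proof -
        have yX: "y \<in> X" using that less.prems by auto
        have "act q y \<notin> Or"
        proof
          assume "act q y \<in> Or"
          then obtain r where r: "r \<in> Q" "act q y = act r x" by (auto simp: Or_def)
          then have "y = act (inv q) (act r x)" using act_inv_act[of q y] that yX by simp
          also have "\<dots> = act (inv q \<otimes> r) x" using act_mult that r xX by simp
          finally show False using that r by (auto simp: Or_def)
        qed
        then show ?thesis using that less.prems by auto
      qed
      have nofix: "Or \<inter> fix_points Q = {}"
      proof (rule ccontr)
        assume "Or \<inter> fix_points Q \<noteq> {}"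
        then obtain r where r: "r \<in> Q" "act r x \<in> fix_points Q" by (auto simp: Or_def)
        have "act (inv r) (act r x) = act r x" using r by (auto simp: fix_points_def)
        then have "act r x = x" using act_inv_act r xX by simp
        then show False using r x by simp
      qed
      have "card Or \<noteq> 1"
      proof
        assume "card Or = 1"
        then have "Or = {x}" using xOr by (metis card_1_singletonE singletonD)
        then show False using x xX by (auto simp: Or_def fix_points_def)
      qed
      moreover obtain n where n: "card Q = p ^ n" using Q by (auto simp: p_subgroup_def)
      moreover have "card Or dvd card Q" using card_orbit_stabilizer[OF sQ xX] by (simp add: Or_def)
      ultimately have "p dvd card Or" using p
        by (metis divides_primepow_nat dvd_power gr0I power_0)
      then obtain k where k: "card Or = p * k" by auto
      have "(\<Sum>y\<in>Or. F y) = of_nat (card Or) * F x"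
        using less.prems(4) x
        by (subst sum.cong[OF refl, where h = "\<lambda>_. F x"]) (auto simp: Or_def)
      then have Or0: "(\<Sum>y\<in>Or. F y) = of_nat p * (of_nat k * F x)" by (simp add: k mult.assoc)
      have "card (Z - Or) < card Z"
        by (intro psubset_card_mono) (use less.prems x xOr in auto)
      then have "\<exists>r. (\<Sum>y\<in>Z - Or. F y) = (\<Sum>y\<in>(Z - Or) \<inter> fix_points Q. F y) + of_nat p * r"
        using less.prems closed by (intro less.hyps) auto
      then obtain r where r: "(\<Sum>y\<in>Z - Or. F y) = (\<Sum>y\<in>(Z - Or) \<inter> fix_points Q. F y) + of_nat p * r"
        by blast
      have "(Z - Or) \<inter> fix_points Q = Z \<inter> fix_points Q" using nofix by auto
      moreover have "(\<Sum>y\<in>Z. F y) = (\<Sum>y\<in>Z - Or. F y) + (\<Sum>y\<in>Or. F y)"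
        using sum.subset_diff[OF OrZ] less.prems by blast
      ultimately show ?thesis using Or0 r
        by (intro exI[of _ "r + of_nat k * F x"]) (simp add: algebra_simps)
    qed
  qed
qed

text \<open>In characteristic p the remainder \<open>of_nat p * r\<close> vanishes. Every later
  collapse of a sum over X to the fixed points comes from here.\<close>

lemma sum_eq_sum_fixed:
  fixes F :: "'x \<Rightarrow> 'k::field"
  assumes "prime p" "CHAR('k) = p" "p_subgroup p G Q"
    and "Z \<subseteq> X" "\<And>q x. q \<in> Q \<Longrightarrow> x \<in> Z \<Longrightarrow> act q x \<in> Z"
    and "\<And>q x. q \<in> Q \<Longrightarrow> x \<in> Z \<Longrightarrow> F (act q x) = F x"
  shows "(\<Sum>x\<in>Z. F x) = (\<Sum>x\<in>Z \<inter> fix_points Q. F x)"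
proof -
  have "of_nat p = (0::'k)" using assms(2) of_nat_CHAR by blast
  then show ?thesis using sum_eq_sum_fixed_plus[OF assms(1,3-6)] by auto
qed

text \<open>The same orbit formula over the natural numbers, with F constant 1; working over
  semirings serves both purposes.\<close>

lemma card_fixed_mod:
  assumes "prime p" "p_subgroup p G Q" "Z \<subseteq> X" "\<And>q x. q \<in> Q \<Longrightarrow> x \<in> Z \<Longrightarrow> act q x \<in> Z"
  shows "p dvd card Z \<longleftrightarrow> p dvd card (Z \<inter> fix_points Q)"
proof -
  obtain r where "card Z = card (Z \<inter> fix_points Q) + p * r"
    using sum_eq_sum_fixed_plus[OF assms, of "\<lambda>_. 1::nat"] by auto
  then show ?thesis by (simp add: dvd_add_left_iff)
qed

section \<open>The algebra of invariant matrices\<close>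

definition mat_mult :: "('x \<Rightarrow> 'x \<Rightarrow> 'k::field) \<Rightarrow> ('x \<Rightarrow> 'x \<Rightarrow> 'k) \<Rightarrow> 'x \<Rightarrow> 'x \<Rightarrow> 'k"
    (infixl \<open>\<star>\<close> 70) where
  "a \<star> b = (\<lambda>x z. \<Sum>y\<in>X. a x y * b y z)"

definition mat_app :: "('x \<Rightarrow> 'x \<Rightarrow> 'k::field) \<Rightarrow> ('x \<Rightarrow> 'k) \<Rightarrow> 'x \<Rightarrow> 'k" where
  "mat_app a F = (\<lambda>x. \<Sum>y\<in>X. a x y * F y)"

definition transl :: "'g \<Rightarrow> ('x \<Rightarrow> 'k::field) \<Rightarrow> 'x \<Rightarrow> 'k" where
  "transl g F = (\<lambda>x. if x \<in> X then F (act (inv g) x) else 0)"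

text \<open>This is the endomorphism algebra of the permutation module kX over kH, written in the
  basis of points. Matrices vanish outside X so that equal endomorphisms are equal
  functions.\<close>

definition inv_mats :: "'g set \<Rightarrow> ('x \<Rightarrow> 'x \<Rightarrow> 'k::field) set" where
  "inv_mats H = {a. (\<forall>x y. a x y \<noteq> 0 \<longrightarrow> x \<in> X \<and> y \<in> X) \<and>
     (\<forall>h\<in>H. \<forall>x\<in>X. \<forall>y\<in>X. a (act h x) (act h y) = a x y)}"

text \<open>The quantified idempotents are those of the corner algebra of e; each of them splits the
  image of e into the images of a and of \<open>e - a\<close>.\<close>

definition prim_idem :: "'g set \<Rightarrow> ('x \<Rightarrow> 'x \<Rightarrow> 'k::field) \<Rightarrow> bool" where
  "prim_idem H e \<longleftrightarrow> e \<in> inv_mats H \<and> e \<star> e = e \<and> e \<noteq> 0 \<and>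
     (\<forall>a \<in> inv_mats H. a \<star> a = a \<longrightarrow> e \<star> a = a \<longrightarrow> a \<star> e = a \<longrightarrow> a = 0 \<or> a = e)"

lemma mult_assoc: "(a \<star> b) \<star> c = a \<star> (b \<star> c)"
proof (intro ext)
  fix x z
  have "((a \<star> b) \<star> c) x z = (\<Sum>y\<in>X. \<Sum>w\<in>X. a x w * b w y * c y z)"
    by (simp add: mat_mult_def sum_distrib_right)
  also have "\<dots> = (\<Sum>w\<in>X. \<Sum>y\<in>X. a x w * b w y * c y z)" by (rule sum.swap)
  also have "\<dots> = (a \<star> (b \<star> c)) x z"
    by (simp add: mat_mult_def sum_distrib_left mult.assoc)
  finally show "((a \<star> b) \<star> c) x z = (a \<star> (b \<star> c)) x z" .
qed

lemma mult_zero: "0 \<star> a = 0" "a \<star> 0 = 0"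
  by (auto simp: mat_mult_def fun_eq_iff)

lemma mult_add_left: "(a + b) \<star> c = a \<star> c + b \<star> c"
  and mult_add_right: "c \<star> (a + b) = c \<star> a + c \<star> b"
  by (auto simp: mat_mult_def fun_eq_iff distrib_left distrib_right sum.distrib)

lemma mult_diff_left: "(a - b) \<star> c = a \<star> c - b \<star> c"
  and mult_diff_right: "c \<star> (a - b) = c \<star> a - c \<star> b"
  by (auto simp: mat_mult_def fun_eq_iff left_diff_distrib right_diff_distrib sum_subtractf)

lemma mult_scale: "c \<star> (\<lambda>x y. r * a x y) = (\<lambda>x y. r * (c \<star> a) x y)"
  "(\<lambda>x y. r * a x y) \<star> c = (\<lambda>x y. r * (a \<star> c) x y)"
  by (auto simp: mat_mult_def fun_eq_iff sum_distrib_left mult_ac)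

lemma app_mult: "mat_app (a \<star> b) F = mat_app a (mat_app b F)"
proof
  fix x
  have "mat_app (a \<star> b) F x = (\<Sum>z\<in>X. \<Sum>y\<in>X. a x y * b y z * F z)"
    by (simp add: mat_app_def mat_mult_def sum_distrib_right)
  also have "\<dots> = (\<Sum>y\<in>X. \<Sum>z\<in>X. a x y * b y z * F z)" by (rule sum.swap)
  also have "\<dots> = mat_app a (mat_app b F) x"
    by (simp add: mat_app_def sum_distrib_left mult.assoc)
  finally show "mat_app (a \<star> b) F x = mat_app a (mat_app b F) x" .
qed

lemma app_add: "mat_app a (F + F') = mat_app a F + mat_app a F'"
  and app_diff: "mat_app a (F - F') = mat_app a F - mat_app a F'"
  and app_zero: "mat_app a 0 = 0"
  and app_scale: "mat_app a (\<lambda>x. c * F x) = (\<lambda>x. c * mat_app a F x)"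
  by (auto simp: mat_app_def fun_eq_iff distrib_left right_diff_distrib sum.distrib sum_subtractf
      sum_distrib_left mult_ac)

lemma app_zero_mat: "mat_app 0 F = 0"
  and app_diff_mat: "mat_app (a - b) F = mat_app a F - mat_app b F"
  by (auto simp: mat_app_def fun_eq_iff left_diff_distrib sum_subtractf)

lemma app_cong: "(\<And>x. x \<in> X \<Longrightarrow> F x = F' x) \<Longrightarrow> mat_app a F = mat_app a F'"
  by (auto simp: mat_app_def fun_eq_iff intro!: sum.cong)

lemma app_delta: "y \<in> X \<Longrightarrow> mat_app a (\<lambda>z. if z = y then c else 0) x = a x y * c"
  using finite_points by (simp add: mat_app_def if_distrib[of "\<lambda>t. _ * t"] cong: if_cong)

lemma inv_mats_supp: "a \<in> inv_mats H \<Longrightarrow> x \<notin> X \<or> y \<notin> X \<Longrightarrow> a x y = 0"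
  by (auto simp: inv_mats_def)

lemma inv_mats_act: "a \<in> inv_mats H \<Longrightarrow> h \<in> H \<Longrightarrow> x \<in> X \<Longrightarrow> y \<in> X \<Longrightarrow> a (act h x) (act h y) = a x y"
  by (auto simp: inv_mats_def)

lemma inv_mats_mono: "H \<subseteq> H' \<Longrightarrow> inv_mats H' \<subseteq> inv_mats H"
  by (auto simp: inv_mats_def)

lemma app_supp: "a \<in> inv_mats H \<Longrightarrow> x \<notin> X \<Longrightarrow> mat_app a F x = 0"
  by (simp add: mat_app_def inv_mats_supp)

lemma mat_eqI:
  assumes "a \<in> inv_mats H" "b \<in> inv_mats H'" "\<And>F. mat_app a F = mat_app b F"
  shows "a = b"
proof (intro ext)
  fix x y
  show "a x y = b x y"
  proof (cases "y \<in> X")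
    case True
    then show ?thesis using app_delta[OF True, of a 1 x] app_delta[OF True, of b 1 x] assms(3) by simp
  next
    case False
    then show ?thesis using inv_mats_supp[OF assms(1), of x y] inv_mats_supp[OF assms(2), of x y] by simp
  qed
qed

lemma mult_inv_mats:
  assumes "a \<in> inv_mats H" "b \<in> inv_mats H" "H \<subseteq> carrier G"
  shows "a \<star> b \<in> inv_mats H"
proof -
  have "(a \<star> b) (act h x) (act h z) = (a \<star> b) x z" if "h \<in> H" "x \<in> X" "z \<in> X" for h x z
  proof -
    have h: "h \<in> carrier G" using that assms by auto
    have "(a \<star> b) (act h x) (act h z) = (\<Sum>y\<in>X. a (act h x) (act h y) * b (act h y) (act h z))"
      unfolding mat_mult_def by (rule sum_reindex_act[OF h, symmetric])
    also have "\<dots> = (a \<star> b) x z"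
      using that assms by (simp add: mat_mult_def inv_mats_act)
    finally show ?thesis .
  qed
  moreover have "x \<in> X \<and> z \<in> X" if nz: "(a \<star> b) x z \<noteq> 0" for x z
  proof -
    obtain y where "a x y * b y z \<noteq> 0" 
      using nz sum.not_neutral_contains_not_neutral unfolding mat_mult_def by blast
    then show ?thesis using inv_mats_supp[OF assms(1), of x y] inv_mats_supp[OF assms(2), of y z] by auto
  qed
  ultimately show ?thesis by (auto simp: inv_mats_def)
qed

lemma diff_inv_mats: "a \<in> inv_mats H \<Longrightarrow> b \<in> inv_mats H \<Longrightarrow> a - b \<in> inv_mats H"
  unfolding inv_mats_def by (simp add: fun_diff_def) (metis diff_zero)

lemma add_inv_mats: "a \<in> inv_mats H \<Longrightarrow> b \<in> inv_mats H \<Longrightarrow> a + b \<in> inv_mats H"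
  unfolding inv_mats_def by simp (metis add.right_neutral)

lemma scale_inv_mats: "a \<in> inv_mats H \<Longrightarrow> (\<lambda>x y. c * a x y) \<in> inv_mats H"
  by (auto simp: inv_mats_def)

lemma app_transl:
  assumes "a \<in> inv_mats H" "h \<in> H" "h \<in> carrier G"
  shows "mat_app a (transl h F) = transl h (mat_app a F)"
proof
  fix x
  show "mat_app a (transl h F) x = transl h (mat_app a F) x"
  proof (cases "x \<in> X")
    case True
    have "mat_app a (transl h F) x = (\<Sum>y\<in>X. a x (act h y) * transl h F (act h y))"
      unfolding mat_app_def using sum_reindex_act[OF assms(3), of "\<lambda>y. a x y * transl h F y"] by simp
    also have "\<dots> = (\<Sum>y\<in>X. a (act (inv h) x) y * F y)"
    proof (rule sum.cong[OF refl])
      fix y assume y: "y \<in> X"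
      have "a x (act h y) = a (act h (act (inv h) x)) (act h y)"
        using True act_act_inv assms(3) by simp
      also have "\<dots> = a (act (inv h) x) y"
        using inv_mats_act[OF assms(1,2)] True y assms(3) act_closed by simp
      finally show "a x (act h y) * transl h F (act h y) = a (act (inv h) x) y * F y"
        using y assms(3) by (simp add: transl_def act_closed act_inv_act)
    qed
    finally show ?thesis using True by (simp add: transl_def mat_app_def)
  qed (use assms in \<open>simp add: app_supp transl_def\<close>)
qed

lemma transl_delta:
  assumes "h \<in> carrier G" "y \<in> X"
  shows "transl h (\<lambda>z. if z = y then c else 0) = (\<lambda>z. if z = act h y then c else 0)"
proof
  fix z
  have "act (inv h) z = y \<longleftrightarrow> z = act h y" if "z \<in> X"
    using that assms act_act_inv[of h z] act_inv_act[of h y] by metis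
  then show "transl h (\<lambda>z. if z = y then c else 0) z = (if z = act h y then c else 0)"
    using assms act_closed by (simp add: transl_def act_inv_act)
qed

text \<open>Evaluating at delta functions turns equivariance of the operator into invariance of the
  entries.\<close>

lemma inv_matsI:
  assumes "\<And>x y. a x y \<noteq> 0 \<Longrightarrow> x \<in> X \<and> y \<in> X" "H \<subseteq> carrier G"
    "\<And>h F. h \<in> H \<Longrightarrow> mat_app a (transl h F) = transl h (mat_app a F)"
  shows "a \<in> inv_mats H"
proof -
  have "a (act h x) (act h y) = a x y" if h: "h \<in> H" "x \<in> X" "y \<in> X" for h x y
  proof -
    have hG: "h \<in> carrier G" using h assms by auto
    have "a (act h x) (act h y) = mat_app a (transl h (\<lambda>z. if z = y then 1 else 0)) (act h x)"
      using h hG by (simp add: transl_delta app_delta act_closed)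
    also have "\<dots> = transl h (mat_app a (\<lambda>z. if z = y then 1 else 0)) (act h x)"
      using assms(3) h by simp
    also have "\<dots> = a x y" using h hG by (simp add: transl_def app_delta act_closed act_inv_act)
    finally show ?thesis .
  qed
  then show ?thesis using assms(1) by (auto simp: inv_mats_def)
qed

section \<open>Primitive idempotents and direct decompositions\<close>

lemma prim_idem_mono:
  "prim_idem H e \<Longrightarrow> H \<subseteq> H' \<Longrightarrow> e \<in> inv_mats H' \<Longrightarrow> prim_idem H' e"
  using inv_mats_mono[of H H'] unfolding prim_idem_def by blast

text \<open>The maps i and j identify the images of e and f. Sandwiching by j and i carries
  idempotents below e to idempotents below f, and sandwiching by i and j undoes it.\<close>

lemma prim_idem_iso:
  assumes f: "prim_idem H f" and H: "H \<subseteq> carrier G"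
    and e: "e \<in> inv_mats H" "e \<star> e = e"
    and ij: "i \<in> inv_mats H" "j \<in> inv_mats H" "i \<star> j = e" "j \<star> i = f"
  shows "prim_idem H e"
  unfolding prim_idem_def
proof (intro conjI ballI impI e)
  have ifj: "i \<star> f \<star> j = e"
    using e ij by (metis mult_assoc)
  have ff: "f \<star> f = f" and f0: "f \<noteq> 0" using f by (auto simp: prim_idem_def)
  show "e \<noteq> 0"
  proof
    assume "e = 0"
    moreover have "f = j \<star> e \<star> i" using ff ij by (metis mult_assoc)
    ultimately show False using f0 by (simp add: mult_zero)
  qed
  fix a assume a: "a \<in> inv_mats H" "a \<star> a = a" "e \<star> a = a" "a \<star> e = a"
  let ?a = "j \<star> a \<star> i"
  have "?a \<in> inv_mats H" using a ij H mult_inv_mats by metis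
  moreover have "?a \<star> ?a = ?a" by (metis a ij(3) mult_assoc)
  moreover have "f \<star> ?a = ?a" by (metis a(3) ij(3,4) mult_assoc)
  moreover have "?a \<star> f = ?a" by (metis a(4) ij(3,4) mult_assoc)
  ultimately have "?a = 0 \<or> ?a = f" using f by (auto simp: prim_idem_def)
  moreover have "a = i \<star> ?a \<star> j" by (metis a(3,4) ij(3) mult_assoc)
  ultimately show "a = 0 \<or> a = e" using ifj by (metis mult_zero)
qed

text \<open>Fitting's lemma for the corner algebra of a primitive idempotent \<open>e\<close>: the chain of the
  spaces \<open>a\<^sup>n B\<close>, \<open>B\<close> the centralizer of \<open>a\<close>, becomes stationary, whence
  \<open>a\<^sup>n = a\<^sup>2\<^sup>n b\<close> for some \<open>b\<close> in \<open>B\<close>, and \<open>a\<^sup>n b\<close> is idempotent.\<close>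

lemma prim_idem_fitting:
  assumes e: "prim_idem H e" and H: "H \<subseteq> carrier G"
    and a: "a \<in> inv_mats H" "e \<star> a = a" "a \<star> e = a"
    and nonnil: "\<And>n. (((\<star>) a) ^^ n) e \<noteq> 0"
  obtains c where "c \<in> inv_mats H" "e \<star> c = c" "c \<star> e = c" "c \<star> a = e" "a \<star> c = e"
proof -
  define pw where "pw n = (((\<star>) a) ^^ n) e" for n
  have e': "e \<in> inv_mats H" "e \<star> e = e" using e by (auto simp: prim_idem_def)
  have pw0: "pw 0 = e" and pwS: "pw (Suc n) = a \<star> pw n" for n by (auto simp: pw_def)
  have epw: "e \<star> pw n = pw n" for n
    by (induction n) (simp_all add: pw0 pwS e' a flip: mult_assoc)
  have pwe: "pw n \<star> e = pw n" for n
    by (induction n) (simp_all add: pw0 pwS e' a mult_assoc)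
  have pw_add: "pw m \<star> pw n = pw (m + n)" for m n
    by (induction m) (simp_all add: pw0 pwS epw mult_assoc)
  have pw1: "pw 1 = a" using pwS[of 0] a pw0 by simp
  have pw_a: "pw n \<star> a = a \<star> pw n" for n using pw_add[of n 1] pw_add[of 1 n] pw1 by simp
  have pw_inv: "pw n \<in> inv_mats H" for n
    by (induction n) (use mult_inv_mats H a e' in \<open>auto simp: pw0 pwS\<close>)
  define B where "B = {b \<in> inv_mats H. e \<star> b = b \<and> b \<star> e = b \<and> a \<star> b = b \<star> a}"
  have pwB: "pw n \<star> b \<in> B" if "b \<in> B" for n b
  proof -
    have b: "b \<in> inv_mats H" "e \<star> b = b" "b \<star> e = b" "a \<star> b = b \<star> a"
      using that by (auto simp: B_def)
    have "a \<star> (pw n \<star> b) = pw n \<star> a \<star> b" by (simp add: pw_a flip: mult_assoc)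
    also have "\<dots> = (pw n \<star> b) \<star> a" using b by (simp add: mult_assoc)
    finally have "a \<star> (pw n \<star> b) = (pw n \<star> b) \<star> a" .
    moreover have "e \<star> (pw n \<star> b) = pw n \<star> b" by (simp add: epw flip: mult_assoc)
    moreover have "(pw n \<star> b) \<star> e = pw n \<star> b" using b by (simp add: mult_assoc)
    ultimately show ?thesis using mult_inv_mats[OF pw_inv b(1) H] by (simp add: B_def)
  qed
  have eB: "e \<in> B" using e' a by (simp add: B_def)
  have pw_comm: "pw n \<star> b = b \<star> pw n" if "b \<in> B" for n b
  proof (induction n)
    case 0 then show ?case using that by (simp add: pw0 B_def)
  next
    case (Suc n)
    have "pw (Suc n) \<star> b = (a \<star> b) \<star> pw n" using Suc by (simp add: pwS mult_assoc)
    also have "\<dots> = b \<star> pw (Suc n)" using that by (simp add: pwS B_def mult_assoc)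
    finally show ?case .
  qed
  \<comment> \<open>The matrices are read as functions on pairs so that the chain lemma, which
    concerns functions of one argument, applies.\<close>
  define W where "W n = (\<lambda>b. \<lambda>(x, y). (pw n \<star> b) x y) ` B" for n
  have Wmem: "f \<in> W n \<longleftrightarrow> (\<exists>b\<in>B. f = (\<lambda>(x, y). (pw n \<star> b) x y))" for f n
    by (auto simp: W_def)
  have "\<exists>n. \<forall>m\<ge>n. W m = W n"
  proof (rule subspace_chain_stable[of "X \<times> X" W])
    show "finite (X \<times> X)" using finite_points by simp
    show "lin_subspace (W m)" for m
    proof (rule lin_subspaceI)
      have "0 \<in> B" by (auto simp: B_def mult_zero inv_mats_def)
      then show "0 \<in> W m" unfolding Wmem by (rule bexI[rotated]) (auto simp: mult_zero)
      fix f h assume "f \<in> W m" "h \<in> W m"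
      then obtain b c where bc: "b \<in> B" "c \<in> B" "f = (\<lambda>(x, y). (pw m \<star> b) x y)" "h = (\<lambda>(x, y). (pw m \<star> c) x y)"
        unfolding Wmem by blast
      then have "b + c \<in> B" by (auto simp: B_def add_inv_mats mult_add_left mult_add_right)
      then show "f + h \<in> W m" unfolding Wmem using bc by (intro bexI[of _ "b + c"]) (auto simp: mult_add_right)
    next
      fix r f assume "f \<in> W m"
      then obtain b where b: "b \<in> B" "f = (\<lambda>(x, y). (pw m \<star> b) x y)" unfolding Wmem by blast
      then have "(\<lambda>x y. r * b x y) \<in> B" by (auto simp: B_def scale_inv_mats mult_scale)
      then show "(\<lambda>x. r * f x) \<in> W m" unfolding Wmem using b
        by (intro bexI[of _ "\<lambda>x y. r * b x y"]) (auto simp: mult_scale)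
    qed
    show "f z = 0" if "f \<in> W m" "z \<notin> X \<times> X" for m f z
      using that pwB inv_mats_supp unfolding Wmem B_def by (cases z) fastforce
    show "W (Suc m) \<subseteq> W m" for m
    proof
      fix f assume "f \<in> W (Suc m)"
      then obtain b where b: "b \<in> B" "f = (\<lambda>(x, y). (pw (Suc m) \<star> b) x y)" unfolding Wmem by blast
      then have "pw (Suc m) \<star> b = pw m \<star> (pw 1 \<star> b)"
        using pw_add[of m 1] by (simp flip: mult_assoc)
      then show "f \<in> W m" using b pwB unfolding Wmem by metis
    qed
  qed
  then obtain n where n: "\<And>m. n \<le> m \<Longrightarrow> W m = W n" by blast
  \<comment> \<open>The exponent is taken positive so that one factor a can be split off:
    \<open>pw (Suc n) \<star> b = a \<star> (pw n \<star> b)\<close>. Once the left side is known to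
    be e, \<open>pw n \<star> b\<close> is the inverse of a.\<close>
  let ?n = "Suc n"
  have "(\<lambda>(x, y). (pw ?n \<star> e) x y) \<in> W ?n" using eB Wmem by blast
  also have "W ?n = W (?n + ?n)" using n[of ?n] n[of "?n + ?n"] by simp
  finally obtain b where b: "b \<in> B" "(\<lambda>(x, y). (pw ?n \<star> e) x y) = (\<lambda>(x, y). (pw (?n + ?n) \<star> b) x y)"
    unfolding Wmem by blast
  have pwn: "pw ?n = pw (?n + ?n) \<star> b"
  proof (intro ext)
    fix x y
    show "pw ?n x y = (pw (?n + ?n) \<star> b) x y" using fun_cong[OF b(2), of "(x, y)"] pwe[of ?n] by simp
  qed
  let ?i = "pw ?n \<star> b"
  have "?i \<star> ?i = pw ?n \<star> (b \<star> pw ?n) \<star> b" by (simp add: mult_assoc)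
  also have "\<dots> = pw (?n + ?n) \<star> b \<star> b"
    unfolding pw_comm[OF b(1), of ?n, symmetric] pw_add[of ?n ?n, symmetric] by (simp only: mult_assoc)
  also have "\<dots> = ?i" using pwn by simp
  finally have "?i \<star> ?i = ?i" .
  moreover have iB: "?i \<in> B" using pwB b by blast
  ultimately have "?i = 0 \<or> ?i = e" using e by (auto simp: prim_idem_def B_def)
  moreover have "?i \<noteq> 0"
  proof
    assume "?i = 0"
    then have "pw (?n + ?n) \<star> b = 0"
      unfolding pw_add[of ?n ?n, symmetric] mult_assoc by (simp only: mult_zero)
    then have "pw ?n = 0" using pwn by (rule trans[rotated])
    then show False using nonnil[of ?n] by (simp only: pw_def)
  qed
  ultimately have ie: "?i = e" by blast
  let ?c = "pw n \<star> b"
  have c: "?c \<in> inv_mats H" "e \<star> ?c = ?c" "?c \<star> e = ?c" "a \<star> ?c = ?c \<star> a"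
    using pwB[OF b(1), of n] unfolding B_def by blast+
  have ac: "a \<star> ?c = e" using ie by (simp add: pwS mult_assoc)
  show thesis by (rule that[OF c(1-3) trans[OF c(4)[symmetric] ac] ac])
qed

text \<open>The idempotent is b followed by the projection onto A along B. The projection is chosen
  pointwise by \<open>SOME\<close>; uniqueness of the component in A, from A and B meeting in 0,
  gives its linearity and equivariance.\<close>

lemma idem_of_decomposition:
  fixes A B :: "('x \<Rightarrow> 'k::field) set"
  assumes b: "b \<in> inv_mats H" "b \<star> b = b" and H: "H \<subseteq> carrier G"
    and A: "lin_subspace A" "\<And>h F. h \<in> H \<Longrightarrow> F \<in> A \<Longrightarrow> transl h F \<in> A"
    and B: "lin_subspace B" "\<And>h F. h \<in> H \<Longrightarrow> F \<in> B \<Longrightarrow> transl h F \<in> B"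
    and sum: "ssum A B = range (mat_app b)" and int: "A \<inter> B = {0}"
  obtains a where "a \<in> inv_mats H" "a \<star> a = a" "b \<star> a = a" "a \<star> b = a" "range (mat_app a) = A"
proof -
  have ex: "\<exists>\<alpha>. \<alpha> \<in> A \<and> mat_app b F - \<alpha> \<in> B" for F
  proof -
    have "mat_app b F \<in> ssum A B" using sum by auto
    then obtain \<alpha> \<beta> where "\<alpha> \<in> A" "\<beta> \<in> B" "mat_app b F = \<alpha> + \<beta>" unfolding ssum_eq by blast
    then have "mat_app b F - \<alpha> \<in> B" by simp
    then show ?thesis using \<open>\<alpha> \<in> A\<close> by blast
  qed
  define pr where "pr F = (SOME \<alpha>. \<alpha> \<in> A \<and> mat_app b F - \<alpha> \<in> B)" for F
  have pr: "pr F \<in> A" "mat_app b F - pr F \<in> B" for F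
    using someI_ex[OF ex[of F]] by (auto simp: pr_def)
  have pr_unique: "pr F = \<alpha>" if "\<alpha> \<in> A" "mat_app b F - \<alpha> \<in> B" for F \<alpha>
  proof -
    have "pr F - \<alpha> \<in> A" using pr that lin_subspace_diff[OF A(1)] by blast
    moreover have "(mat_app b F - \<alpha>) - (mat_app b F - pr F) \<in> B"
      using pr that lin_subspace_diff[OF B(1)] by blast
    moreover have "(mat_app b F - \<alpha>) - (mat_app b F - pr F) = pr F - \<alpha>" by simp
    ultimately have "pr F - \<alpha> = 0" using int by force
    then show ?thesis by simp
  qed
  have in_range: "mat_app b F = F" if "F \<in> A \<or> F \<in> B" for F
  proof -
    have "F + 0 \<in> ssum A B \<or> 0 + F \<in> ssum A B"
      using that lin_subspace_zero[OF A(1)] lin_subspace_zero[OF B(1)] unfolding ssum_eq by blast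
    then obtain F' where "F = mat_app b F'" using sum by auto
    then show ?thesis using b by (simp flip: app_mult)
  qed
  have pr_add: "pr (F + F') = pr F + pr F'" for F F'
  proof (rule pr_unique)
    show "pr F + pr F' \<in> A" using pr lin_subspace_add[OF A(1)] by blast
    have "mat_app b (F + F') - (pr F + pr F') = (mat_app b F - pr F) + (mat_app b F' - pr F')"
      by (simp add: app_add)
    then show "mat_app b (F + F') - (pr F + pr F') \<in> B"
      using lin_subspace_add[OF B(1) pr(2)[of F] pr(2)[of F']] by (simp only:)
  qed
  have pr_scale: "pr (\<lambda>x. c * F x) = (\<lambda>x. c * pr F x)" for c F
  proof (rule pr_unique)
    show "(\<lambda>x. c * pr F x) \<in> A" using pr lin_subspace_scale[OF A(1)] by blast
    have "mat_app b (\<lambda>x. c * F x) - (\<lambda>x. c * pr F x) = (\<lambda>x. c * (mat_app b F - pr F) x)"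
      by (auto simp: app_scale fun_eq_iff right_diff_distrib)
    then show "mat_app b (\<lambda>x. c * F x) - (\<lambda>x. c * pr F x) \<in> B"
      using lin_subspace_scale[OF B(1) pr(2)[of F]] by (simp only:)
  qed
  have pr_zero: "pr 0 = 0"
    using pr_unique[of 0 0] lin_subspace_zero[OF A(1)] lin_subspace_zero[OF B(1)] by (simp add: app_zero)
  have pr_sum: "pr (\<lambda>x. \<Sum>y\<in>Z. F y x) = (\<lambda>x. \<Sum>y\<in>Z. pr (F y) x)" if "finite Z" for Z :: "'x set" and F
    using that
  proof (induction Z)
    case empty
    show ?case using pr_zero by (simp add: zero_fun_def)
  next
    case (insert z Z)
    have "(\<lambda>x. \<Sum>y\<in>insert z Z. F y x) = F z + (\<lambda>x. \<Sum>y\<in>Z. F y x)"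
      using insert.hyps by (simp add: fun_eq_iff)
    then have "pr (\<lambda>x. \<Sum>y\<in>insert z Z. F y x) = pr (F z) + (\<lambda>x. \<Sum>y\<in>Z. pr (F y) x)"
      using pr_add insert.IH by simp
    then show ?case using insert.hyps by (simp add: fun_eq_iff)
  qed
  have pr_cong: "pr F = pr F'" if "\<And>x. x \<in> X \<Longrightarrow> F x = F' x" for F F'
    using app_cong[OF that] by (simp add: pr_def)
  \<comment> \<open>The columns of the matrix are the projections of the delta functions; since
    \<open>pr F\<close> depends only on F within X, linearity extends this to all F.\<close>
  define a where "a x y = (if x \<in> X \<and> y \<in> X then pr (\<lambda>z. if z = y then 1 else 0) x else 0)" for x y
  have pr_supp: "pr F x = 0" if "x \<notin> X" for F x
    using in_range[of "pr F"] pr(1) app_supp[OF b(1) that, of "pr F"] by metis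
  have app_a: "mat_app a F = pr F" for F
  proof -
    have "pr F = pr (\<lambda>x. \<Sum>y\<in>X. F y * (if x = y then 1 else 0))"
      by (rule pr_cong) (simp add: finite_points if_distrib[of "\<lambda>t. _ * t"] cong: if_cong)
    also have "\<dots> = (\<lambda>x. \<Sum>y\<in>X. F y * pr (\<lambda>z. if z = y then 1 else 0) x)"
      using pr_sum[OF finite_points, of "\<lambda>y x. F y * (if x = y then 1 else 0)"] by (simp only: pr_scale)
    also have "\<dots> = mat_app a F"
      using pr_supp by (auto simp: mat_app_def a_def fun_eq_iff mult.commute intro!: sum.cong)
    finally show ?thesis by simp
  qed
  have a_inv: "a \<in> inv_mats H"
  proof (rule inv_matsI[OF _ H])
    show "x \<in> X \<and> y \<in> X" if "a x y \<noteq> 0" for x y using that by (simp add: a_def split: if_splits)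
    fix h F assume h: "h \<in> H"
    have hG: "h \<in> carrier G" using h H by auto
    have "transl h (mat_app b F) - transl h (pr F) = transl h (mat_app b F - pr F)"
      by (auto simp: transl_def fun_eq_iff)
    then have "pr (transl h F) = transl h (pr F)"
      using A(2)[OF h pr(1)[of F]] B(2)[OF h pr(2)[of F]] by (intro pr_unique) (simp_all add: app_transl[OF b(1) h hG])
    then show "mat_app a (transl h F) = transl h (mat_app a F)" by (simp add: app_a)
  qed
  have pr_A: "pr F = F" if "F \<in> A" for F
    using that in_range[of F] lin_subspace_zero[OF B(1)] by (intro pr_unique) auto
  have 1: "a \<star> a = a"
    by (rule mat_eqI[OF mult_inv_mats[OF a_inv a_inv H] a_inv]) (simp add: app_mult app_a pr_A pr)
  have 2: "b \<star> a = a"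
    by (rule mat_eqI[OF mult_inv_mats[OF b(1) a_inv H] a_inv]) (simp add: app_mult app_a in_range pr)
  have 3: "a \<star> b = a"
  proof (rule mat_eqI[OF mult_inv_mats[OF a_inv b(1) H] a_inv])
    fix F :: "'x \<Rightarrow> 'k"
    have "mat_app b (mat_app b F) = mat_app b F" using b by (simp flip: app_mult)
    then show "mat_app (a \<star> b) F = mat_app a F" by (simp add: app_mult app_a pr_def)
  qed
  have 4: "range (mat_app a) = A"
  proof
    show "range (mat_app a) \<subseteq> A" using pr by (auto simp: app_a)
    show "A \<subseteq> range (mat_app a)" using pr_A app_a by (metis rangeI subsetI)
  qed
  show thesis by (rule that[OF a_inv 1 2 3 4])
qed

text \<open>The map \<rho> identifies V/W with the image of b, so direct decompositions of V over W
  correspond to idempotents below b. The map is left abstract because the criterion is applied both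
  to modules of functions on cosets, with W = 0, and to Brauer quotients, with W the kernel of
  restriction to fixed points.\<close>

lemma indec_quot_iff_prim_idem:
  fixes \<rho> :: "('g \<Rightarrow> 'k::field) \<Rightarrow> 'x \<Rightarrow> 'k"
  assumes b: "b \<in> inv_mats H" "b \<star> b = b" and H: "H \<subseteq> carrier G"
    and V: "submodule G H V"
    and add: "\<And>v w. v \<in> V \<Longrightarrow> w \<in> V \<Longrightarrow> \<rho> (v + w) = \<rho> v + \<rho> w"
    and scale: "\<And>c v. v \<in> V \<Longrightarrow> \<rho> (\<lambda>x. c * v x) = (\<lambda>x. c * \<rho> v x)"
    and equiv: "\<And>h v. h \<in> H \<Longrightarrow> v \<in> V \<Longrightarrow> \<rho> (gact G h v) = transl h (\<rho> v)"
    and range: "\<rho> ` V = range (mat_app b)"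
    and W: "W = {v \<in> V. \<rho> v = 0}"
  shows "indec_quot G H V W \<longleftrightarrow> prim_idem H b"
proof -
  have Vs: "lin_subspace V" and Vg: "\<And>h v. h \<in> H \<Longrightarrow> v \<in> V \<Longrightarrow> gact G h v \<in> V"
    using V by (auto simp: submodule_def)
  have diff: "\<rho> (v - w) = \<rho> v - \<rho> w" if "v \<in> V" "w \<in> V" for v w
    using add[of "v - w" w] that lin_subspace_diff[OF Vs that] by simp
  have zero: "\<rho> 0 = 0" using scale[OF lin_subspace_zero[OF Vs], of 0] by (simp add: fun_eq_iff zero_fun_def)
  have rho_range: "mat_app b (\<rho> v) = \<rho> v" if v: "v \<in> V" for v
  proof -
    obtain F where "\<rho> v = mat_app b F" using range v by blast
    then show ?thesis using b by (simp flip: app_mult)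
  qed
  have b0: "b \<noteq> 0 \<longleftrightarrow> W \<subset> V"
  proof
    assume "b \<noteq> 0"
    have "\<exists>F. mat_app b F \<noteq> 0"
    proof (rule ccontr)
      assume "\<not> ?thesis"
      then have "b = 0" by (intro mat_eqI[of b H 0 H]) (use b in \<open>auto simp: app_zero_mat inv_mats_def\<close>)
      then show False using \<open>b \<noteq> 0\<close> by simp
    qed
    then obtain F where F: "mat_app b F \<noteq> 0" by blast
    obtain v where "v \<in> V" "\<rho> v = mat_app b F" using range by (metis imageE rangeI)
    with F have "v \<in> V" "v \<notin> W" using W by auto
    then show "W \<subset> V" using W by blast
  next
    assume "W \<subset> V"
    then obtain v where "v \<in> V" "\<rho> v \<noteq> 0" using W by auto
    then show "b \<noteq> 0" using rho_range app_zero_mat by metis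
  qed
  show ?thesis
  proof
    assume ind: "indec_quot G H V W"
    show "prim_idem H b"
      unfolding prim_idem_def
    proof (intro conjI ballI impI b)
      show "b \<noteq> 0" using ind b0 by (simp add: indec_quot_def)
      fix a assume a: "a \<in> inv_mats H" "a \<star> a = a" "b \<star> a = a" "a \<star> b = a"
      \<comment> \<open>Preimages in V of the image and of the kernel of a; both contain the kernel
        W of \<rho>.\<close>
      define A where "A = {v \<in> V. mat_app a (\<rho> v) = \<rho> v}"
      define B where "B = {v \<in> V. mat_app a (\<rho> v) = 0}"
      have "submodule G H A" unfolding submodule_def
      proof (intro conjI lin_subspaceI ballI)
        show "0 \<in> A" using lin_subspace_zero[OF Vs] by (simp add: A_def zero app_zero)
        show "f + h \<in> A" if "f \<in> A" "h \<in> A" for f h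
          using that lin_subspace_add[OF Vs] by (simp add: A_def add app_add)
        show "(\<lambda>x. c * f x) \<in> A" if "f \<in> A" for c f
          using that lin_subspace_scale[OF Vs] by (simp add: A_def scale app_scale)
        show "gact G h v \<in> A" if "h \<in> H" "v \<in> A" for h v
          using that Vg H app_transl[OF a(1)] by (auto simp: A_def equiv)
      qed
      moreover have "submodule G H B" unfolding submodule_def
      proof (intro conjI lin_subspaceI ballI)
        show "0 \<in> B" using lin_subspace_zero[OF Vs] by (simp add: B_def zero app_zero)
        show "f + h \<in> B" if "f \<in> B" "h \<in> B" for f h
          using that lin_subspace_add[OF Vs] by (simp add: B_def add app_add)
        show "(\<lambda>x. c * f x) \<in> B" if "f \<in> B" for c f
          using that lin_subspace_scale[OF Vs] by (simp add: B_def scale app_scale fun_eq_iff)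
        show "gact G h v \<in> B" if "h \<in> H" "v \<in> B" for h v
        proof -
          have "mat_app a (\<rho> (gact G h v)) = transl h (mat_app a (\<rho> v))"
            using that H app_transl[OF a(1)] by (auto simp: B_def equiv)
          also have "\<dots> = 0" using that by (simp add: B_def transl_def fun_eq_iff)
          finally show ?thesis using that Vg by (simp add: B_def)
        qed
      qed
      moreover have "W \<subseteq> A" "W \<subseteq> B" using W by (auto simp: A_def B_def app_zero)
      moreover have split: "\<exists>v'\<in>A. v - v' \<in> B \<and> \<rho> v' = mat_app a (\<rho> v)" if v: "v \<in> V" for v
      proof -
        have "mat_app a (\<rho> v) = mat_app b (mat_app a (\<rho> v))" using a(3) by (simp flip: app_mult)
        then obtain v' where v': "v' \<in> V" "\<rho> v' = mat_app a (\<rho> v)" using range by (metis imageE rangeI)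
        have aa: "mat_app a (mat_app a (\<rho> v)) = mat_app a (\<rho> v)" using a(2) by (simp flip: app_mult)
        have "v' \<in> A" "v - v' \<in> B" using v v' aa lin_subspace_diff[OF Vs]
          by (auto simp: A_def B_def diff app_diff)
        then show ?thesis using v' by blast
      qed
      moreover have "ssum A B = V"
      proof
        show "ssum A B \<subseteq> V" using lin_subspace_add[OF Vs] by (auto simp: ssum_eq A_def B_def)
        show "V \<subseteq> ssum A B"
        proof
          fix v assume "v \<in> V"
          then obtain v' where v': "v' \<in> A" "v - v' \<in> B" using split by blast
          moreover have "v = v' + (v - v')" by simp
          ultimately show "v \<in> ssum A B" unfolding ssum_eq by blast
        qed
      qed
      moreover have "A \<inter> B = W" using W by (auto simp: A_def B_def app_zero)
      ultimately have "A = W \<or> B = W" using ind unfolding indec_quot_def by blast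
      moreover have "a = 0" if "A = W"
      proof (rule mat_eqI[OF a(1), of 0 H])
        fix F
        obtain v where v: "v \<in> V" "\<rho> v = mat_app b F" using range by (metis imageE rangeI)
        obtain v' where "v' \<in> A" "\<rho> v' = mat_app a (\<rho> v)" using split v by blast
        then have "mat_app a (mat_app b F) = 0" using that W v by auto
        then show "mat_app a F = mat_app 0 F" using a(4) by (simp add: app_zero_mat flip: app_mult)
      qed (simp add: inv_mats_def)
      moreover have "a = b" if "B = W"
      proof (rule mat_eqI[OF a(1) b(1)])
        fix F
        obtain v where v: "v \<in> V" "\<rho> v = mat_app b F" using range by (metis imageE rangeI)
        obtain v' where v': "v' \<in> A" "v - v' \<in> B" "\<rho> v' = mat_app a (\<rho> v)" using split v by blast
        have "\<rho> v - \<rho> v' = 0" using v' v W that diff by (auto simp: A_def)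
        then have "mat_app a (mat_app b F) = mat_app b F" using v v' by simp
        then show "mat_app a F = mat_app b F" using a(4) by (simp flip: app_mult)
      qed
      ultimately show "a = 0 \<or> a = b" by blast
    qed
  next
    assume prim: "prim_idem H b"
    show "indec_quot G H V W"
      unfolding indec_quot_def
    proof (intro conjI notI)
      show "W \<subset> V" using prim b0 by (simp add: prim_idem_def)
      assume "\<exists>A B. submodule G H A \<and> submodule G H B \<and> W \<subseteq> A \<and> W \<subseteq> B \<and>
        ssum A B = V \<and> A \<inter> B = W \<and> A \<noteq> W \<and> B \<noteq> W"
      then obtain A B where A: "submodule G H A" and B: "submodule G H B"
        and WA: "W \<subseteq> A" and WB: "W \<subseteq> B" and AB: "ssum A B = V" "A \<inter> B = W" and ne: "A \<noteq> W" "B \<noteq> W"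
        by blast
      have As: "lin_subspace A" and Bs: "lin_subspace B" using A B by (auto simp: submodule_def)
      have AV: "A \<subseteq> V"
      proof
        fix v assume "v \<in> A"
        then have "v + 0 \<in> ssum A B" using lin_subspace_zero[OF Bs] unfolding ssum_eq by blast
        then show "v \<in> V" using AB by simp
      qed
      have BV: "B \<subseteq> V"
      proof
        fix v assume "v \<in> B"
        then have "0 + v \<in> ssum A B" using lin_subspace_zero[OF As] unfolding ssum_eq by blast
        then show "v \<in> V" using AB by simp
      qed
      have sub: "lin_subspace (\<rho> ` C)" "\<And>h F. h \<in> H \<Longrightarrow> F \<in> \<rho> ` C \<Longrightarrow> transl h F \<in> \<rho> ` C"
        if C: "submodule G H C" "C \<subseteq> V" for C
      proof -
        have Cs: "lin_subspace C" using C by (simp add: submodule_def)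
        show "lin_subspace (\<rho> ` C)"
        proof (rule lin_subspaceI)
          show "0 \<in> \<rho> ` C" using zero lin_subspace_zero[OF Cs] by force
          show "f + h \<in> \<rho> ` C" if fh: "f \<in> \<rho> ` C" "h \<in> \<rho> ` C" for f h
          proof -
            obtain v w where vw: "v \<in> C" "w \<in> C" "f = \<rho> v" "h = \<rho> w" using fh by blast
            have "f + h = \<rho> (v + w)" using add[of v w] subsetD[OF C(2)] vw by metis
            then show ?thesis using lin_subspace_add[OF Cs] vw by blast
          qed
          show "(\<lambda>x. c * f x) \<in> \<rho> ` C" if f: "f \<in> \<rho> ` C" for c f
          proof -
            obtain v where v: "v \<in> C" "f = \<rho> v" using f by blast
            have "(\<lambda>x. c * f x) = \<rho> (\<lambda>x. c * v x)" using scale[of v c] subsetD[OF C(2)] v by simp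
            then show ?thesis using lin_subspace_scale[OF Cs] v by blast
          qed
        qed
        show "transl h F \<in> \<rho> ` C" if F: "h \<in> H" "F \<in> \<rho> ` C" for h F
        proof -
          obtain v where v: "v \<in> C" "F = \<rho> v" using F by blast
          have "transl h F = \<rho> (gact G h v)" using equiv[of h v] subsetD[OF C(2)] F v by simp
          moreover have "gact G h v \<in> C" using C F v by (simp add: submodule_def)
          ultimately show ?thesis by blast
        qed
      qed
      have sum: "ssum (\<rho> ` A) (\<rho> ` B) = range (mat_app b)"
      proof -
        have "ssum (\<rho> ` A) (\<rho> ` B) = \<rho> ` ssum A B"
        proof
          show "ssum (\<rho> ` A) (\<rho> ` B) \<subseteq> \<rho> ` ssum A B"
          proof
            fix F assume "F \<in> ssum (\<rho> ` A) (\<rho> ` B)"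
            then obtain v w where vw: "v \<in> A" "w \<in> B" "F = \<rho> v + \<rho> w" unfolding ssum_eq by blast
            have "F = \<rho> (v + w)" using add[of v w] subsetD[OF AV] subsetD[OF BV] vw by metis
            then show "F \<in> \<rho> ` ssum A B" using vw unfolding ssum_eq by blast
          qed
          show "\<rho> ` ssum A B \<subseteq> ssum (\<rho> ` A) (\<rho> ` B)"
          proof
            fix F assume "F \<in> \<rho> ` ssum A B"
            then obtain v w where vw: "v \<in> A" "w \<in> B" "F = \<rho> (v + w)" unfolding ssum_eq by blast
            have "F = \<rho> v + \<rho> w" using add[of v w] subsetD[OF AV] subsetD[OF BV] vw by metis
            then show "F \<in> ssum (\<rho> ` A) (\<rho> ` B)" using vw unfolding ssum_eq by blast
          qed
        qed
        then show ?thesis using AB range by simp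
      qed
      have int: "\<rho> ` A \<inter> \<rho> ` B = {0}"
      proof
        show "{0} \<subseteq> \<rho> ` A \<inter> \<rho> ` B"
          using lin_subspace_zero[OF sub(1)[OF A AV]] lin_subspace_zero[OF sub(1)[OF B BV]] by simp
        show "\<rho> ` A \<inter> \<rho> ` B \<subseteq> {0}"
        proof
          fix F assume "F \<in> \<rho> ` A \<inter> \<rho> ` B"
          then obtain v w where vw: "v \<in> A" "w \<in> B" "F = \<rho> v" "F = \<rho> w" by auto
          have vwV: "v \<in> V" "w \<in> V" using vw AV BV by auto
          \<comment> \<open>Equal images determine v only up to the kernel; as W lies in B, v itself
            lies in the intersection of A and B.\<close>
          then have "v - w \<in> W" using W diff[OF vwV] vw lin_subspace_diff[OF Vs vwV] by simp
          then have "(v - w) + w \<in> B" using WB vw lin_subspace_add[OF Bs] by blast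
          then have "v \<in> W" using AB vw by auto
          then show "F \<in> {0}" using W vw by simp
        qed
      qed
      obtain a where a: "a \<in> inv_mats H" "a \<star> a = a" "b \<star> a = a" "a \<star> b = a" "range (mat_app a) = \<rho> ` A"
        using idem_of_decomposition[OF b H sub[OF A AV] sub[OF B BV] sum int] by blast
      have "a = 0 \<or> a = b" using prim a unfolding prim_idem_def by blast
      then show False
      proof
        assume "a = 0"
        then have "\<rho> ` A \<subseteq> {0}" using a(5) by (auto simp: app_zero_mat)
        then have "A \<subseteq> W" using AV W by auto
        then show False using ne WA by blast
      next
        assume "a = b"
        then have "\<rho> ` B \<subseteq> \<rho> ` A" using a(5) range BV by blast
        then have "\<rho> ` B \<subseteq> {0}" using int by blast
        then have "B \<subseteq> W" using BV W by auto
        then show False using ne WB by blast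
      qed
    qed
  qed
qed

section \<open>The Brauer homomorphism on invariant matrices\<close>

definition brauer_map :: "'g set \<Rightarrow> ('x \<Rightarrow> 'x \<Rightarrow> 'k::field) \<Rightarrow> 'x \<Rightarrow> 'x \<Rightarrow> 'k" where
  "brauer_map Q a = (\<lambda>x y. if x \<in> fix_points Q \<and> y \<in> fix_points Q then a x y else 0)"

lemma fix_points_subset: "fix_points Q \<subseteq> X"
  by (auto simp: fix_points_def)

lemma brauer_map_diff: "brauer_map Q (a - b) = brauer_map Q a - brauer_map Q b"
  and brauer_map_zero: "brauer_map Q 0 = 0"
  by (auto simp: brauer_map_def fun_eq_iff)

lemma brauer_map_twice: "Q \<subseteq> R \<Longrightarrow> brauer_map R (brauer_map Q a) = brauer_map R a"
  by (auto simp: brauer_map_def fun_eq_iff fix_points_def)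

lemma brauer_map_mult:
  fixes a b :: "'x \<Rightarrow> 'x \<Rightarrow> 'k::field"
  assumes p: "prime p" "CHAR('k) = p" and Q: "p_subgroup p G Q"
    and a: "a \<in> inv_mats Q" and b: "b \<in> inv_mats Q"
  shows "brauer_map Q (a \<star> b) = brauer_map Q a \<star> brauer_map Q b"
proof (intro ext)
  fix x z
  show "brauer_map Q (a \<star> b) x z = (brauer_map Q a \<star> brauer_map Q b) x z"
  proof (cases "x \<in> fix_points Q \<and> z \<in> fix_points Q")
    case True
    have QG: "q \<in> carrier G" if "q \<in> Q" for q using that Q by (auto simp: p_subgroup_def dest: subgroup.subset)
    have xz: "x \<in> X" "z \<in> X" "\<And>q. q \<in> Q \<Longrightarrow> act q x = x" "\<And>q. q \<in> Q \<Longrightarrow> act q z = z"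
      using True by (auto simp: fix_points_def)
    have "(a \<star> b) x z = (\<Sum>y\<in>X \<inter> fix_points Q. a x y * b y z)"
      unfolding mat_mult_def
    proof (rule sum_eq_sum_fixed[OF p Q])
      fix q y assume q: "q \<in> Q" and y: "y \<in> X"
      show "act q y \<in> X" using act_closed QG q y by blast
      show "a x (act q y) * b (act q y) z = a x y * b y z"
        using inv_mats_act[OF a q xz(1) y] inv_mats_act[OF b q y xz(2)] xz q by simp
    qed simp
    also have "\<dots> = (\<Sum>y\<in>X. brauer_map Q a x y * brauer_map Q b y z)"
      using True finite_points by (intro sum.mono_neutral_cong_left) (auto simp: brauer_map_def)
    finally show ?thesis using True by (simp add: brauer_map_def mat_mult_def)
  next
    case False
    then show ?thesis by (auto simp: brauer_map_def mat_mult_def)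
  qed
qed

text \<open>For invariant F the sum defining \<open>mat_app a F\<close> at a fixed point collapses
  to the fixed points. With F constant this carries the property of fixing the constant function
  from e to its restrictions.\<close>

lemma mat_app_brauer_map:
  fixes a :: "'x \<Rightarrow> 'x \<Rightarrow> 'k::field"
  assumes p: "prime p" "CHAR('k) = p" and Q: "p_subgroup p G Q"
    and a: "a \<in> inv_mats Q" and F: "\<And>q y. q \<in> Q \<Longrightarrow> y \<in> X \<Longrightarrow> F (act q y) = F y"
    and x: "x \<in> fix_points Q"
  shows "mat_app (brauer_map Q a) F x = mat_app a F x"
proof -
  have QG: "q \<in> carrier G" if "q \<in> Q" for q using that Q by (auto simp: p_subgroup_def dest: subgroup.subset)
  have xX: "x \<in> X" "\<And>q. q \<in> Q \<Longrightarrow> act q x = x" using x by (auto simp: fix_points_def)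
  have "mat_app a F x = (\<Sum>y\<in>X \<inter> fix_points Q. a x y * F y)"
    unfolding mat_app_def
  proof (rule sum_eq_sum_fixed[OF p Q])
    fix q y assume q: "q \<in> Q" and y: "y \<in> X"
    show "act q y \<in> X" using act_closed QG q y by blast
    show "a x (act q y) * F (act q y) = a x y * F y"
      using inv_mats_act[OF a q xX(1) y] xX(2)[OF q] F[OF q y] by simp
  qed simp
  also have "\<dots> = (\<Sum>y\<in>X. brauer_map Q a x y * F y)"
    using x finite_points by (intro sum.mono_neutral_cong_left) (auto simp: brauer_map_def)
  finally show ?thesis by (simp add: mat_app_def)
qed

lemma act_conjg:
  assumes "g \<in> carrier G" "q \<in> carrier G" "x \<in> X"
  shows "act (conjg G g q) (act g x) = act g (act q x)"
proof -
  have "act (conjg G g q) (act g x) = act (g \<otimes> q \<otimes> inv g \<otimes> g) x"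
    using assms by (simp add: conjg_def act_mult)
  also have "g \<otimes> q \<otimes> inv g \<otimes> g = g \<otimes> q" using assms by (simp add: m_assoc)
  finally show ?thesis using assms by (simp add: act_mult)
qed

lemma fix_points_conj:
  assumes g: "g \<in> carrier G" and Q: "Q \<subseteq> carrier G" and x: "x \<in> X"
  shows "act g x \<in> fix_points (conj_set G g Q) \<longleftrightarrow> x \<in> fix_points Q"
proof -
  have "act (conjg G g q) (act g x) = act g x \<longleftrightarrow> act q x = x" if "q \<in> Q" for q
    using act_conjg[OF g _ x] act_inject[OF g] x act_closed that Q by auto
  then show ?thesis using x act_closed[OF g x] by (auto simp: fix_points_def conj_set_def)
qed

lemma brauer_map_inv_mats:
  assumes a: "a \<in> inv_mats H" and Q: "Q \<subseteq> carrier G"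
    and H: "\<And>h. h \<in> H \<Longrightarrow> h \<in> carrier G \<and> conj_set G h Q = Q"
  shows "brauer_map Q a \<in> inv_mats H"
proof -
  have "act h x \<in> fix_points Q \<longleftrightarrow> x \<in> fix_points Q" if "h \<in> H" "x \<in> X" for h x
    using fix_points_conj[OF _ Q that(2), of h] H[OF that(1)] by simp
  then show ?thesis using a fix_points_subset
    by (auto simp: inv_mats_def brauer_map_def split: if_splits)
qed

end

section \<open>Conjugation, normalizers and saturation\<close>

context group
begin

lemma conjg_closed: "\<lbrakk>g \<in> carrier G; x \<in> carrier G\<rbrakk> \<Longrightarrow> conjg G g x \<in> carrier G"
  by (simp add: conjg_def)

lemma conjg_one: "x \<in> carrier G \<Longrightarrow> conjg G \<one> x = x"
  by (simp add: conjg_def)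

lemma conjg_conjg:
  "\<lbrakk>g \<in> carrier G; h \<in> carrier G; x \<in> carrier G\<rbrakk> \<Longrightarrow> conjg G (g \<otimes> h) x = conjg G g (conjg G h x)"
  by (simp add: conjg_def m_assoc inv_mult_group)

lemma conjg_mult:
  "\<lbrakk>g \<in> carrier G; x \<in> carrier G; y \<in> carrier G\<rbrakk> \<Longrightarrow> conjg G g (x \<otimes> y) = conjg G g x \<otimes> conjg G g y"
  by (simp add: conjg_def m_assoc inv_solve_left)

lemma conjg_m_inv:
  "\<lbrakk>g \<in> carrier G; x \<in> carrier G\<rbrakk> \<Longrightarrow> conjg G g (inv x) = inv (conjg G g x)"
  by (simp add: conjg_def m_assoc inv_mult_group)

lemma conjg_inv_conjg:
  assumes "g \<in> carrier G" "x \<in> carrier G"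
  shows "conjg G (inv g) (conjg G g x) = x" "conjg G g (conjg G (inv g) x) = x"
  using assms conjg_conjg[of "inv g" g x] conjg_conjg[of g "inv g" x] conjg_one by simp_all

lemma conjg_inj_on: "g \<in> carrier G \<Longrightarrow> Q \<subseteq> carrier G \<Longrightarrow> inj_on (conjg G g) Q"
  by (rule inj_onI) (metis conjg_inv_conjg(1) subsetD)

lemma conj_set_closed: "g \<in> carrier G \<Longrightarrow> Q \<subseteq> carrier G \<Longrightarrow> conj_set G g Q \<subseteq> carrier G"
  by (auto simp: conj_set_def conjg_closed)

lemma conj_set_one: "Q \<subseteq> carrier G \<Longrightarrow> conj_set G \<one> Q = Q"
  by (auto simp: conj_set_def conjg_one image_iff subset_iff)

lemma conj_set_mult:
  "\<lbrakk>g \<in> carrier G; h \<in> carrier G; Q \<subseteq> carrier G\<rbrakk> \<Longrightarrow>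
    conj_set G (g \<otimes> h) Q = conj_set G g (conj_set G h Q)"
  unfolding conj_set_def image_image by (rule image_cong[OF refl]) (auto intro!: conjg_conjg)

lemma conj_set_mono: "Q \<subseteq> R \<Longrightarrow> conj_set G g Q \<subseteq> conj_set G g R"
  by (auto simp: conj_set_def)

lemma conj_set_inv:
  assumes "g \<in> carrier G" "Q \<subseteq> carrier G"
  shows "conj_set G (inv g) (conj_set G g Q) = Q" "conj_set G g (conj_set G (inv g) Q) = Q"
  using assms conj_set_mult[of "inv g" g Q] conj_set_mult[of g "inv g" Q] conj_set_one by simp_all

lemma card_conj_set: "g \<in> carrier G \<Longrightarrow> Q \<subseteq> carrier G \<Longrightarrow> card (conj_set G g Q) = card Q"
  unfolding conj_set_def by (rule card_image[OF conjg_inj_on])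

lemma conj_set_eqI:
  assumes "finite Q" "Q \<subseteq> carrier G" "g \<in> carrier G" "conj_set G g Q \<subseteq> Q"
  shows "conj_set G g Q = Q"
  by (rule card_subset_eq[OF assms(1,4) card_conj_set[OF assms(3,2)]])

lemma conj_set_subgroup:
  assumes "g \<in> carrier G" "subgroup Q G"
  shows "subgroup (conj_set G g Q) G"
proof (rule subgroupI)
  interpret Q: subgroup Q G by fact
  show "conj_set G g Q \<subseteq> carrier G" using assms conj_set_closed Q.subset by blast
  show "conj_set G g Q \<noteq> {}" using Q.one_closed unfolding conj_set_def by blast
  fix a assume "a \<in> conj_set G g Q"
  then obtain x where x: "x \<in> Q" "a = conjg G g x" unfolding conj_set_def by blast
  have "inv a = conjg G g (inv x)" using x assms conjg_m_inv[of g x] by simp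
  then show "inv a \<in> conj_set G g Q" using Q.m_inv_closed[OF x(1)] unfolding conj_set_def by blast
  fix b assume "b \<in> conj_set G g Q"
  then obtain y where y: "y \<in> Q" "b = conjg G g y" unfolding conj_set_def by blast
  have "a \<otimes> b = conjg G g (x \<otimes> y)" using x y assms conjg_mult[of g x y] by simp
  then show "a \<otimes> b \<in> conj_set G g Q" using Q.m_closed[OF x(1) y(1)] unfolding conj_set_def by blast
qed

lemma conj_set_p_subgroup:
  assumes "g \<in> carrier G" "p_subgroup p G Q"
  shows "p_subgroup p G (conj_set G g Q)"
  using assms conj_set_subgroup[of g Q] card_conj_set[of g Q] subgroup.subset[of Q G]
  by (simp add: p_subgroup_def conj_set_def)

lemma normalizer_in_subgroup:
  assumes "subgroup H G" "Q \<subseteq> carrier G"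
  shows "subgroup (normalizer_in G H Q) G"
proof (rule subgroupI)
  interpret H: subgroup H G by fact
  show "normalizer_in G H Q \<subseteq> carrier G" using H.subset by (auto simp: normalizer_in_def)
  show "normalizer_in G H Q \<noteq> {}" using conj_set_one[OF assms(2)] H.one_closed unfolding normalizer_in_def by blast
  show "inv a \<in> normalizer_in G H Q" if "a \<in> normalizer_in G H Q" for a
    using that conj_set_inv(1)[OF _ assms(2), of a] by (auto simp: normalizer_in_def)
  show "a \<otimes> b \<in> normalizer_in G H Q" if "a \<in> normalizer_in G H Q" "b \<in> normalizer_in G H Q" for a b
    using that conj_set_mult[OF _ _ assms(2), of a b] by (auto simp: normalizer_in_def)
qed

lemma centralizer_in_iff:
  assumes "Q \<subseteq> carrier G"
  shows "g \<in> centralizer_in G (carrier G) Q \<longleftrightarrow> g \<in> carrier G \<and> (\<forall>q\<in>Q. conjg G g q = q)"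
proof -
  have "g \<otimes> q = q \<otimes> g \<longleftrightarrow> conjg G g q = q" if "g \<in> carrier G" "q \<in> Q" for q
    using that assms unfolding conjg_def
    by (metis inv_solve_right m_closed subsetD)
  then show ?thesis by (auto simp: centralizer_in_def)
qed

lemma subgroup_self_normalizing:
  assumes "subgroup Q G" "g \<in> Q"
  shows "conj_set G g Q = Q"
proof -
  interpret Q: subgroup Q G by fact
  have 1: "conj_set G g Q \<subseteq> Q" if "g \<in> Q" for g using that by (auto simp: conj_set_def conjg_def)
  have "Q = conj_set G g (conj_set G (inv g) Q)" using conj_set_inv assms Q.subset by auto
  also have "\<dots> \<subseteq> conj_set G g Q" using 1[of "inv g"] assms conj_set_mono by simp
  finally show ?thesis using 1[OF assms(2)] by blast
qed

lemma set_prod_centralizer_normalizes: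
  assumes "subgroup Q G" "h \<in> set_prod G Q (centralizer_in G (carrier G) Q)"
  shows "h \<in> carrier G \<and> conj_set G h Q = Q"
proof -
  interpret Q: subgroup Q G by fact
  obtain q c where h: "h = q \<otimes> c" "q \<in> Q" "c \<in> centralizer_in G (carrier G) Q"
    using assms(2) by (auto simp: set_prod_def)
  then have c: "c \<in> carrier G" "\<forall>x\<in>Q. conjg G c x = x" using centralizer_in_iff[OF Q.subset] by auto
  then have "conj_set G c Q = Q" by (auto simp: conj_set_def)
  then have "conj_set G h Q = Q"
    using conj_set_mult[of q c Q] h c Q.subset subgroup_self_normalizing[OF assms(1)] by auto
  then show ?thesis using h c by auto
qed

section \<open>Left cosets as a set with group action\<close>

lemma lcoset_eq_iff:
  assumes "subgroup P G" "x \<in> carrier G" "y \<in> carrier G"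
  shows "x <# P = y <# P \<longleftrightarrow> inv y \<otimes> x \<in> P"
proof
  interpret P: subgroup P G by fact
  assume "x <# P = y <# P"
  moreover have "x \<in> x <# P" unfolding l_coset_def using P.one_closed assms by force
  ultimately obtain h where h: "h \<in> P" "x = y \<otimes> h" by (auto simp: l_coset_def)
  then have "inv y \<otimes> x = h" using assms inv_solve_left P.mem_carrier by (metis m_assoc inv_closed l_inv l_one)
  then show "inv y \<otimes> x \<in> P" using h by simp
next
  interpret P: subgroup P G by fact
  assume h: "inv y \<otimes> x \<in> P"
  have "(inv y \<otimes> x) <# P = P"
    using h by (metis P.subgroup_axioms coset_join3 P.mem_carrier)
  moreover have "x <# P = y <# ((inv y \<otimes> x) <# P)"
    using assms P.subset by (simp add: lcos_m_assoc m_assoc[symmetric])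
  ultimately show "x <# P = y <# P" by simp
qed

lemma lcosets_finite_action:
  assumes "finite (carrier G)" "subgroup P G"
  shows "finite_action G (lcosets_in G (carrier G) P) (l_coset G)"
proof -
  interpret P: subgroup P G by fact
  have X: "lcosets_in G (carrier G) P = (\<lambda>x. x <# P) ` carrier G" by (auto simp: lcosets_in_def)
  have mult: "g <# (x <# P) = (g \<otimes> x) <# P" if "g \<in> carrier G" "x \<in> carrier G" for g x
    using that P.subset by (simp add: lcos_m_assoc)
  show ?thesis
  proof (intro finite_action.intro finite_action_axioms.intro)
    show "group G" by (rule is_group)
    show "finite (carrier G)" by fact
    show "finite (lcosets_in G (carrier G) P)" unfolding X using assms by simp
  next
    fix g C assume "g \<in> carrier G" "C \<in> lcosets_in G (carrier G) P"
    then show "g <# C \<in> lcosets_in G (carrier G) P" unfolding X using mult by force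
  next
    fix C assume "C \<in> lcosets_in G (carrier G) P"
    then show "\<one> <# C = C" unfolding X using mult by force
  next
    fix g h C assume "g \<in> carrier G" "h \<in> carrier G" "C \<in> lcosets_in G (carrier G) P"
    then show "(g \<otimes> h) <# C = g <# (h <# C)" unfolding X using mult m_assoc by force
  qed
qed

lemma lcoset_fixed_iff:
  assumes "subgroup P G" "g \<in> carrier G" "x \<in> carrier G"
  shows "g <# (x <# P) = x <# P \<longleftrightarrow> g \<in> conj_set G x P"
proof -
  interpret P: subgroup P G by fact
  have "g <# (x <# P) = x <# P \<longleftrightarrow> inv x \<otimes> (g \<otimes> x) \<in> P"
    using assms P.subset lcoset_eq_iff[OF assms(1), of "g \<otimes> x" x] by (simp add: lcos_m_assoc)
  also have "inv x \<otimes> (g \<otimes> x) = conjg G (inv x) g" using assms by (simp add: conjg_def m_assoc)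
  also have "conjg G (inv x) g \<in> P \<longleftrightarrow> g \<in> conj_set G x P"
  proof
    assume "conjg G (inv x) g \<in> P"
    then have "conjg G x (conjg G (inv x) g) \<in> conj_set G x P" unfolding conj_set_def by blast
    then show "g \<in> conj_set G x P" using conjg_inv_conjg(2)[OF assms(3,2)] by simp
  next
    assume "g \<in> conj_set G x P"
    then obtain h where h: "h \<in> P" "g = conjg G x h" unfolding conj_set_def by blast
    then show "conjg G (inv x) g \<in> P" using conjg_inv_conjg(1)[OF assms(3) P.mem_carrier[OF h(1)]] by simp
  qed
  finally show ?thesis .
qed

text \<open>Orbit formula for the point K of the coset space: its orbit under H is H/K and its
  stabilizer is K.\<close>

lemma card_lcosets_in:
  assumes "finite (carrier G)" "subgroup H G" "subgroup K G" "K \<subseteq> H"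
  shows "card H = card (lcosets_in G H K) * card K"
proof -
  interpret H: subgroup H G by fact
  interpret K: subgroup K G by fact
  interpret A: finite_action G "lcosets_in G (carrier G) K" "l_coset G"
    by (rule lcosets_finite_action[OF assms(1,3)])
  have KX: "K \<in> lcosets_in G (carrier G) K"
    using K.subset by (auto simp: lcosets_in_def intro!: exI[of _ \<one>] dest: lcos_mult_one)
  have "(\<lambda>h. h <# K) ` H = lcosets_in G H K" by (auto simp: lcosets_in_def)
  moreover have "{h \<in> H. h <# K = K} = K"
  proof -
    have "h <# K = K \<longleftrightarrow> h \<in> K" if "h \<in> H" for h
      using lcoset_eq_iff[OF assms(3), of h \<one>] lcos_mult_one[OF K.subset] H.mem_carrier[OF that] by simp
    then show ?thesis using assms(4) by auto
  qed
  ultimately show ?thesis using A.card_orbit_stabilizer[OF assms(2) KX] by simp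
qed

section \<open>p-subgroups, normalizers and automizers\<close>

lemma p_subgroup_subset:
  assumes p: "prime p" and T: "p_subgroup p G T" and fin: "finite (carrier G)" and H: "subgroup H G" "H \<subseteq> T"
  shows "p_subgroup p G H"
proof -
  obtain n where "card T = p ^ n" and T': "subgroup T G" using T by (auto simp: p_subgroup_def)
  moreover have "card H dvd card T" using card_lcosets_in[OF fin T' H(1,2)] by simp
  ultimately have "\<exists>m. card H = p ^ m" using p divides_primepow_nat by metis
  then show ?thesis using H T finite_subset by (auto simp: p_subgroup_def)
qed

text \<open>Let Q act on T/Q by left multiplication. The number of fixed cosets is divisible by p
  and Q is one of them, so there is another; a coset \<open>t Q\<close> is fixed exactly when t
  normalizes Q.\<close>

lemma p_subgroup_normalizer_grows:
  assumes fin: "finite (carrier G)" and p: "prime p" and T: "p_subgroup p G T"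
    and Q: "subgroup Q G" "Q \<subset> T"
  shows "Q \<subset> normalizer_in G T Q"
proof -
  have sT: "subgroup T G" using T by (simp add: p_subgroup_def)
  interpret T: subgroup T G by fact
  interpret Q: subgroup Q G by fact
  interpret A: finite_action G "lcosets_in G (carrier G) Q" "l_coset G"
    by (rule lcosets_finite_action[OF fin Q(1)])
  have finT: "finite T" using T by (simp add: p_subgroup_def)
  have pQ: "p_subgroup p G Q" using p_subgroup_subset[OF p T fin Q(1)] Q(2) by auto
  let ?Z = "lcosets_in G T Q"
  have c: "card T = card ?Z * card Q" using card_lcosets_in[OF fin sT Q(1)] Q(2) by auto
  have "card Q < card T" using Q(2) finT psubset_card_mono by blast
  then have "card ?Z \<noteq> 1" using c by auto
  moreover obtain n where "card T = p ^ n" using T by (auto simp: p_subgroup_def)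
  ultimately have "p dvd card ?Z" using p c
    by (metis divides_primepow_nat dvd_power dvd_triv_left gr0I power_0)
  moreover have ZX: "?Z \<subseteq> lcosets_in G (carrier G) Q" using T.subset by (auto simp: lcosets_in_def)
  moreover have "q <# C \<in> ?Z" if qC: "q \<in> Q" "C \<in> ?Z" for q C
  proof -
    obtain x where x: "x \<in> T" "C = x <# Q" using qC(2) by (auto simp: lcosets_in_def)
    have "q <# C = (q \<otimes> x) <# Q" using x qC(1) Q.subset by (simp add: lcos_m_assoc)
    moreover have "q \<otimes> x \<in> T" using x qC(1) Q(2) by auto
    ultimately show ?thesis by (auto simp: lcosets_in_def)
  qed
  ultimately have dvd: "p dvd card (?Z \<inter> A.fix_points Q)"
    using A.card_fixed_mod[OF p pQ ZX] by blast
  have QZ: "Q \<in> ?Z \<inter> A.fix_points Q"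
  proof -
    have "Q = \<one> <# Q" using lcos_mult_one[OF Q.subset] by simp
    then have "Q \<in> ?Z" using T.one_closed unfolding lcosets_in_def by blast
    moreover have "q <# Q = Q" if "q \<in> Q" for q using that by (simp add: coset_join3[OF _ Q(1)])
    ultimately show ?thesis using ZX by (auto simp: A.fix_points_def)
  qed
  have "?Z \<inter> A.fix_points Q \<noteq> {Q}" using dvd p by (auto simp: prime_nat_iff)
  then obtain C where C: "C \<in> ?Z" "C \<in> A.fix_points Q" "C \<noteq> Q" using QZ by blast
  then obtain t where t: "t \<in> T" "C = t <# Q" by (auto simp: lcosets_in_def)
  have tG: "t \<in> carrier G" using t by simp
  have "Q \<subseteq> conj_set G t Q"
  proof
    fix q assume "q \<in> Q"
    then show "q \<in> conj_set G t Q"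
      using C(2) t lcoset_fixed_iff[OF Q(1) _ tG, of q] by (auto simp: A.fix_points_def)
  qed
  moreover have "finite (conj_set G t Q)"
    using card_conj_set[OF tG Q.subset] pQ by (simp add: conj_set_def p_subgroup_def)
  ultimately have "conj_set G t Q = Q" using card_conj_set[OF tG Q.subset] card_subset_eq by metis
  then have "t \<in> normalizer_in G T Q" using t by (simp add: normalizer_in_def)
  moreover have "t \<notin> Q" using C(3) t coset_join3[OF tG Q(1)] by auto
  moreover have "Q \<subseteq> normalizer_in G T Q"
    using subgroup_self_normalizing[OF Q(1)] Q(2) by (auto simp: normalizer_in_def)
  ultimately show ?thesis by blast
qed

text \<open>The orbit of the identity map on \<open>Q\<close> under \<open>H\<close>, acting by composition with conjugations, is
  the group of automorphisms induced by \<open>H\<close>; its stabilizer is the centralizer.\<close>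

lemma card_induced_automorphisms:
  assumes fin: "finite (carrier G)" and Q: "Q \<subseteq> carrier G" and H: "subgroup H G"
    and C: "centralizer_in G (carrier G) Q \<subseteq> H"
  shows "card H = card ((\<lambda>h. restrict (conjg G h) Q) ` H) * card (centralizer_in G (carrier G) Q)"
proof -
  interpret H: subgroup H G by fact
  define Y where "Y = (\<lambda>g. restrict (conjg G g) Q) ` carrier G"
  define comp_conj where "comp_conj g \<phi> = restrict (\<lambda>q. conjg G g (\<phi> q)) Q" for g and \<phi> :: "'a \<Rightarrow> 'a"
  have act: "comp_conj g (restrict (conjg G h) Q) = restrict (conjg G (g \<otimes> h)) Q"
    if "g \<in> carrier G" "h \<in> carrier G" for g h
    using that Q by (auto simp: comp_conj_def conjg_conjg fun_eq_iff restrict_def subset_iff)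
  have A: "finite_action G Y comp_conj"
  proof unfold_locales
    show "finite (carrier G)" "finite Y" using fin by (auto simp: Y_def)
    show "comp_conj g \<phi> \<in> Y" if "g \<in> carrier G" "\<phi> \<in> Y" for g \<phi> using that act by (auto simp: Y_def)
    show "comp_conj \<one> \<phi> = \<phi>" if "\<phi> \<in> Y" for \<phi> using that act by (auto simp: Y_def)
    show "comp_conj (g \<otimes> h) \<phi> = comp_conj g (comp_conj h \<phi>)"
      if gh: "g \<in> carrier G" "h \<in> carrier G" "\<phi> \<in> Y" for g h \<phi>
    proof -
      obtain k where k: "k \<in> carrier G" "\<phi> = restrict (conjg G k) Q" using gh(3) by (auto simp: Y_def)
      show ?thesis unfolding k(2)
        using act[OF m_closed[OF gh(1,2)] k(1)] act[OF gh(2) k(1)] act[OF gh(1) m_closed[OF gh(2) k(1)]]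
        by (simp only: m_assoc[OF gh(1,2) k(1)])
    qed
  qed
  let ?id = "restrict (conjg G \<one>) Q"
  have id: "?id \<in> Y" by (simp add: Y_def)
  have actid: "comp_conj h ?id = restrict (conjg G h) Q" if "h \<in> carrier G" for h
    using act[OF that one_closed] that by simp
  have "(\<lambda>h. comp_conj h ?id) ` H = (\<lambda>h. restrict (conjg G h) Q) ` H"
    by (intro image_cong refl actid) simp
  moreover have "{h \<in> H. comp_conj h ?id = ?id} = centralizer_in G (carrier G) Q"
  proof -
    have "comp_conj h ?id = ?id \<longleftrightarrow> (\<forall>q\<in>Q. conjg G h q = q)" if "h \<in> carrier G" for h
      unfolding actid[OF that] using Q conjg_one
      by (auto simp: fun_eq_iff restrict_def subset_iff)
    then show ?thesis using C by (auto simp: centralizer_in_iff[OF Q])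
  qed
  ultimately show ?thesis using finite_action.card_orbit_stabilizer[OF A H id] by simp
qed

text \<open>Sylow's theorem in the automizer of Q, proved by counting: saturation makes the index of
  K in N prime to p, hence the p-group T fixes some coset \<open>n K\<close>. This says that the
  conjugate of T by the inverse of n acts on Q through elements of \<open>N_P(Q)\<close>.\<close>

lemma fully_normalized_automizer_sylow:
  assumes fin: "finite (carrier G)" and p: "prime p" and P: "p_subgroup p G P"
    and sat: "saturated_fusion p G P" and Q: "fully_normalized G P Q"
    and T: "p_subgroup p G T" "T \<subseteq> normalizer_in G (carrier G) Q"
  obtains n where "n \<in> normalizer_in G (carrier G) Q"
    "\<And>t. t \<in> T \<Longrightarrow> \<exists>u \<in> normalizer_in G P Q. \<forall>q\<in>Q. conjg G (inv n \<otimes> t \<otimes> n) q = conjg G u q"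
proof -
  have sQ: "subgroup Q G" and QP: "Q \<subseteq> P" using Q by (auto simp: fully_normalized_def)
  have sP: "subgroup P G" using P by (simp add: p_subgroup_def)
  interpret P: subgroup P G by fact
  interpret Q: subgroup Q G by fact
  define N where "N = normalizer_in G (carrier G) Q"
  define R where "R = normalizer_in G P Q"
  define C where "C = centralizer_in G (carrier G) Q"
  have sN: "subgroup N G" unfolding N_def by (rule normalizer_in_subgroup[OF subgroup_self Q.subset])
  have sR: "subgroup R G" unfolding R_def by (rule normalizer_in_subgroup[OF sP Q.subset])
  interpret N: subgroup N G by fact
  interpret R: subgroup R G by fact
  have RN: "R \<subseteq> N" unfolding R_def N_def normalizer_in_def using P.subset by blast
  have Nact: "conjg G n q \<in> Q" if "n \<in> N" "q \<in> Q" for n q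
  proof -
    have "conj_set G n Q = Q" using that(1) unfolding N_def normalizer_in_def by blast
    then show ?thesis using that(2) unfolding conj_set_def by blast
  qed
  \<comment> \<open>The preimage of \<open>aut_P G P Q\<close> in N. It contains the centralizer C,
    so N and K act on Q with the same kernel and the index of K in N is the index of the induced
    automorphism groups.\<close>
  define K where "K = {x \<in> N. \<exists>u\<in>R. \<forall>q\<in>Q. conjg G x q = conjg G u q}"
  have sK: "subgroup K G"
  proof (rule subgroupI)
    show "K \<subseteq> carrier G" by (auto simp: K_def)
    show "K \<noteq> {}" using N.one_closed R.one_closed unfolding K_def by blast
  next
    fix x assume "x \<in> K"
    then obtain u where x: "x \<in> N" "u \<in> R" "\<forall>q\<in>Q. conjg G x q = conjg G u q" by (auto simp: K_def)
    have "conjg G (inv x) q = conjg G (inv u) q" if q: "q \<in> Q" for q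
    proof -
      have "conjg G (inv u) q \<in> Q" using Nact RN x(2) q by blast
      then have "conjg G x (conjg G (inv u) q) = conjg G u (conjg G (inv u) q)" using x by blast
      also have "\<dots> = q" using conjg_inv_conjg(2) x q by simp
      finally show ?thesis using conjg_inv_conjg(1)[of x "conjg G (inv u) q"] x(1,2) q conjg_closed by simp
    qed
    then show "inv x \<in> K" using x unfolding K_def by blast
  next
    fix x y assume "x \<in> K" "y \<in> K"
    then obtain u v where x: "x \<in> N" "u \<in> R" "\<forall>q\<in>Q. conjg G x q = conjg G u q"
      and y: "y \<in> N" "v \<in> R" "\<forall>q\<in>Q. conjg G y q = conjg G v q" by (auto simp: K_def)
    have "conjg G (x \<otimes> y) q = conjg G (u \<otimes> v) q" if q: "q \<in> Q" for q
      using q x y Nact[of y q] by (simp add: conjg_conjg)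
    then show "x \<otimes> y \<in> K" using x y unfolding K_def by blast
  qed
  have KN: "K \<subseteq> N" by (auto simp: K_def)
  have CK: "C \<subseteq> K"
  proof
    fix c assume "c \<in> C"
    then have c: "c \<in> carrier G" "\<forall>q\<in>Q. conjg G c q = q" using centralizer_in_iff[OF Q.subset] by (auto simp: C_def)
    then have "conj_set G c Q = Q" unfolding conj_set_def by force
    then have "c \<in> N" using c(1) unfolding N_def normalizer_in_def by blast
    moreover have "\<forall>q\<in>Q. conjg G c q = conjg G \<one> q" using c(2) conjg_one by simp
    ultimately show "c \<in> K" using R.one_closed unfolding K_def by blast
  qed
  have finQ: "finite Q" using fin Q.subset finite_subset by blast
  have imN: "(\<lambda>h. restrict (conjg G h) Q) ` N = fus_hom G Q Q"
  proof -
    have "g \<in> N \<longleftrightarrow> g \<in> carrier G \<and> conj_set G g Q \<subseteq> Q" for g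
      using conj_set_eqI[OF finQ Q.subset, of g] unfolding N_def normalizer_in_def by blast
    then show ?thesis unfolding fus_hom_def by blast
  qed
  have imK: "(\<lambda>h. restrict (conjg G h) Q) ` K = aut_P G P Q"
  proof
    show "(\<lambda>h. restrict (conjg G h) Q) ` K \<subseteq> aut_P G P Q"
    proof
      fix \<phi> assume "\<phi> \<in> (\<lambda>h. restrict (conjg G h) Q) ` K"
      then obtain x u where "\<phi> = restrict (conjg G x) Q" "u \<in> R" "\<forall>q\<in>Q. conjg G x q = conjg G u q"
        by (auto simp: K_def)
      then have "\<phi> = restrict (conjg G u) Q" "u \<in> R" by (auto simp: restrict_def fun_eq_iff)
      then show "\<phi> \<in> aut_P G P Q" unfolding aut_P_def R_def by blast
    qed
    show "aut_P G P Q \<subseteq> (\<lambda>h. restrict (conjg G h) Q) ` K"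
      using RN unfolding aut_P_def K_def R_def by blast
  qed
  let ?Z = "lcosets_in G N K"
  have "card N = card (fus_hom G Q Q) * card C"
    using card_induced_automorphisms[OF fin Q.subset sN] CK KN imN unfolding C_def by simp
  moreover have "card K = card (aut_P G P Q) * card C"
    using card_induced_automorphisms[OF fin Q.subset sK] CK imK by (simp add: C_def)
  moreover have "card N = card ?Z * card K" by (rule card_lcosets_in[OF fin sN sK KN])
  moreover have "card C > 0"
  proof -
    have "\<one> \<in> C" using Q.subset by (auto simp: C_def centralizer_in_def)
    moreover have "finite C" using fin by (auto simp: C_def centralizer_in_def)
    ultimately show ?thesis by (auto simp: card_gt_0_iff)
  qed
  ultimately have "card (fus_hom G Q Q) = card ?Z * card (aut_P G P Q)" by simp
  moreover have "card (aut_P G P Q) = p ^ multiplicity p (card (fus_hom G Q Q))"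
    using sat Q sQ QP by (auto simp: saturated_fusion_def)
  ultimately have cZ: "card (fus_hom G Q Q) = card ?Z * p ^ multiplicity p (card (fus_hom G Q Q))" by simp
  have "finite N" using fin N.subset finite_subset by blast
  then have "card (fus_hom G Q Q) \<noteq> 0" using imN N.one_closed by (metis card_eq_0_iff empty_iff finite_imageI image_is_empty)
  then have "\<not> p ^ Suc (multiplicity p (card (fus_hom G Q Q))) dvd card (fus_hom G Q Q)"
    using p by (metis not_less_eq_eq order_refl power_dvd_iff_le_multiplicity not_prime_unit)
  then have "\<not> p dvd card ?Z" using cZ by (metis mult_dvd_mono dvd_refl power_Suc)
  moreover interpret A: finite_action G "lcosets_in G (carrier G) K" "l_coset G"
    by (rule lcosets_finite_action[OF fin sK])
  have ZX: "?Z \<subseteq> lcosets_in G (carrier G) K" using N.subset by (auto simp: lcosets_in_def)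
  have TN: "T \<subseteq> N" using T unfolding N_def by blast
  have Ksub: "K \<subseteq> carrier G" using KN N.subset by blast
  have "t <# c \<in> ?Z" if "t \<in> T" "c \<in> ?Z" for t c
  proof -
    obtain x where x: "x \<in> N" "c = x <# K" using \<open>c \<in> ?Z\<close> by (auto simp: lcosets_in_def)
    have t: "t \<in> N" using TN \<open>t \<in> T\<close> by blast
    have "t <# c = (t \<otimes> x) <# K" using x t Ksub by (simp add: lcos_m_assoc)
    then show ?thesis using x t unfolding lcosets_in_def by blast
  qed
  ultimately have "\<not> p dvd card (?Z \<inter> A.fix_points T)" using A.card_fixed_mod[OF p T(1) ZX] by blast
  then have "?Z \<inter> A.fix_points T \<noteq> {}" by (metis card.empty dvd_0_right)
  then obtain n where n: "n \<in> N" "n <# K \<in> A.fix_points T" by (auto simp: lcosets_in_def)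
  show thesis
  proof (rule that)
    show "n \<in> normalizer_in G (carrier G) Q" using n(1) unfolding N_def .
    fix t assume t: "t \<in> T"
    then have tN: "t \<in> N" using TN by blast
    have "(t \<otimes> n) <# K = n <# K"
      using n t tN Ksub lcos_m_assoc[of K t n] by (simp add: A.fix_points_def)
    then have "inv n \<otimes> (t \<otimes> n) \<in> K" using lcoset_eq_iff[OF sK] tN n by simp
    then have "inv n \<otimes> t \<otimes> n \<in> K" using tN n by (simp add: m_assoc)
    then show "\<exists>u \<in> normalizer_in G P Q. \<forall>q\<in>Q. conjg G (inv n \<otimes> t \<otimes> n) q = conjg G u q"
      unfolding K_def R_def by blast
  qed
qed

text \<open>This is the only way in which saturation enters the proof.\<close>

lemma saturated_normalizer_conj:
  assumes fin: "finite (carrier G)" and p: "prime p" and P: "p_subgroup p G P"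
    and sat: "saturated_fusion p G P" and Q: "fully_normalized G P Q"
    and g: "g \<in> carrier G" and Qg: "Q \<subseteq> conj_set G g P"
  obtains m where "m \<in> normalizer_in G (carrier G) Q"
    "conj_set G m (normalizer_in G (conj_set G g P) Q) \<subseteq> P"
proof -
  have sQ: "subgroup Q G" and QP: "Q \<subseteq> P" using Q by (auto simp: fully_normalized_def)
  have sP: "subgroup P G" using P by (simp add: p_subgroup_def)
  interpret P: subgroup P G by fact
  interpret Q: subgroup Q G by fact
  have finQ: "finite Q" using fin Q.subset finite_subset by blast
  let ?T = "normalizer_in G (conj_set G g P) Q"
  have pgP: "p_subgroup p G (conj_set G g P)" by (rule conj_set_p_subgroup[OF g P])
  then have sgP: "subgroup (conj_set G g P) G" by (simp add: p_subgroup_def)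
  have pT: "p_subgroup p G ?T"
    by (rule p_subgroup_subset[OF p pgP fin normalizer_in_subgroup[OF sgP Q.subset]])
      (auto simp: normalizer_in_def)
  have "?T \<subseteq> normalizer_in G (carrier G) Q"
    using subgroup.subset[OF sgP] by (auto simp: normalizer_in_def)
  then obtain n where n: "n \<in> normalizer_in G (carrier G) Q"
    and nT: "\<And>t. t \<in> ?T \<Longrightarrow> \<exists>u \<in> normalizer_in G P Q. \<forall>q\<in>Q. conjg G (inv n \<otimes> t \<otimes> n) q = conjg G u q"
    using fully_normalized_automizer_sylow[OF fin p P sat Q pT] by blast
  have nG: "n \<in> carrier G" "conj_set G n Q = Q" using n by (auto simp: normalizer_in_def)
  \<comment> \<open>The map to be extended leads from Q', the conjugate of Q inside P determined by
    g, back to Q.\<close>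
  define Q' where "Q' = conj_set G (inv g) Q"
  have Q'P: "Q' \<subseteq> P" using conj_set_mono[OF Qg, of "inv g"] conj_set_inv(1)[OF g P.subset] by (simp add: Q'_def)
  have sQ': "subgroup Q' G" unfolding Q'_def using conj_set_subgroup g sQ by simp
  have gQ': "conj_set G g Q' = Q" unfolding Q'_def by (rule conj_set_inv(2)[OF g Q.subset])
  have Q'G: "Q' \<subseteq> carrier G" using Q'P P.subset by blast
  \<comment> \<open>The factor \<open>inv n\<close> corrects conjugation by g: after it, every
    element of \<open>N_P(Q')\<close> induces on Q an automorphism coming from
    \<open>N_P(Q)\<close>, so the extension axiom reaches all of \<open>N_P(Q')\<close>.\<close>
  define k where "k = inv n \<otimes> g"
  have kG: "k \<in> carrier G" using nG g by (simp add: k_def)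
  have kQ': "conj_set G k Q' = Q"
    using conj_set_mult[of "inv n" g Q'] nG g Q'G gQ' conj_set_inv(1)[of n Q] Q.subset by (simp add: k_def)
  define \<phi> where "\<phi> = restrict (conjg G k) Q'"
  have phiQ: "\<phi> ` Q' = Q" using kQ' by (simp add: \<phi>_def conj_set_def)
  have phi: "\<phi> \<in> fus_hom G Q' P" using kG kQ' QP by (auto simp: \<phi>_def fus_hom_def)
  have "N_phi G P Q' \<phi> = normalizer_in G P Q'"
  proof
    show "N_phi G P Q' \<phi> \<subseteq> normalizer_in G P Q'" by (auto simp: N_phi_def)
    show "normalizer_in G P Q' \<subseteq> N_phi G P Q' \<phi>"
    proof
      fix h assume h: "h \<in> normalizer_in G P Q'"
      then have hP: "h \<in> P" "conj_set G h Q' = Q'" by (auto simp: normalizer_in_def)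
      have hG: "h \<in> carrier G" using hP by simp
      define t where "t = conjg G g h"
      have tG: "t \<in> carrier G" using g hG by (simp add: t_def conjg_closed)
      have tg: "t \<otimes> g = g \<otimes> h" using g hG by (simp add: t_def conjg_def m_assoc)
      have "conj_set G t Q = conj_set G (t \<otimes> g) Q'" using conj_set_mult[OF tG g Q'G] gQ' by simp
      also have "\<dots> = Q" using conj_set_mult[OF g hG Q'G] hP gQ' tg by simp
      finally have "t \<in> ?T" using hP by (auto simp: normalizer_in_def t_def conj_set_def)
      then obtain u where u: "u \<in> normalizer_in G P Q" "\<forall>q\<in>Q. conjg G (inv n \<otimes> t \<otimes> n) q = conjg G u q"
        using nT by blast
      have "\<phi> (conjg G h x) = conjg G u (\<phi> x)" if x: "x \<in> Q'" for x
      proof -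
        have xG: "x \<in> carrier G" using x Q'G by blast
        have hx: "conjg G h x \<in> Q'" using hP x by (auto simp: conj_set_def)
        have kx: "conjg G k x \<in> Q" using kQ' x by (auto simp: conj_set_def)
        have "\<phi> (conjg G h x) = conjg G (k \<otimes> h) x" using hx conjg_conjg[OF kG hG xG] by (simp add: \<phi>_def)
        also have "k \<otimes> h = inv n \<otimes> (t \<otimes> g)" using tg nG g hG by (simp add: k_def m_assoc)
        also have "\<dots> = (inv n \<otimes> t \<otimes> n) \<otimes> k"
        proof -
          have "n \<otimes> (inv n \<otimes> g) = g" using nG g by (simp add: m_assoc[symmetric])
          then show ?thesis using nG g tG by (simp add: k_def m_assoc)
        qed
        also have "conjg G \<dots> x = conjg G (inv n \<otimes> t \<otimes> n) (conjg G k x)"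
          using conjg_conjg nG tG kG xG by simp
        also have "\<dots> = conjg G u (conjg G k x)" using u kx by blast
        finally show ?thesis using x by (simp add: \<phi>_def)
      qed
      then show "h \<in> N_phi G P Q' \<phi>" using h u phiQ unfolding N_phi_def by auto
    qed
  qed
  \<comment> \<open>The first saturation axiom supplies what the extension axiom asks of the image
    Q.\<close>
  moreover have "fully_centralized G P (\<phi> ` Q')"
    using sat Q sQ QP by (auto simp: saturated_fusion_def phiQ)
  ultimately obtain \<psi> where \<psi>: "\<psi> \<in> fus_hom G (normalizer_in G P Q') P" "\<forall>x\<in>Q'. \<psi> x = \<phi> x"
    using sat phi sQ' Q'P unfolding saturated_fusion_def by metis
  then obtain w where w: "w \<in> carrier G" "\<psi> = restrict (conjg G w) (normalizer_in G P Q')"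
    "conj_set G w (normalizer_in G P Q') \<subseteq> P" by (auto simp: fus_hom_def)
  have Q'N: "Q' \<subseteq> normalizer_in G P Q'"
    using Q'P subgroup_self_normalizing[OF sQ'] by (auto simp: normalizer_in_def)
  have wk: "conjg G w x = conjg G k x" if "x \<in> Q'" for x
    using that subsetD[OF Q'N that] bspec[OF \<psi>(2) that] w(2) by (simp add: \<phi>_def)
  \<comment> \<open>Undo g, then apply w. The normalizer of Q in \<open>gPg^-1\<close> is the
    conjugate by g of \<open>N_P(Q')\<close>, which w sends into P; and both g and w carry Q' to Q,
    so m normalizes Q.\<close>
  define m where "m = w \<otimes> inv g"
  have mG: "m \<in> carrier G" using w g by (simp add: m_def)
  have mg: "m \<otimes> g = w" using w g by (simp add: m_def m_assoc)
  have "conj_set G m Q = conj_set G w Q'" using conj_set_mult[OF mG g Q'G] gQ' mg by simp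
  also have "\<dots> = conj_set G k Q'" using wk by (auto simp: conj_set_def)
  finally have mN: "m \<in> normalizer_in G (carrier G) Q" using mG kQ' by (simp add: normalizer_in_def)
  have "conj_set G m ?T \<subseteq> P"
  proof
    fix y assume "y \<in> conj_set G m ?T"
    then obtain t where t: "t \<in> ?T" "y = conjg G m t" by (auto simp: conj_set_def)
    then obtain h where h: "h \<in> P" "t = conjg G g h" by (auto simp: normalizer_in_def conj_set_def)
    have hG: "h \<in> carrier G" using h by simp
    have tG: "t \<in> carrier G" using h g hG conjg_closed by simp
    have "conj_set G g (conj_set G h Q') = conj_set G (t \<otimes> g) Q'"
      using conj_set_mult[OF g hG Q'G] g hG h(2) by (simp add: conjg_def m_assoc)
    also have "\<dots> = conj_set G g Q'"
      using conj_set_mult[OF tG g Q'G] gQ' t by (simp add: normalizer_in_def)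
    finally have "conj_set G h Q' = Q'"
      using conj_set_inv(1)[OF g Q'G] conj_set_inv(1)[OF g conj_set_closed[OF hG Q'G]] by simp
    then have "h \<in> normalizer_in G P Q'" using h by (simp add: normalizer_in_def)
    moreover have "y = conjg G w h" using t h conjg_conjg[OF mG g hG] mg by simp
    ultimately show "y \<in> P" using w(3) by (auto simp: conj_set_def)
  qed
  then show thesis using that mN by blast
qed

text \<open>Among the finitely many conjugates inside P one has a largest normalizer in P. This lets
  results at fully normalized subgroups reach every subgroup of P.\<close>

lemma fully_normalized_conj_exists:
  assumes fin: "finite (carrier G)" and P: "subgroup P G" and Q: "subgroup Q G" "Q \<subseteq> P"
  obtains g where "g \<in> carrier G" "fully_normalized G P (conj_set G g Q)"
proof -
  have QG: "Q \<subseteq> carrier G" using Q subgroup.subset by blast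
  let ?S = "{g \<in> carrier G. conj_set G g Q \<subseteq> P}"
  let ?f = "\<lambda>g. card (normalizer_in G P (conj_set G g Q))"
  have "\<one> \<in> ?S" using conj_set_one[OF QG] Q by simp
  then have ne: "?f ` ?S \<noteq> {}" "finite (?f ` ?S)" using fin by auto
  obtain g where g: "g \<in> ?S" "?f g = Max (?f ` ?S)" using Max_in[OF ne(2,1)] by auto
  have "card (normalizer_in G P (conj_set G h (conj_set G g Q))) \<le> ?f g"
    if h: "h \<in> carrier G" "conj_set G h (conj_set G g Q) \<subseteq> P" for h
  proof -
    have eq: "conj_set G h (conj_set G g Q) = conj_set G (h \<otimes> g) Q" using conj_set_mult h g QG by simp
    then have "h \<otimes> g \<in> ?S" using h g by simp
    then show ?thesis unfolding eq g(2) using ne(2) by (intro Max_ge) auto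
  qed
  then have "fully_normalized G P (conj_set G g Q)"
    using g conj_set_subgroup Q by (auto simp: fully_normalized_def)
  then show thesis using that g by blast
qed

end

section \<open>Summands of the Brauer construction\<close>

context finite_action
begin

lemma mat_app_cong_supp:
  assumes "\<And>x y. a x y \<noteq> 0 \<Longrightarrow> y \<in> Y" "\<And>y. y \<in> Y \<Longrightarrow> F y = F' y"
  shows "mat_app a F = mat_app a F'"
  unfolding mat_app_def by (intro ext sum.cong refl) (use assms in force)

text \<open>With \<open>u\<close> the matrix of composition with \<open>retr\<close>, the composite \<open>f b u f\<close> fixes the constant function, hence it is not nilpotent, hence
  invertible.\<close>

lemma scott_summand:
  fixes f b :: "'x \<Rightarrow> 'x \<Rightarrow> 'k::field"
  assumes N: "N \<subseteq> carrier G" and YZ: "Y \<subseteq> Z" and ZX: "Z \<subseteq> X"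
    and Zact: "\<And>n x. n \<in> N \<Longrightarrow> x \<in> X \<Longrightarrow> act n x \<in> Z \<longleftrightarrow> x \<in> Z"
    and retr: "\<And>x. x \<in> Z \<Longrightarrow> retr x \<in> Y"
    and retr_act: "\<And>n x. n \<in> N \<Longrightarrow> x \<in> Z \<Longrightarrow> retr (act n x) = act n (retr x)"
    and f: "prim_idem N f" and fY: "\<And>x y. f x y \<noteq> 0 \<Longrightarrow> x \<in> Y \<and> y \<in> Y"
    and f1: "mat_app f (\<lambda>_. 1) = (\<lambda>x. if x \<in> Y then 1 else 0)"
    and b: "b \<in> inv_mats N" "b \<star> b = b" and bZ: "\<And>x y. b x y \<noteq> 0 \<Longrightarrow> x \<in> Z \<and> y \<in> Z"
    and b1: "mat_app b (\<lambda>_. 1) = (\<lambda>x. if x \<in> Z then 1 else 0)"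
  obtains a i j where "a \<in> inv_mats N" "a \<star> a = a" "b \<star> a = a" "a \<star> b = a"
    "mat_app a (\<lambda>_. 1) = (\<lambda>x. if x \<in> Z then 1 else 0)"
    "i \<in> inv_mats N" "j \<in> inv_mats N" "i \<star> j = a" "j \<star> i = f"
proof -
  let ?one = "\<lambda>_. 1 :: 'k" and ?Y = "\<lambda>x. if x \<in> Y then 1 else 0 :: 'k" and ?Z = "\<lambda>x. if x \<in> Z then 1 else 0 :: 'k"
  define u :: "'x \<Rightarrow> 'x \<Rightarrow> 'k" where "u x y = (if x \<in> Z \<and> y = retr x then 1 else 0)" for x y
  have YX: "Y \<subseteq> X" using YZ ZX by blast
  have u: "u \<in> inv_mats N"
    unfolding inv_mats_def
  proof (intro CollectI conjI allI impI ballI)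
    fix x y assume "u x y \<noteq> 0"
    then have "x \<in> Z" "y = retr x" by (auto simp: u_def split: if_splits)
    then show "x \<in> X" "y \<in> X" using ZX YX retr by auto
  next
    fix n x y assume n: "n \<in> N" "x \<in> X" "y \<in> X"
    have nG: "n \<in> carrier G" using n N by blast
    have "act n y = retr (act n x) \<longleftrightarrow> y = retr x" if x: "x \<in> Z"
      using retr_act[OF n(1) x] act_inject[OF nG n(3), of "retr x"] retr[OF x] YX by auto
    then show "u (act n x) (act n y) = u x y" using Zact[OF n(1,2)] by (auto simp: u_def)
  qed
  have app_u: "mat_app u F x = (if x \<in> Z then F (retr x) else 0)" for F x
  proof (cases "x \<in> Z")
    case True
    then have "retr x \<in> X" using retr YX by blast
    then show ?thesis using True finite_points
      by (simp add: mat_app_def u_def if_distrib[of "\<lambda>t. t * _"] cong: if_cong)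
  qed (simp add: mat_app_def u_def)
  have f': "f \<in> inv_mats N" "f \<star> f = f" using f by (auto simp: prim_idem_def)
  have f_Y: "mat_app f ?Y = ?Y"
    using f1 mat_app_cong_supp[of f Y ?Y ?one] fY by force
  have f_Z: "mat_app f ?Z = ?Y"
    using f1 mat_app_cong_supp[of f Y ?Z ?one] fY YZ by force
  have u_Y: "mat_app u ?Y = ?Z" using retr by (auto simp: app_u fun_eq_iff)
  have b_Z: "mat_app b ?Z = ?Z"
    using b1 mat_app_cong_supp[of b Z ?Z ?one] bZ by force
  define \<beta> where "\<beta> = f \<star> b \<star> u \<star> f"
  have \<beta>: "\<beta> \<in> inv_mats N" "f \<star> \<beta> = \<beta>" "\<beta> \<star> f = \<beta>"
    using f' b u mult_inv_mats[OF _ _ N] by (auto simp: \<beta>_def mult_assoc) (simp add: mult_assoc[symmetric])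
  have \<beta>_Y: "mat_app \<beta> ?Y = ?Y" by (simp add: \<beta>_def app_mult f_Y u_Y b_Z f_Z)
  have Y0: "?Y \<noteq> 0"
  proof -
    obtain x y where "f x y \<noteq> 0" using f unfolding prim_idem_def by (metis ext zero_fun_apply)
    then have "x \<in> Y" using fY by blast
    then show ?thesis by (auto simp: fun_eq_iff)
  qed
  have "mat_app (((\<star>) \<beta> ^^ n) f) ?Y = ?Y" for n
    by (induction n) (simp_all add: f_Y \<beta>_Y app_mult)
  then have "((\<star>) \<beta> ^^ n) f \<noteq> 0" for n using Y0 app_zero_mat by metis
  then obtain c where c: "c \<in> inv_mats N" "f \<star> c = c" "c \<star> f = c" "c \<star> \<beta> = f" "\<beta> \<star> c = f"
    using prim_idem_fitting[OF f N \<beta>] by blast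
  \<comment> \<open>Absorbing the inverse c into i makes \<open>j \<star> i\<close> equal to f
    exactly, hence \<open>i \<star> j\<close> idempotent; the factors b at its two ends put it below
    b.\<close>
  define i where "i = b \<star> u \<star> f \<star> c"
  define j where "j = f \<star> b"
  have ji: "j \<star> i = f"
  proof -
    have "j \<star> i = f \<star> (b \<star> b) \<star> u \<star> f \<star> c" by (simp only: j_def i_def mult_assoc)
    also have "\<dots> = \<beta> \<star> c" by (simp only: \<beta>_def b)
    finally show ?thesis using c by simp
  qed
  have i_f: "i \<star> f = i" using c by (simp add: i_def mult_assoc)
  have c_Y: "mat_app c ?Y = ?Y"
    using c(4) \<beta>_Y f_Y by (metis app_mult)
  show thesis
  proof (rule that[of "i \<star> j" i j])
    show ij: "i \<in> inv_mats N" "j \<in> inv_mats N"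
      unfolding i_def j_def by (intro mult_inv_mats b(1) u f'(1) c(1) N)+
    then show "i \<star> j \<in> inv_mats N" using mult_inv_mats N by blast
    show "(i \<star> j) \<star> (i \<star> j) = i \<star> j" using ji i_f by (metis mult_assoc)
    show "b \<star> (i \<star> j) = i \<star> j" unfolding i_def by (simp only: b(2) mult_assoc[symmetric])
    show "(i \<star> j) \<star> b = i \<star> j" unfolding j_def by (simp only: b(2) mult_assoc)
    \<comment> \<open>The summand keeps the constant function on Z; this is what later prevents its
      restriction to smaller fixed point sets from vanishing.\<close>
    have "mat_app (i \<star> j) ?one = mat_app i ?Y" by (simp add: app_mult j_def b1 f_Z)
    also have "\<dots> = ?Z" by (simp add: i_def app_mult c_Y f_Y u_Y b_Z)
    finally show "mat_app (i \<star> j) ?one = ?Z" .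
  qed (simp_all add: ji)
qed

text \<open>The matrix \<open>a\<close> is supported on pairs with stabilizer \<open>Q\<close>, so it extends to a
  \<open>G\<close>-invariant matrix \<open>l\<close>; then \<open>e l e\<close> is not nilpotent, hence invertible.\<close>

lemma brauer_map_summand_with_vertex:
  fixes e a :: "'x \<Rightarrow> 'x \<Rightarrow> 'k::field"
  assumes p: "prime p" "CHAR('k) = p" and Q: "p_subgroup p G Q"
    and e: "prim_idem (carrier G) e"
    and a: "a \<in> inv_mats (normalizer_in G (carrier G) Q)" "a \<star> a = a" "a \<noteq> 0"
    and ba: "brauer_map Q e \<star> a = a" "a \<star> brauer_map Q e = a"
    and stab: "\<And>x y. a x y \<noteq> 0 \<Longrightarrow> {g \<in> carrier G. act g x = x \<and> act g y = y} = Q"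
  shows "a = brauer_map Q e"
proof -
  have sQ: "subgroup Q G" using Q by (simp add: p_subgroup_def)
  interpret Q: subgroup Q G by fact
  have finQ: "finite Q" using Q by (simp add: p_subgroup_def)
  have e': "e \<in> inv_mats (carrier G)" "e \<star> e = e" using e by (auto simp: prim_idem_def)
  have aX: "x \<in> X \<and> y \<in> X" if "a x y \<noteq> 0" for x y using that inv_mats_supp[OF a(1)] by blast
  have aQ: "x \<in> fix_points Q \<and> y \<in> fix_points Q" if "a x y \<noteq> 0" for x y
    using aX[OF that] stab[OF that] unfolding fix_points_def by blast
  \<comment> \<open>Q fixes the pair, so \<open>gQg^-1\<close> fixes its translate, whose stabilizer
    is Q. Thus pairs in the support of a that are conjugate under G are already conjugate under the
    normalizer of Q.\<close>
  have norm: "g \<in> normalizer_in G (carrier G) Q"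
    if g: "g \<in> carrier G" and x: "x \<in> fix_points Q" and y: "y \<in> fix_points Q"
      and nz: "a (act g x) (act g y) \<noteq> 0" for g x y
  proof -
    have xy: "x \<in> X" "y \<in> X" using x y by (auto simp: fix_points_def)
    have "conj_set G g Q \<subseteq> Q"
    proof
      fix q' assume "q' \<in> conj_set G g Q"
      then obtain q where q: "q \<in> Q" "q' = conjg G g q" by (auto simp: conj_set_def)
      have qG: "q \<in> carrier G" using q by simp
      have "act q' (act g x) = act g x" "act q' (act g y) = act g y"
        using act_conjg[OF g qG xy(1)] act_conjg[OF g qG xy(2)] q x y by (simp_all add: fix_points_def)
      moreover have "q' \<in> carrier G" using q g qG conjg_closed by simp
      ultimately show "q' \<in> Q" using stab[OF nz] by blast
    qed
    then have "conj_set G g Q = Q" by (rule conj_set_eqI[OF finQ Q.subset g])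
    then show ?thesis using g by (simp add: normalizer_in_def)
  qed
  have val: "a (act g x) (act g y) = a x y"
    if g: "g \<in> carrier G" and x: "x \<in> fix_points Q" and y: "y \<in> fix_points Q"
      and nz: "a (act g x) (act g y) \<noteq> 0" for g x y
    using inv_mats_act[OF a(1) norm[OF that]] x y by (simp add: fix_points_def)
  \<comment> \<open>The value at a pair is that of a at any translate where a is nonzero, and 0 if
    there is none; \<open>val\<close> makes the choice of the translate immaterial.\<close>
  define l where "l x y = (if x \<in> X \<and> y \<in> X \<and> (\<exists>g\<in>carrier G. a (act g x) (act g y) \<noteq> 0)
    then a (act (SOME g. g \<in> carrier G \<and> a (act g x) (act g y) \<noteq> 0) x)
           (act (SOME g. g \<in> carrier G \<and> a (act g x) (act g y) \<noteq> 0) y) else 0)" for x y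
  have l_val: "l x y = a (act g x) (act g y)"
    if g: "g \<in> carrier G" "a (act g x) (act g y) \<noteq> 0" and xy: "x \<in> X" "y \<in> X" for g x y
  proof -
    define h where "h = (SOME g. g \<in> carrier G \<and> a (act g x) (act g y) \<noteq> 0)"
    have h: "h \<in> carrier G" "a (act h x) (act h y) \<noteq> 0"
      using someI[of "\<lambda>g. g \<in> carrier G \<and> a (act g x) (act g y) \<noteq> 0" g] g by (auto simp: h_def)
    have k: "act (h \<otimes> inv g) (act g z) = act h z" if "z \<in> X" for z
      using that g h by (simp add: act_mult act_closed act_inv_act)
    have "a (act (h \<otimes> inv g) (act g x)) (act (h \<otimes> inv g) (act g y)) = a (act g x) (act g y)"
      by (rule val) (use aQ[OF g(2)] g h xy k in auto)
    then have "a (act h x) (act h y) = a (act g x) (act g y)" using k xy by simp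
    moreover have "l x y = a (act h x) (act h y)" using g xy unfolding l_def h_def by auto
    ultimately show ?thesis by simp
  qed
  have l_inv: "l \<in> inv_mats (carrier G)"
    unfolding inv_mats_def
  proof (intro CollectI conjI allI impI ballI)
    show "x \<in> X" "y \<in> X" if "l x y \<noteq> 0" for x y using that by (auto simp: l_def split: if_splits)
  next
    fix h x y assume h: "h \<in> carrier G" and xy: "x \<in> X" "y \<in> X"
    show "l (act h x) (act h y) = l x y"
    proof (cases "\<exists>g\<in>carrier G. a (act g x) (act g y) \<noteq> 0")
      case True
      then obtain g where g: "g \<in> carrier G" "a (act g x) (act g y) \<noteq> 0" by blast
      have k: "act (g \<otimes> inv h) (act h z) = act g z" if "z \<in> X" for z
        using that g h by (simp add: act_mult act_closed act_inv_act)
      have "l (act h x) (act h y) = a (act (g \<otimes> inv h) (act h x)) (act (g \<otimes> inv h) (act h y))"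
        by (rule l_val) (use g h xy k act_closed in auto)
      then show ?thesis using l_val[OF g xy] k xy by simp
    next
      case False
      have "\<not> (\<exists>g\<in>carrier G. a (act g (act h x)) (act g (act h y)) \<noteq> 0)"
      proof
        assume "\<exists>g\<in>carrier G. a (act g (act h x)) (act g (act h y)) \<noteq> 0"
        then obtain g where g: "g \<in> carrier G" "a (act g (act h x)) (act g (act h y)) \<noteq> 0" by blast
        then have "a (act (g \<otimes> h) x) (act (g \<otimes> h) y) \<noteq> 0" using act_mult h xy by simp
        then show False using False g h by blast
      qed
      then show ?thesis using False by (simp add: l_def)
    qed
  qed
  have br_l: "brauer_map Q l = a"
  proof (intro ext)
    fix x y
    show "brauer_map Q l x y = a x y"
    proof (cases "x \<in> fix_points Q \<and> y \<in> fix_points Q")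
      case True
      then have xy: "x \<in> X" "y \<in> X" by (auto simp: fix_points_def)
      have "l x y = a x y"
      proof (cases "\<exists>g\<in>carrier G. a (act g x) (act g y) \<noteq> 0")
        case True': True
        then obtain g where g: "g \<in> carrier G" "a (act g x) (act g y) \<noteq> 0" by blast
        then show ?thesis using l_val[OF g xy] val[OF g(1) _ _ g(2)] True by simp
      next
        case False
        then have "a x y = 0" using act_one xy one_closed by metis
        then show ?thesis using False by (simp add: l_def)
      qed
      then show ?thesis using True by (simp add: brauer_map_def)
    next
      case False
      then show ?thesis using aQ[of x y] by (auto simp: brauer_map_def)
    qed
  qed
  let ?b = "brauer_map Q e"
  have QG: "inv_mats (carrier G) \<subseteq> inv_mats Q" by (rule inv_mats_mono[OF Q.subset])
  have br_mult: "brauer_map Q (c \<star> d) = brauer_map Q c \<star> brauer_map Q d"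
    if "c \<in> inv_mats (carrier G)" "d \<in> inv_mats (carrier G)" for c d :: "'x \<Rightarrow> 'x \<Rightarrow> 'k"
    using brauer_map_mult[OF p Q] that QG by blast
  define \<alpha> where "\<alpha> = e \<star> l \<star> e"
  have le: "l \<star> e \<in> inv_mats (carrier G)" by (rule mult_inv_mats[OF l_inv e'(1) order_refl])
  have \<alpha>_eq: "\<alpha> = e \<star> (l \<star> e)" by (simp only: \<alpha>_def mult_assoc)
  have \<alpha>: "\<alpha> \<in> inv_mats (carrier G)" "e \<star> \<alpha> = \<alpha>" "\<alpha> \<star> e = \<alpha>"
    unfolding \<alpha>_eq using mult_inv_mats[OF e'(1) le order_refl] e'(2)
    by (auto simp: mult_assoc) (simp flip: mult_assoc)
  \<comment> \<open>Cutting l down by e changes nothing after restriction, because a lies below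
    \<open>brauer_map Q e\<close>.\<close>
  have br_\<alpha>: "brauer_map Q \<alpha> = a"
    unfolding \<alpha>_eq br_mult[OF e'(1) le] br_mult[OF l_inv e'(1)] br_l by (simp only: ba)
  have pw: "((\<star>) \<alpha> ^^ n) e \<in> inv_mats (carrier G)" for n
    by (induction n) (use mult_inv_mats \<alpha> e' in auto)
  \<comment> \<open>Restriction sends powers of \<alpha> to powers of the nonzero idempotent a, so
    \<alpha> cannot be nilpotent.\<close>
  have br_pw: "a \<star> brauer_map Q (((\<star>) \<alpha> ^^ n) e) = a" for n
  proof (induction n)
    case 0 then show ?case using ba by simp
  next
    case (Suc n)
    then show ?case using br_mult[OF \<alpha>(1) pw[of n]] br_\<alpha> a(2) by (simp flip: mult_assoc)
  qed
  have "((\<star>) \<alpha> ^^ n) e \<noteq> 0" for n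
  proof
    assume "((\<star>) \<alpha> ^^ n) e = 0"
    then show False using br_pw[of n] a(3) by (simp add: brauer_map_zero mult_zero)
  qed
  then obtain c where c: "c \<in> inv_mats (carrier G)" "c \<star> \<alpha> = e"
    using prim_idem_fitting[OF e order_refl \<alpha>] by blast
  \<comment> \<open>Invertibility of \<alpha> passes to the restriction: \<open>?b\<close> is a left
    multiple of a, hence \<open>?b \<star> a = ?b\<close>, while the left side is a.\<close>
  have "?b = brauer_map Q c \<star> a" using br_mult[OF c(1) \<alpha>(1)] c(2) br_\<alpha> by simp
  then have "?b \<star> a = ?b" using a(2) by (simp add: mult_assoc)
  then show ?thesis using ba by simp
qed

section \<open>Transport of idempotents by conjugation\<close>

definition conj_mat :: "'g \<Rightarrow> ('x \<Rightarrow> 'x \<Rightarrow> 'k::field) \<Rightarrow> 'x \<Rightarrow> 'x \<Rightarrow> 'k" where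
  "conj_mat g a = (\<lambda>x y. if x \<in> X \<and> y \<in> X then a (act (inv g) x) (act (inv g) y) else 0)"

lemma conj_mat_mult:
  assumes g: "g \<in> carrier G"
  shows "conj_mat g (a \<star> b) = conj_mat g a \<star> conj_mat g b"
proof (intro ext)
  fix x z
  have ig: "inv g \<in> carrier G" using g by simp
  show "conj_mat g (a \<star> b) x z = (conj_mat g a \<star> conj_mat g b) x z"
  proof (cases "x \<in> X \<and> z \<in> X")
    case True
    then show ?thesis
      using sum_reindex_act[OF ig, of "\<lambda>y. a (act (inv g) x) y * b y (act (inv g) z)"]
      by (simp add: conj_mat_def mat_mult_def)
  next
    case False
    then show ?thesis by (auto simp: conj_mat_def mat_mult_def)
  qed
qed

lemma conj_mat_inv_mats:
  assumes g: "g \<in> carrier G" and H: "H \<subseteq> carrier G" and a: "a \<in> inv_mats H"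
  shows "conj_mat g a \<in> inv_mats (conj_set G g H)"
  unfolding inv_mats_def
proof (intro CollectI conjI allI impI ballI)
  show "x \<in> X" "y \<in> X" if "conj_mat g a x y \<noteq> 0" for x y
    using that by (auto simp: conj_mat_def split: if_splits)
next
  fix h' x y assume "h' \<in> conj_set G g H" and xy: "x \<in> X" "y \<in> X"
  then obtain h where h: "h \<in> H" "h' = conjg G g h" by (auto simp: conj_set_def)
  have hG: "h \<in> carrier G" "h' \<in> carrier G" using h H g conjg_closed by auto
  have "act (inv g) (act h' z) = act h (act (inv g) z)" if z: "z \<in> X" for z
  proof -
    have "inv g \<otimes> h' = h \<otimes> inv g" using h g hG by (simp add: conjg_def m_assoc[symmetric])
    then show ?thesis using g hG z act_mult[of "inv g" h' z] act_mult[of h "inv g" z] by simp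
  qed
  then show "conj_mat g a (act h' x) (act h' y) = conj_mat g a x y"
    using xy hG g inv_mats_act[OF a h(1)] by (simp add: conj_mat_def act_closed)
qed

lemma conj_mat_inv:
  assumes g: "g \<in> carrier G" and a: "a \<in> inv_mats H"
  shows "conj_mat (inv g) (conj_mat g a) = a" "conj_mat g (conj_mat (inv g) a) = a"
  using assms inv_mats_supp[OF a] by (auto simp: conj_mat_def fun_eq_iff act_closed act_inv_act act_act_inv)

lemma conj_mat_fixed:
  assumes g: "g \<in> carrier G" and a: "a \<in> inv_mats (carrier G)"
  shows "conj_mat g a = a"
  using assms inv_mats_supp[OF a] inv_mats_act[OF a, of "inv g"] by (auto simp: conj_mat_def fun_eq_iff)

lemma conj_mat_zero: "conj_mat g 0 = 0"
  by (auto simp: conj_mat_def fun_eq_iff)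

lemma conj_mat_brauer_map:
  assumes g: "g \<in> carrier G" and Q: "Q \<subseteq> carrier G"
  shows "conj_mat g (brauer_map Q a) = brauer_map (conj_set G g Q) (conj_mat g a)"
proof (intro ext)
  fix x y
  have "x \<in> fix_points (conj_set G g Q) \<longleftrightarrow> act (inv g) x \<in> fix_points Q" if "x \<in> X" for x
    using fix_points_conj[OF g Q, of "act (inv g) x"] that g act_closed act_act_inv by simp
  then show "conj_mat g (brauer_map Q a) x y = brauer_map (conj_set G g Q) (conj_mat g a) x y"
    using fix_points_subset by (auto simp: conj_mat_def brauer_map_def)
qed

lemma prim_idem_conj:
  assumes g: "g \<in> carrier G" and H: "H \<subseteq> carrier G" and e: "prim_idem H e"
  shows "prim_idem (conj_set G g H) (conj_mat g e)"
proof -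
  have e': "e \<in> inv_mats H" "e \<star> e = e" "e \<noteq> 0" using e by (auto simp: prim_idem_def)
  show ?thesis
    unfolding prim_idem_def
  proof (intro conjI ballI impI)
    show "conj_mat g e \<in> inv_mats (conj_set G g H)" by (rule conj_mat_inv_mats[OF g H e'(1)])
    show "conj_mat g e \<star> conj_mat g e = conj_mat g e" using conj_mat_mult[OF g, of e e] e' by simp
    show "conj_mat g e \<noteq> 0" using conj_mat_inv(1)[OF g e'(1)] e'(3) conj_mat_zero by metis
    fix a assume a: "a \<in> inv_mats (conj_set G g H)" "a \<star> a = a" "conj_mat g e \<star> a = a" "a \<star> conj_mat g e = a"
    let ?a = "conj_mat (inv g) a"
    have ig: "inv g \<in> carrier G" using g by simp
    have "?a \<in> inv_mats H"
      using conj_mat_inv_mats[OF ig conj_set_closed[OF g H] a(1)] conj_set_inv(1)[OF g H] by simp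
    moreover have "?a \<star> ?a = ?a" using conj_mat_mult[OF ig, of a a] a by simp
    moreover have "e \<star> ?a = ?a"
      using conj_mat_mult[OF ig, of "conj_mat g e" a] a conj_mat_inv(1)[OF g e'(1)] by simp
    moreover have "?a \<star> e = ?a"
      using conj_mat_mult[OF ig, of a "conj_mat g e"] a conj_mat_inv(1)[OF g e'(1)] by simp
    ultimately have "?a = 0 \<or> ?a = e" using e unfolding prim_idem_def by blast
    then show "a = 0 \<or> a = conj_mat g e"
      using conj_mat_inv(2)[OF g a(1)] conj_mat_zero by metis
  qed
qed

end

text \<open>G/P enters as a transitive set with a base point of stabilizer P. The condition
  \<open>e_one\<close> puts the constant function into the image of e, and with it the trivial
  module into the socle.\<close>

locale scott_action = finite_action G X act for G :: "('g, 'b) monoid_scheme" (structure) and X :: "'x set" and act +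
  fixes p :: nat and P :: "'g set" and x0 :: 'x and e :: "'x \<Rightarrow> 'x \<Rightarrow> 'k::field"
  assumes prime_p: "prime p" and char_p: "CHAR('k) = p"
    and P: "p_subgroup p G P" and saturated: "saturated_fusion p G P"
    and x0: "x0 \<in> X" and transitive: "\<And>x. x \<in> X \<Longrightarrow> \<exists>g\<in>carrier G. x = act g x0"
    and stab_x0: "\<And>g. g \<in> carrier G \<Longrightarrow> act g x0 = x0 \<longleftrightarrow> g \<in> P"
    and prim_e: "prim_idem (carrier G) e"
    and e_one: "mat_app e (\<lambda>_. 1) = (\<lambda>x. if x \<in> X then 1 else 0)"
begin

abbreviation NG :: "'g set \<Rightarrow> 'g set" where
  "NG Q \<equiv> normalizer_in G (carrier G) Q"

abbreviation QC :: "'g set \<Rightarrow> 'g set" where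
  "QC Q \<equiv> set_prod G Q (centralizer_in G (carrier G) Q)"

abbreviation base_orbit :: "'g set \<Rightarrow> 'x set" where
  "base_orbit Q \<equiv> (\<lambda>n. act n x0) ` NG Q"

text \<open>The orbit of \<open>x0\<close> under \<open>N_G(Q)\<close> is
  \<open>N_G(Q)/N_P(Q)\<close> realised inside X, so this describes an idempotent for the Scott
  module of the normalizer, extended by zero to X.\<close>

definition scott_idem :: "'g set \<Rightarrow> ('x \<Rightarrow> 'x \<Rightarrow> 'k) \<Rightarrow> bool" where
  "scott_idem Q f \<longleftrightarrow> prim_idem (NG Q) f \<and> (\<forall>x y. f x y \<noteq> 0 \<longrightarrow> x \<in> base_orbit Q \<and> y \<in> base_orbit Q) \<and>
     mat_app f (\<lambda>_. 1) = (\<lambda>x. if x \<in> base_orbit Q then 1 else 0)"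

lemma subgroup_P: "subgroup P G" using P by (simp add: p_subgroup_def)

lemma P_subset: "P \<subseteq> carrier G" using subgroup_P subgroup.subset by blast

lemma NG_subset: "NG Q \<subseteq> carrier G" by (auto simp: normalizer_in_def)

lemma e_inv: "e \<in> inv_mats (carrier G)" and e_idem: "e \<star> e = e"
  using prim_e by (auto simp: prim_idem_def)

lemma p_subgroup_in_P: "subgroup Q G \<Longrightarrow> Q \<subseteq> P \<Longrightarrow> p_subgroup p G Q"
  by (rule p_subgroup_subset[OF prime_p P finite_carrier])

lemma stab_iff:
  assumes "g \<in> carrier G" "h \<in> carrier G"
  shows "act h (act g x0) = act g x0 \<longleftrightarrow> h \<in> conj_set G g P"
proof
  assume "act h (act g x0) = act g x0"
  then have "act (inv g \<otimes> (h \<otimes> g)) x0 = x0" using assms x0 by (simp add: act_mult act_closed act_inv_act)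
  then have "inv g \<otimes> (h \<otimes> g) \<in> P" using stab_x0 assms by simp
  moreover have "conjg G g (inv g \<otimes> (h \<otimes> g)) = h"
    using assms by (simp add: conjg_def m_assoc) (simp add: m_assoc[symmetric])
  ultimately show "h \<in> conj_set G g P" unfolding conj_set_def by (metis imageI)
next
  assume "h \<in> conj_set G g P"
  then obtain k where k: "k \<in> P" "h = conjg G g k" by (auto simp: conj_set_def)
  then show "act h (act g x0) = act g x0" 
    using act_conjg[of g k x0] subsetD[OF P_subset k(1)] assms(1) x0 stab_x0[of k] by simp
qed

lemma in_fix_points_iff:
  assumes "g \<in> carrier G" "Q \<subseteq> carrier G"
  shows "act g x0 \<in> fix_points Q \<longleftrightarrow> Q \<subseteq> conj_set G g P"
proof -
  have "act q (act g x0) = act g x0 \<longleftrightarrow> q \<in> conj_set G g P" if "q \<in> Q" for q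
    using stab_iff[OF assms(1)] subsetD[OF assms(2) that] by simp
  then show ?thesis using act_closed[OF assms(1) x0] by (auto simp: fix_points_def)
qed

lemma x0_fix_points: "Q \<subseteq> P \<Longrightarrow> x0 \<in> fix_points Q"
  using stab_x0 P_subset x0 by (auto simp: fix_points_def)

lemma fix_points_NG:
  assumes "Q \<subseteq> carrier G" "n \<in> NG Q" "x \<in> X"
  shows "act n x \<in> fix_points Q \<longleftrightarrow> x \<in> fix_points Q"
  using fix_points_conj[of n Q x] assms by (auto simp: normalizer_in_def)

text \<open>A group fixing a point lies in a conjugate of P. This turns stabilizers of pairs in the
  support of a matrix into p-groups.\<close>

lemma stabilizer_p_subgroup:
  assumes "x \<in> X" "subgroup T G" "\<And>t. t \<in> T \<Longrightarrow> act t x = x"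
  shows "p_subgroup p G T"
proof -
  obtain g where g: "g \<in> carrier G" "x = act g x0" using transitive assms by blast
  have "T \<subseteq> conj_set G g P"
  proof
    fix t assume t: "t \<in> T"
    show "t \<in> conj_set G g P"
      using stab_iff[OF g(1) subgroup.mem_carrier[OF assms(2) t]] assms(3)[OF t] g(2) by simp
  qed
  then show ?thesis
    using p_subgroup_subset[OF prime_p conj_set_p_subgroup[OF g(1) P] finite_carrier assms(2)] by blast
qed

lemma QC_subset_NG: "subgroup Q G \<Longrightarrow> QC Q \<subseteq> NG Q"
  using set_prod_centralizer_normalizes by (auto simp: normalizer_in_def)

lemma brauer_map_e:
  assumes Q: "p_subgroup p G Q"
  shows "brauer_map Q e \<in> inv_mats (NG Q)" "brauer_map Q e \<star> brauer_map Q e = brauer_map Q e"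
    "\<And>x y. brauer_map Q e x y \<noteq> 0 \<Longrightarrow> x \<in> fix_points Q \<and> y \<in> fix_points Q"
    "mat_app (brauer_map Q e) (\<lambda>_. 1) = (\<lambda>x. if x \<in> fix_points Q then 1 else 0)"
proof -
  have QG: "Q \<subseteq> carrier G" using Q subgroup.subset by (auto simp: p_subgroup_def)
  have eQ: "e \<in> inv_mats Q" and eN: "e \<in> inv_mats (NG Q)"
    using e_inv inv_mats_mono QG NG_subset by blast+
  show "brauer_map Q e \<in> inv_mats (NG Q)"
    by (rule brauer_map_inv_mats[OF eN QG]) (simp add: normalizer_in_def)
  show "brauer_map Q e \<star> brauer_map Q e = brauer_map Q e"
    using brauer_map_mult[OF prime_p char_p Q eQ eQ] e_idem by simp
  show supp: "x \<in> fix_points Q \<and> y \<in> fix_points Q" if "brauer_map Q e x y \<noteq> 0" for x y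
    using that by (auto simp: brauer_map_def split: if_splits)
  show "mat_app (brauer_map Q e) (\<lambda>_. 1) = (\<lambda>x. if x \<in> fix_points Q then 1 else 0)"
  proof
    fix x
    show "mat_app (brauer_map Q e) (\<lambda>_. 1) x = (if x \<in> fix_points Q then 1 else 0)"
    proof (cases "x \<in> fix_points Q")
      case True
      then have "mat_app (brauer_map Q e) (\<lambda>_. 1) x = mat_app e (\<lambda>_. 1) x"
        by (intro mat_app_brauer_map[OF prime_p char_p Q eQ]) auto
      then show ?thesis using True e_one fix_points_subset by auto
    next
      case False
      then show ?thesis by (simp add: mat_app_def brauer_map_def)
    qed
  qed
qed

text \<open>The restricted idempotent fixes the constant function on a nonempty set.\<close>

lemma brauer_map_e_nonzero:
  assumes "p_subgroup p G Q" "fix_points Q \<noteq> {}"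
  shows "brauer_map Q e \<noteq> 0"
proof
  assume "brauer_map Q e = 0"
  then have "(\<lambda>x. if x \<in> fix_points Q then 1 else 0 :: 'k) = 0"
    using brauer_map_e(4)[OF assms(1)] app_zero_mat by metis
  then show False using assms(2) by (auto simp: fun_eq_iff split: if_splits)
qed

text \<open>An equivariant map out of an orbit exists as soon as the stabilizer of one of its points
  fixes some point of the target. Saturation provides such a point in \<open>base_orbit Q\<close>
  for every point fixed by Q.\<close>

lemma equivariant_map_exists:
  assumes Q: "fully_normalized G P Q"
  obtains retr where "\<And>x. x \<in> fix_points Q \<Longrightarrow> retr x \<in> base_orbit Q"
    "\<And>n x. n \<in> NG Q \<Longrightarrow> x \<in> fix_points Q \<Longrightarrow> retr (act n x) = act n (retr x)"
proof -
  have sQ: "subgroup Q G" and QP: "Q \<subseteq> P" using Q by (auto simp: fully_normalized_def)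
  have QG: "Q \<subseteq> carrier G" using sQ subgroup.subset by blast
  interpret N: subgroup "NG Q" G by (rule normalizer_in_subgroup[OF subgroup_self QG])
  have "\<exists>z\<in>base_orbit Q. \<forall>n\<in>NG Q. act n x = x \<longrightarrow> act n z = z" if x: "x \<in> fix_points Q" for x
  proof -
    obtain g where g: "g \<in> carrier G" "x = act g x0" using transitive x fix_points_subset by blast
    have "Q \<subseteq> conj_set G g P" using in_fix_points_iff[OF g(1) QG] g x by simp
    then obtain m where m: "m \<in> NG Q" "conj_set G m (normalizer_in G (conj_set G g P) Q) \<subseteq> P"
      using saturated_normalizer_conj[OF finite_carrier prime_p P saturated Q g(1)] by blast
    have mG: "m \<in> carrier G" using subsetD[OF NG_subset m(1)] .
    \<comment> \<open>The stabilizer of x in \<open>N_G(Q)\<close> is the normalizer of Q in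
      \<open>gPg^-1\<close>. Conjugation by m moves it into P, which fixes \<open>x0\<close>; so the
      stabilizer fixes the point that m carries to \<open>x0\<close>.\<close>
    show ?thesis
    proof (intro bexI[of _ "act (inv m) x0"] ballI impI)
      show "act (inv m) x0 \<in> base_orbit Q" using N.m_inv_closed[OF m(1)] by blast
      fix n assume n: "n \<in> NG Q" "act n x = x"
      have nG: "n \<in> carrier G" using subsetD[OF NG_subset n(1)] .
      have "n \<in> conj_set G g P" using stab_iff[OF g(1) nG] n(2) g(2) by simp
      then have "n \<in> normalizer_in G (conj_set G g P) Q"
        using n(1) unfolding normalizer_in_def by blast
      then have c: "conjg G m n \<in> P" using m(2) unfolding conj_set_def by blast
      then have "act (conjg G m n) x0 = x0" using stab_x0 subsetD[OF P_subset c] by simp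
      then have "act (conjg G m n) (act m (act (inv m) x0)) = act m (act (inv m) x0)"
        using act_act_inv[OF mG x0] by simp
      then have "act m (act n (act (inv m) x0)) = act m (act (inv m) x0)"
        using act_conjg[OF mG nG, of "act (inv m) x0"] mG x0 act_closed by simp
      then show "act n (act (inv m) x0) = act (inv m) x0"
        using act_inject[OF mG] nG mG x0 act_closed by simp
    qed
  qed
  then obtain zz where zz: "\<And>x. x \<in> fix_points Q \<Longrightarrow> zz x \<in> base_orbit Q"
    "\<And>x n. x \<in> fix_points Q \<Longrightarrow> n \<in> NG Q \<Longrightarrow> act n x = x \<Longrightarrow> act n (zz x) = zz x"
    by metis
  have orbX: "base_orbit Q \<subseteq> X" using x0 act_closed N.subset by blast
  define orb where "orb x = (\<lambda>n. act n x) ` NG Q" for x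
  \<comment> \<open>The representative is chosen from the orbit as a set, so all points of one orbit
    get the same one; the map is then spread from representatives along orbits.\<close>
  define rep where "rep x = (SOME y. y \<in> orb x)" for x
  have orb_act: "orb (act n x) = orb x" if n: "n \<in> NG Q" and x: "x \<in> X" for n x
  proof -
    have "orb (act n x) \<subseteq> orb x" if "n \<in> NG Q" "x \<in> X" for n x
    proof
      fix y assume "y \<in> orb (act n x)"
      then obtain m where "m \<in> NG Q" "y = act m (act n x)" by (auto simp: orb_def)
      then have "y = act (m \<otimes> n) x" "m \<otimes> n \<in> NG Q" using that act_mult[of m n x] by auto
      then show "y \<in> orb x" unfolding orb_def by blast
    qed
    from this[OF n x] this[of "inv n" "act n x"] show ?thesis
      using n x act_closed[of n x] act_inv_act[of n x] by simp
  qed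
  have rep_orb: "\<exists>n. n \<in> NG Q \<and> x = act n (rep x)" if x: "x \<in> X" for x
  proof -
    have "act \<one> x \<in> orb x" using N.one_closed unfolding orb_def by blast
    then have "rep x \<in> orb x" unfolding rep_def by (rule someI)
    then obtain m where m: "m \<in> NG Q" "rep x = act m x" by (auto simp: orb_def)
    then have "x = act (inv m) (rep x)" using act_inv_act[of m x] x by simp
    then show ?thesis using N.m_inv_closed[OF m(1)] by blast
  qed
  have rep_fix: "rep x \<in> fix_points Q" if x: "x \<in> fix_points Q" for x
  proof -
    have xX: "x \<in> X" using x fix_points_subset by blast
    have "act \<one> x \<in> orb x" using N.one_closed unfolding orb_def by blast
    then have "rep x \<in> orb x" unfolding rep_def by (rule someI)
    then show ?thesis using fix_points_NG[OF QG _ xX] x by (auto simp: orb_def)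
  qed
  define retr where "retr x = act (SOME n. n \<in> NG Q \<and> x = act n (rep x)) (zz (rep x))" for x
  \<comment> \<open>Two choices of n differ by an element stabilizing \<open>rep x\<close>, and this
    element fixes \<open>zz (rep x)\<close> too.\<close>
  have retr: "retr x = act n (zz (rep x))" if x: "x \<in> fix_points Q" and n: "n \<in> NG Q" "x = act n (rep x)" for x n
  proof -
    have xX: "x \<in> X" using x fix_points_subset by blast
    define m where "m = (SOME n. n \<in> NG Q \<and> x = act n (rep x))"
    have m: "m \<in> NG Q" "x = act m (rep x)" using someI_ex[OF rep_orb[OF xX]] by (auto simp: m_def)
    have r: "rep x \<in> fix_points Q" by (rule rep_fix[OF x])
    have rX: "rep x \<in> X" using r fix_points_subset by blast
    have zX: "zz (rep x) \<in> X" using zz(1)[OF r] orbX by blast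
    have mG: "m \<in> carrier G" and nG: "n \<in> carrier G" using subsetD[OF NG_subset] m n by blast+
    have "act (inv m \<otimes> n) (rep x) = act (inv m) (act m (rep x))"
      using act_mult[OF _ nG rX, of "inv m"] mG m(2) n(2) by simp
    then have "act (inv m \<otimes> n) (rep x) = rep x" using act_inv_act[OF mG rX] by simp
    then have "act (inv m \<otimes> n) (zz (rep x)) = zz (rep x)" 
      using zz(2)[OF r N.m_closed[OF N.m_inv_closed[OF m(1)] n(1)]] by blast
    then have "act m (act (inv m) (act n (zz (rep x)))) = act m (zz (rep x))"
      using act_mult[OF _ nG zX, of "inv m"] mG by simp
    then have "act n (zz (rep x)) = act m (zz (rep x))" using act_act_inv[OF mG] act_closed[OF nG zX] by simp
    then show ?thesis by (simp add: retr_def m_def)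
  qed
  show thesis
  proof (rule that[of retr])
    fix x assume x: "x \<in> fix_points Q"
    then have xX: "x \<in> X" using fix_points_subset by blast
    obtain m where m: "m \<in> NG Q" "x = act m (rep x)" using rep_orb[OF xX] by blast
    obtain k where k: "k \<in> NG Q" "zz (rep x) = act k x0" using zz(1)[OF rep_fix[OF x]] by blast
    have "retr x = act (m \<otimes> k) x0" using retr[OF x m] k m act_mult[of m k x0] x0 by simp
    then show "retr x \<in> base_orbit Q" using N.m_closed[OF m(1) k(1)] by blast
    fix n assume n: "n \<in> NG Q"
    have nx: "act n x \<in> fix_points Q" using fix_points_NG[OF QG n xX] x by simp
    have rep: "rep (act n x) = rep x" using orb_act[OF n xX] by (simp add: rep_def)
    have rX: "rep x \<in> X" using rep_fix[OF x] fix_points_subset by blast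
    have zX: "zz (rep x) \<in> X" using zz(1)[OF rep_fix[OF x]] orbX by blast
    have "act n x = act (n \<otimes> m) (rep x)" using act_mult[OF _ _ rX, of n m] n m by simp
    then have "retr (act n x) = act (n \<otimes> m) (zz (rep x))"
      using retr[OF nx, of "n \<otimes> m"] rep n m by simp
    then show "retr (act n x) = act n (retr x)" using retr[OF x m] act_mult[OF _ _ zX, of n m] n m by simp
  qed
qed

text \<open>The case of \<open>scott_summand\<close> in which Z is the fixed point set of Q, Y the
  base orbit and the equivariant map the one obtained from saturation.\<close>

lemma brauer_scott_summand:
  assumes Q: "fully_normalized G P Q" and f: "scott_idem Q f"
  obtains a i j where "a \<in> inv_mats (NG Q)" "a \<star> a = a" "brauer_map Q e \<star> a = a" "a \<star> brauer_map Q e = a"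
    "mat_app a (\<lambda>_. 1) = (\<lambda>x. if x \<in> fix_points Q then 1 else 0)"
    "i \<in> inv_mats (NG Q)" "j \<in> inv_mats (NG Q)" "i \<star> j = a" "j \<star> i = f"
proof -
  have sQ: "subgroup Q G" and QP: "Q \<subseteq> P" using Q by (auto simp: fully_normalized_def)
  have QG: "Q \<subseteq> carrier G" using sQ subgroup.subset by blast
  have pQ: "p_subgroup p G Q" by (rule p_subgroup_in_P[OF sQ QP])
  obtain retr where retr: "\<And>x. x \<in> fix_points Q \<Longrightarrow> retr x \<in> base_orbit Q"
    "\<And>n x. n \<in> NG Q \<Longrightarrow> x \<in> fix_points Q \<Longrightarrow> retr (act n x) = act n (retr x)"
    using equivariant_map_exists[OF Q] by blast
  have sub: "base_orbit Q \<subseteq> fix_points Q" using fix_points_NG[OF QG _ x0] x0_fix_points[OF QP] by blast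
  have f': "prim_idem (NG Q) f" "\<And>x y. f x y \<noteq> 0 \<Longrightarrow> x \<in> base_orbit Q \<and> y \<in> base_orbit Q"
    "mat_app f (\<lambda>_. 1) = (\<lambda>x. if x \<in> base_orbit Q then 1 else 0)"
    using f unfolding scott_idem_def by blast+
  show thesis
    by (rule scott_summand[OF NG_subset sub fix_points_subset fix_points_NG[OF QG] retr f' brauer_map_e[OF pQ]])
      (assumption | rule that)+
qed

text \<open>The nonzero summand a must be all of the primitive \<open>brauer_map Q e\<close>. Hence
  i and j identify the images of f and of \<open>brauer_map Q e\<close>, and primitivity over
  \<open>QC Q\<close> is carried over to f.\<close>

lemma prim_scott_idem_if_prim_brauer_map:
  assumes Q: "fully_normalized G P Q" and f: "scott_idem Q f"
    and b: "prim_idem (QC Q) (brauer_map Q e)"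
  shows "prim_idem (QC Q) f"
proof -
  have sQ: "subgroup Q G" and QP: "Q \<subseteq> P" using Q by (auto simp: fully_normalized_def)
  have sub: "inv_mats (NG Q) \<subseteq> inv_mats (QC Q)" by (rule inv_mats_mono[OF QC_subset_NG[OF sQ]])
  obtain a i j where a: "a \<in> inv_mats (NG Q)" "a \<star> a = a" "brauer_map Q e \<star> a = a" "a \<star> brauer_map Q e = a"
    "mat_app a (\<lambda>_. 1) = (\<lambda>x. if x \<in> fix_points Q then 1 else 0)"
    and ij: "i \<in> inv_mats (NG Q)" "j \<in> inv_mats (NG Q)" "i \<star> j = a" "j \<star> i = f"
    by (rule brauer_scott_summand[OF Q f])
  have f': "f \<in> inv_mats (NG Q)" "f \<star> f = f" "f \<noteq> 0" using f by (auto simp: scott_idem_def prim_idem_def)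
  have "a \<noteq> 0"
  proof
    assume "a = 0"
    then have "f = j \<star> (0 \<star> i)" using f'(2) ij by (metis mult_assoc)
    then show False using f'(3) by (simp add: mult_zero)
  qed
  then have "a = brauer_map Q e" using b a sub unfolding prim_idem_def by blast
  then have "i \<star> j = brauer_map Q e" using ij by simp
  then show ?thesis
    using prim_idem_iso[OF b _ _ f'(2), of j i] ij sub f'(1) QC_subset_NG[OF sQ] NG_subset by blast
qed

section \<open>The core and conjugate subgroups\<close>

lemma core_subset_P: "core G P \<subseteq> P"
  using conj_set_one[OF P_subset] unfolding core_def by blast

lemma core_acts_trivially:
  assumes "c \<in> core G P" "x \<in> X"
  shows "act c x = x"
proof -
  obtain g where g: "g \<in> carrier G" "x = act g x0" using transitive assms by blast
  have "c \<in> conj_set G g P" using assms(1) g(1) unfolding core_def by blast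
  then show ?thesis using stab_iff[OF g(1)] g(2) assms(1) core_subset_P P_subset by blast
qed

lemma core_subset_conj:
  assumes g: "g \<in> carrier G" and Q: "core G P \<subseteq> Q"
  shows "core G P \<subseteq> conj_set G g Q"
proof
  fix c assume c: "c \<in> core G P"
  have cG: "c \<in> carrier G" using c core_subset_P P_subset by blast
  have "conjg G (inv g) c \<in> core G P"
    unfolding core_def
  proof
    fix h assume h: "h \<in> carrier G"
    have "c \<in> conj_set G (g \<otimes> h) P" using c m_closed[OF g h] unfolding core_def by blast
    then have "c \<in> conj_set G g (conj_set G h P)" using conj_set_mult[OF g h P_subset] by simp
    then obtain d where d: "d \<in> conj_set G h P" "c = conjg G g d" unfolding conj_set_def by blast
    then have "conjg G (inv g) c = d"
      using conjg_inv_conjg(1)[OF g] conj_set_closed[OF h P_subset] by blast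
    then show "conjg G (inv g) c \<in> conj_set G h P" using d by simp
  qed
  then have "conjg G (inv g) c \<in> Q" using Q by blast
  then have "conjg G g (conjg G (inv g) c) \<in> conj_set G g Q" unfolding conj_set_def by blast
  then show "c \<in> conj_set G g Q" using conjg_inv_conjg(2)[OF g cG] by simp
qed

lemma QC_subset_carrier: "subgroup Q G \<Longrightarrow> QC Q \<subseteq> carrier G"
  using QC_subset_NG NG_subset by blast

lemma conj_QC_subset:
  assumes g: "g \<in> carrier G" and Q: "subgroup Q G"
  shows "conj_set G g (QC Q) \<subseteq> QC (conj_set G g Q)"
proof
  have QG: "Q \<subseteq> carrier G" using Q subgroup.subset by blast
  fix y assume "y \<in> conj_set G g (QC Q)"
  then obtain q c where y: "y = conjg G g (q \<otimes> c)" "q \<in> Q" "c \<in> centralizer_in G (carrier G) Q"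
    unfolding conj_set_def set_prod_def by blast
  have c: "c \<in> carrier G" "\<And>x. x \<in> Q \<Longrightarrow> conjg G c x = x"
    using y(3) centralizer_in_iff[OF QG] by auto
  have qG: "q \<in> carrier G" using y(2) QG by blast
  have "conjg G (conjg G g c) x = x" if x: "x \<in> conj_set G g Q" for x
  proof -
    obtain z where z: "z \<in> Q" "x = conjg G g z" using x unfolding conj_set_def by blast
    have zG: "z \<in> carrier G" using z QG by blast
    have "conjg G (conjg G g c) x = conjg G (conjg G g c \<otimes> g) z"
      using conjg_conjg[OF conjg_closed[OF g c(1)] g zG] z(2) by simp
    also have "conjg G g c \<otimes> g = g \<otimes> c" using g c(1) by (simp add: conjg_def m_assoc)
    also have "conjg G (g \<otimes> c) z = x" using conjg_conjg[OF g c(1) zG] c(2)[OF z(1)] z(2) by simp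
    finally show ?thesis .
  qed
  then have "conjg G g c \<in> centralizer_in G (carrier G) (conj_set G g Q)"
    using centralizer_in_iff[OF conj_set_closed[OF g QG]] conjg_closed[OF g c(1)] by blast
  moreover have "y = conjg G g q \<otimes> conjg G g c" using y(1) conjg_mult[OF g qG c(1)] by simp
  moreover have "conjg G g q \<in> conj_set G g Q" using y(2) unfolding conj_set_def by blast
  ultimately show "y \<in> QC (conj_set G g Q)" unfolding set_prod_def by blast
qed

text \<open>As e is invariant under G, conjugation by g carries its restriction at Q to the one at
  the conjugate of Q. An inclusion between the groups \<open>QC\<close> suffices, since a primitive
  idempotent stays primitive over any larger group that leaves it invariant.\<close>

lemma prim_brauer_map_conj:
  assumes g: "g \<in> carrier G" and Q: "p_subgroup p G Q" and prim: "prim_idem (QC Q) (brauer_map Q e)"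
  shows "prim_idem (QC (conj_set G g Q)) (brauer_map (conj_set G g Q) e)"
proof -
  have sQ: "subgroup Q G" using Q by (simp add: p_subgroup_def)
  have QG: "Q \<subseteq> carrier G" using sQ subgroup.subset by blast
  have gQ: "p_subgroup p G (conj_set G g Q)" by (rule conj_set_p_subgroup[OF g Q])
  have sgQ: "subgroup (conj_set G g Q) G" using gQ by (simp add: p_subgroup_def)
  have "prim_idem (conj_set G g (QC Q)) (brauer_map (conj_set G g Q) e)"
    using prim_idem_conj[OF g QC_subset_carrier[OF sQ] prim] conj_mat_brauer_map[OF g QG, of e]
      conj_mat_fixed[OF g e_inv] by simp
  then show ?thesis
    by (rule prim_idem_mono[OF _ conj_QC_subset[OF g sQ]])
      (use brauer_map_e(1)[OF gQ] inv_mats_mono[OF QC_subset_NG[OF sgQ]] in blast)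
qed

lemma prim_brauer_map_if_conj:
  assumes g: "g \<in> carrier G" and Q: "p_subgroup p G Q"
    and prim: "prim_idem (QC (conj_set G g Q)) (brauer_map (conj_set G g Q) e)"
  shows "prim_idem (QC Q) (brauer_map Q e)"
proof -
  have "Q \<subseteq> carrier G" using Q subgroup.subset by (auto simp: p_subgroup_def)
  then show ?thesis
    using prim_brauer_map_conj[OF inv_closed[OF g] conj_set_p_subgroup[OF g Q] prim] conj_set_inv(1)[OF g] by simp
qed

text \<open>The summand a obtained from f is primitive over \<open>QC Q\<close> to begin with; all
  the work is to show that its complement a' vanishes. Each way in which a' could be nonzero
  contradicts either the induction hypothesis or \<open>a \<noteq> 0\<close>.\<close>

lemma prim_brauer_map_if_prim_scott_idem:
  assumes hyp: "\<And>Q. fully_normalized G P Q \<Longrightarrow> core G P \<subseteq> Q \<Longrightarrow> \<exists>f. scott_idem Q f \<and> prim_idem (QC Q) f"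
    and Q: "fully_normalized G P Q" "core G P \<subseteq> Q"
  shows "prim_idem (QC Q) (brauer_map Q e)"
  using Q
proof (induction "card P - card Q" arbitrary: Q rule: less_induct)
  case less
  note Q = less.prems(1)
  have sQ: "subgroup Q G" and QP: "Q \<subseteq> P" using Q by (auto simp: fully_normalized_def)
  have QG: "Q \<subseteq> carrier G" using sQ subgroup.subset by blast
  have pQ: "p_subgroup p G Q" by (rule p_subgroup_in_P[OF sQ QP])
  let ?b = "brauer_map Q e"
  obtain f where f: "scott_idem Q f" "prim_idem (QC Q) f" using hyp[OF less.prems] by blast
  obtain a i j where a: "a \<in> inv_mats (NG Q)" "a \<star> a = a" "?b \<star> a = a" "a \<star> ?b = a"
    and a1: "mat_app a (\<lambda>_. 1) = (\<lambda>x. if x \<in> fix_points Q then 1 else 0)"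
    and ij: "i \<in> inv_mats (NG Q)" "j \<in> inv_mats (NG Q)" "i \<star> j = a" "j \<star> i = f"
    by (rule brauer_scott_summand[OF Q f(1)])
  have sub: "inv_mats (NG Q) \<subseteq> inv_mats (QC Q)" by (rule inv_mats_mono[OF QC_subset_NG[OF sQ]])
  have prim_a: "prim_idem (QC Q) a"
    by (rule prim_idem_iso[OF f(2) QC_subset_carrier[OF sQ] subsetD[OF sub a(1)] a(2)
      subsetD[OF sub ij(1)] subsetD[OF sub ij(2)] ij(3,4)])
  define a' where "a' = ?b - a"
  have bb: "?b \<star> ?b = ?b" by (rule brauer_map_e(2)[OF pQ])
  have a': "a' \<in> inv_mats (NG Q)" "a' \<star> a' = a'" "?b \<star> a' = a'" "a' \<star> ?b = a'" "a' \<star> a = 0" "a \<star> a' = 0"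
    using diff_inv_mats[OF brauer_map_e(1)[OF pQ] a(1)] a bb
    by (simp_all add: a'_def mult_diff_left mult_diff_right)
  have a'_supp: "x \<in> fix_points Q \<and> y \<in> fix_points Q" if "a' x y \<noteq> 0" for x y
  proof -
    have "(?b \<star> a' \<star> ?b) x y \<noteq> 0" using that a'(3,4) by simp
    then have "\<exists>z\<in>X. (?b \<star> a') x z * ?b z y \<noteq> 0"
      unfolding mat_mult_def[of "?b \<star> a'" ?b] by (meson sum.neutral)
    then obtain z where z: "(?b \<star> a') x z \<noteq> 0" "?b z y \<noteq> 0" by auto
    then have "\<exists>w\<in>X. ?b x w * a' w z \<noteq> 0"
      unfolding mat_mult_def[of ?b a'] by (meson sum.neutral)
    then obtain w where "?b x w \<noteq> 0" by auto
    then show ?thesis using z brauer_map_e(3)[OF pQ] by blast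
  qed
  have "a' = 0"
  proof (rule ccontr)
    assume a'0: "a' \<noteq> 0"
    show False
    proof (cases "\<exists>R. p_subgroup p G R \<and> Q \<subset> R \<and> R \<subseteq> NG Q \<and> brauer_map R a' \<noteq> 0")
      case False
      have "{g \<in> carrier G. act g x = x \<and> act g y = y} = Q" if nz: "a' x y \<noteq> 0" for x y
      proof (rule ccontr)
        let ?T = "{g \<in> carrier G. act g x = x \<and> act g y = y}"
        assume ne: "?T \<noteq> Q"
        have xy: "x \<in> fix_points Q" "y \<in> fix_points Q" using a'_supp[OF nz] by auto
        have xyX: "x \<in> X" "y \<in> X" using xy fix_points_subset by auto
        have inv_fix: "act (inv g) z = z" if "g \<in> carrier G" "act g z = z" "z \<in> X" for g z
          using act_inv_act[OF that(1,3)] that(2) by simp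
        have sT: "subgroup ?T G"
          by (rule subgroupI) (use xyX act_one one_closed inv_fix act_mult in auto)
        have pT: "p_subgroup p G ?T" by (rule stabilizer_p_subgroup[OF xyX(1) sT]) simp
        have QT: "Q \<subset> ?T" using xy ne QG unfolding fix_points_def by blast
        \<comment> \<open>The stabilizer of the pair need not normalize Q, but the elements of it
          that do form a group strictly larger than Q inside \<open>NG Q\<close>, where a' can be
          restricted.\<close>
        define R where "R = normalizer_in G ?T Q"
        have sR: "subgroup R G" unfolding R_def by (rule normalizer_in_subgroup[OF sT QG])
        have RT: "R \<subseteq> ?T" unfolding R_def normalizer_in_def by blast
        have QR: "Q \<subset> R" unfolding R_def by (rule p_subgroup_normalizer_grows[OF finite_carrier prime_p pT sQ QT])
        have RN: "R \<subseteq> NG Q" unfolding R_def normalizer_in_def by blast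
        have pR: "p_subgroup p G R" by (rule p_subgroup_subset[OF prime_p pT finite_carrier sR RT])
        have "x \<in> fix_points R" "y \<in> fix_points R" using RT xyX unfolding fix_points_def by blast+
        then have "brauer_map R a' x y \<noteq> 0" using nz by (simp add: brauer_map_def)
        then have "brauer_map R a' \<noteq> 0" by auto
        then show False using False pR QR RN by blast
      qed
      \<comment> \<open>A nonzero summand with this support is the whole Brauer quotient, which
        leaves nothing for a.\<close>
      then have "a' = ?b"
        using brauer_map_summand_with_vertex[OF prime_p char_p pQ prim_e a'(1,2) a'0 a'(3,4)] by blast
      then have "a = 0" unfolding a'_def by simp
      then show False using prim_a by (simp add: prim_idem_def)
    next
      case True
      then obtain R where R: "p_subgroup p G R" "Q \<subset> R" "R \<subseteq> NG Q" "brauer_map R a' \<noteq> 0" by blast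
      have sR: "subgroup R G" using R(1) by (simp add: p_subgroup_def)
      have RG: "R \<subseteq> carrier G" using sR subgroup.subset by blast
      obtain x y where "brauer_map R a' x y \<noteq> 0" using R(4) by (metis ext zero_fun_apply)
      then have x: "x \<in> fix_points R" by (auto simp: brauer_map_def split: if_splits)
      obtain g where g: "g \<in> carrier G" "x = act g x0" using x fix_points_subset transitive by blast
      have Rg: "R \<subseteq> conj_set G g P" using x g in_fix_points_iff[OF g(1) RG] by simp
      then have Qg: "Q \<subseteq> conj_set G g P" using R(2) by blast
      \<comment> \<open>Saturation moves R into P by an element normalizing Q; a' is invariant under
        that element and so stays nonzero at the new group R'.\<close>
      obtain m where m: "m \<in> NG Q" "conj_set G m (normalizer_in G (conj_set G g P) Q) \<subseteq> P"
        using saturated_normalizer_conj[OF finite_carrier prime_p P saturated Q g(1) Qg] by blast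
      have mG: "m \<in> carrier G" "conj_set G m Q = Q" using m(1) by (auto simp: normalizer_in_def)
      define R' where "R' = conj_set G m R"
      have "R \<subseteq> normalizer_in G (conj_set G g P) Q" using Rg R(3) unfolding normalizer_in_def by blast
      then have R'P: "R' \<subseteq> P" using m(2) conj_set_mono unfolding R'_def by blast
      have pR': "p_subgroup p G R'" unfolding R'_def by (rule conj_set_p_subgroup[OF mG(1) R(1)])
      have sR': "subgroup R' G" using pR' by (simp add: p_subgroup_def)
      have QR': "Q \<subseteq> R'" using conj_set_mono[of Q R m] R(2) mG(2) unfolding R'_def by blast
      have cardR': "card R' = card R" unfolding R'_def by (rule card_conj_set[OF mG(1) RG])
      have "finite R" using R(1) by (simp add: p_subgroup_def)
      then have cardQ: "card Q < card R'" using psubset_card_mono R(2) cardR' by metis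
      have conj_a': "conj_mat m a' = a'"
      proof (intro ext)
        fix x y
        interpret N: subgroup "NG Q" G by (rule normalizer_in_subgroup[OF subgroup_self QG])
        show "conj_mat m a' x y = a' x y"
          using inv_mats_act[OF a'(1) N.m_inv_closed[OF m(1)], of x y] inv_mats_supp[OF a'(1), of x y]
          by (auto simp: conj_mat_def)
      qed
      have "brauer_map R' a' = conj_mat m (brauer_map R a')"
        unfolding R'_def using conj_mat_brauer_map[OF mG(1) RG, of a'] conj_a' by simp
      moreover have "conj_mat m (brauer_map R a') \<noteq> 0"
      proof
        have "a' \<in> inv_mats {}" using a'(1) inv_mats_mono by blast
        then have "brauer_map R a' \<in> inv_mats {}" by (rule brauer_map_inv_mats[OF _ RG]) simp
        moreover assume "conj_mat m (brauer_map R a') = 0"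
        ultimately have "brauer_map R a' = 0" using conj_mat_inv(1)[OF mG(1)] conj_mat_zero by metis
        then show False using R(4) by simp
      qed
      ultimately have ba'0: "brauer_map R' a' \<noteq> 0" by simp
      have R'N: "R' \<subseteq> NG Q"
      proof
        fix r' assume "r' \<in> R'"
        then obtain r where r: "r \<in> R" "r' = m \<otimes> r \<otimes> inv m" unfolding R'_def conj_set_def conjg_def by blast
        interpret N: subgroup "NG Q" G by (rule normalizer_in_subgroup[OF subgroup_self QG])
        show "r' \<in> NG Q" unfolding r(2) using r(1) R(3) m(1) N.m_closed N.m_inv_closed by blast
      qed
      \<comment> \<open>R' fixes \<open>x0\<close> and a fixes the constant function, so the
        restriction of a sends the constant function to one with value 1 at
        \<open>x0\<close>.\<close>
      have ba0: "brauer_map R' a \<noteq> 0"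
      proof
        assume z: "brauer_map R' a = 0"
        have "a \<in> inv_mats R'" using a(1) inv_mats_mono[OF R'N] by blast
        then have "mat_app (brauer_map R' a) (\<lambda>_. 1) x0 = mat_app a (\<lambda>_. 1) x0"
          by (intro mat_app_brauer_map[OF prime_p char_p pR' _ _ x0_fix_points[OF R'P]]) auto
        then have "(1::'k) = 0" using a1 x0_fix_points[OF QP] by (simp add: z app_zero_mat)
        then show False by simp
      qed
      have subR': "inv_mats (NG Q) \<subseteq> inv_mats R'" by (rule inv_mats_mono[OF R'N])
      \<comment> \<open>An element centralizing R' centralizes its subgroup Q. So a is invariant
        under all of \<open>QC R'\<close>, and its restriction is one of the idempotents against
        which primitivity over \<open>QC R'\<close> is tested.\<close>
      have QCR': "QC R' \<subseteq> NG Q"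
      proof
        fix h assume "h \<in> QC R'"
        then obtain r c where h: "h = r \<otimes> c" "r \<in> R'" "c \<in> centralizer_in G (carrier G) R'"
          unfolding set_prod_def by blast
        interpret N: subgroup "NG Q" G by (rule normalizer_in_subgroup[OF subgroup_self QG])
        have c: "c \<in> carrier G" "\<forall>q\<in>Q. conjg G c q = q"
          using h(3) centralizer_in_iff[OF subgroup.subset[OF sR']] QR' by auto
        then have "conj_set G c Q = Q" unfolding conj_set_def by force
        then have "c \<in> NG Q" using c(1) unfolding normalizer_in_def by blast
        then show "h \<in> NG Q" unfolding h(1) using h(2) R'N N.m_closed by blast
      qed
      have br_a: "brauer_map R' a \<in> inv_mats (QC R')"
        by (rule brauer_map_inv_mats[OF subsetD[OF inv_mats_mono[OF QCR'] a(1)] subgroup.subset[OF sR']])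
          (rule set_prod_centralizer_normalizes[OF sR'])
      have mul: "brauer_map R' (c \<star> d) = brauer_map R' c \<star> brauer_map R' d"
        if "c \<in> inv_mats (NG Q)" "d \<in> inv_mats (NG Q)" for c d :: "'x \<Rightarrow> 'x \<Rightarrow> 'k"
        using brauer_map_mult[OF prime_p char_p pR'] that subR' by blast
      have tw: "brauer_map R' ?b = brauer_map R' e" by (rule brauer_map_twice[OF QR'])
      have bN: "?b \<in> inv_mats (NG Q)" by (rule brauer_map_e(1)[OF pQ])
      have "brauer_map R' a \<star> brauer_map R' a = brauer_map R' a" using mul[OF a(1) a(1)] a(2) by simp
      moreover have "brauer_map R' e \<star> brauer_map R' a = brauer_map R' a" using mul[OF bN a(1)] a(3) tw by simp
      moreover have "brauer_map R' a \<star> brauer_map R' e = brauer_map R' a" using mul[OF a(1) bN] a(4) tw by simp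
      moreover have "brauer_map R' a \<noteq> brauer_map R' e"
      proof
        assume "brauer_map R' a = brauer_map R' e"
        then have "brauer_map R' a' = 0" unfolding a'_def by (simp add: brauer_map_diff tw)
        then show False using ba'0 by simp
      qed
      ultimately have "\<not> prim_idem (QC R') (brauer_map R' e)"
        using ba0 br_a unfolding prim_idem_def by blast
      moreover have "prim_idem (QC R') (brauer_map R' e)"
      proof -
        \<comment> \<open>R' itself may fail to be fully normalized; a conjugate of the same order
          is, and primitivity is transported back.\<close>
        obtain h where h: "h \<in> carrier G" "fully_normalized G P (conj_set G h R')"
          using fully_normalized_conj_exists[OF finite_carrier subgroup_P sR' R'P] by blast
        have "card (conj_set G h R') = card R'" by (rule card_conj_set[OF h(1) subgroup.subset[OF sR']])
        moreover have "card R' \<le> card P" using R'P P by (intro card_mono) (auto simp: p_subgroup_def)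
        ultimately have "card P - card (conj_set G h R') < card P - card Q" using cardQ by simp
        moreover have "core G P \<subseteq> conj_set G h R'"
          using core_subset_conj[OF h(1)] less.prems(2) QR' by blast
        ultimately have "prim_idem (QC (conj_set G h R')) (brauer_map (conj_set G h R') e)"
          using less.hyps h(2) by blast
        then show ?thesis by (rule prim_brauer_map_if_conj[OF h(1) pR'])
      qed
      ultimately show False by blast
    qed
  qed
  then have "a = ?b" unfolding a'_def by simp
  then show ?case using prim_a by simp
qed

text \<open>The core acts trivially, so \<open>Q\<close> may be enlarged by all elements of \<open>P\<close> that act like an
  element of \<open>Q\<close>.\<close>

lemma brauer_map_zero_or_prim:
  assumes hyp: "\<And>Q. fully_normalized G P Q \<Longrightarrow> core G P \<subseteq> Q \<Longrightarrow> prim_idem (QC Q) (brauer_map Q e)"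
    and Q: "p_subgroup p G Q"
  shows "brauer_map Q e = 0 \<or> prim_idem (QC Q) (brauer_map Q e)"
proof (cases "fix_points Q = {}")
  case True
  then show ?thesis by (auto simp: brauer_map_def fun_eq_iff)
next
  case False
  have main: "prim_idem (QC Q) (brauer_map Q e)" if sQ: "subgroup Q G" and QP: "Q \<subseteq> P" for Q
  proof -
    interpret P: subgroup P G by (rule subgroup_P)
    interpret Q: subgroup Q G by (rule sQ)
    define R where "R = {g \<in> P. \<exists>q\<in>Q. \<forall>x\<in>X. act g x = act q x}"
    have RP: "R \<subseteq> P" unfolding R_def by blast
    have QR: "Q \<subseteq> R" using QP unfolding R_def by blast
    have sR: "subgroup R G"
    proof (rule subgroupI)
      show "R \<subseteq> carrier G" using RP P_subset by blast
      show "R \<noteq> {}" using QR Q.one_closed by blast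
    next
      fix g assume "g \<in> R"
      then obtain q where g: "g \<in> P" "q \<in> Q" "\<forall>x\<in>X. act g x = act q x" unfolding R_def by blast
      have "act (inv g) x = act (inv q) x" if x: "x \<in> X" for x
      proof -
        have "act g (act (inv q) x) = x" using g x act_closed[of "inv q" x] act_act_inv[of q x] by simp
        then show ?thesis using act_inv_act[of g "act (inv q) x"] act_closed[of "inv q" x] g x by simp
      qed
      then show "inv g \<in> R" using g P.m_inv_closed Q.m_inv_closed unfolding R_def by blast
    next
      fix g h assume "g \<in> R" "h \<in> R"
      then obtain q r where g: "g \<in> P" "q \<in> Q" "\<forall>x\<in>X. act g x = act q x"
        and h: "h \<in> P" "r \<in> Q" "\<forall>x\<in>X. act h x = act r x" unfolding R_def by blast
      have "act (g \<otimes> h) x = act (q \<otimes> r) x" if "x \<in> X" for x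
        using that g h act_mult[of g h x] act_mult[of q r x] act_closed[of r x] by simp
      then show "g \<otimes> h \<in> R" using g h P.m_closed Q.m_closed unfolding R_def by blast
    qed
    have pR: "p_subgroup p G R" by (rule p_subgroup_in_P[OF sR RP])
    have "core G P \<subseteq> R"
    proof
      fix c assume c: "c \<in> core G P"
      then have "\<forall>x\<in>X. act c x = act \<one> x" using core_acts_trivially act_one by simp
      then show "c \<in> R" using c core_subset_P Q.one_closed unfolding R_def by blast
    qed
    moreover obtain h where h: "h \<in> carrier G" "fully_normalized G P (conj_set G h R)"
      using fully_normalized_conj_exists[OF finite_carrier subgroup_P sR RP] by blast
    ultimately have "prim_idem (QC (conj_set G h R)) (brauer_map (conj_set G h R) e)"
      using hyp core_subset_conj by blast
    then have prim: "prim_idem (QC R) (brauer_map R e)" by (rule prim_brauer_map_if_conj[OF h(1) pR])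
    have "fix_points R = fix_points Q"
    proof
      show "fix_points R \<subseteq> fix_points Q" using QR unfolding fix_points_def by blast
      show "fix_points Q \<subseteq> fix_points R"
      proof
        fix x assume x: "x \<in> fix_points Q"
        have "act g x = x" if "g \<in> R" for g
        proof -
          obtain q where "q \<in> Q" "act g x = act q x" using \<open>g \<in> R\<close> x unfolding R_def fix_points_def by blast
          then show ?thesis using x by (simp add: fix_points_def)
        qed
        then show "x \<in> fix_points R" using x by (simp add: fix_points_def)
      qed
    qed
    then have br: "brauer_map R e = brauer_map Q e" by (simp add: brauer_map_def)
    \<comment> \<open>Elements of \<open>QC R\<close> act on X like elements of \<open>QC Q\<close>,
      because R acts through Q and centralizing R implies centralizing Q. Hence idempotents
      invariant under \<open>QC Q\<close> are covered by primitivity over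
      \<open>QC R\<close>.\<close>
    have sub: "(inv_mats (QC Q) :: ('x \<Rightarrow> 'x \<Rightarrow> 'k) set) \<subseteq> inv_mats (QC R)"
    proof
      fix a :: "'x \<Rightarrow> 'x \<Rightarrow> 'k" assume a: "a \<in> inv_mats (QC Q)"
      have "a (act h x) (act h y) = a x y" if h: "h \<in> QC R" and xy: "x \<in> X" "y \<in> X" for h x y
      proof -
        obtain g c where gc: "h = g \<otimes> c" "g \<in> R" "c \<in> centralizer_in G (carrier G) R"
          using h unfolding set_prod_def by blast
        obtain q where q: "g \<in> P" "q \<in> Q" "\<forall>x\<in>X. act g x = act q x" using gc(2) unfolding R_def by blast
        have c: "c \<in> centralizer_in G (carrier G) Q" using gc(3) QR unfolding centralizer_in_def by blast
        then have cG: "c \<in> carrier G" unfolding centralizer_in_def by blast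
        have "act h z = act (q \<otimes> c) z" if "z \<in> X" for z
          using that q gc(1) cG act_mult[of g c z] act_mult[of q c z] act_closed[of c z] by simp
        moreover have "q \<otimes> c \<in> QC Q" using q(2) c unfolding set_prod_def by blast
        ultimately show ?thesis using inv_mats_act[OF a] xy by simp
      qed
      then show "a \<in> inv_mats (QC R)" using inv_mats_supp[OF a] unfolding inv_mats_def by blast
    qed
    have pQ: "p_subgroup p G Q" by (rule p_subgroup_in_P[OF sQ QP])
    have "brauer_map Q e \<in> inv_mats (QC Q)"
      using brauer_map_e(1)[OF pQ] inv_mats_mono[OF QC_subset_NG[OF sQ]] by blast
    then show ?thesis using prim sub unfolding br prim_idem_def by blast
  qed
  have sQ: "subgroup Q G" using Q by (simp add: p_subgroup_def)
  have QG: "Q \<subseteq> carrier G" using sQ subgroup.subset by blast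
  \<comment> \<open>A fixed point of Q puts a conjugate of Q inside P, where \<open>main\<close>
    applies.\<close>
  obtain g where g: "g \<in> carrier G" "act g x0 \<in> fix_points Q"
    using False fix_points_subset transitive by blast
  then have "Q \<subseteq> conj_set G g P" using in_fix_points_iff[OF g(1) QG] by simp
  then have "conj_set G (inv g) Q \<subseteq> P" using conj_set_mono conj_set_inv(1)[OF g(1) P_subset] by metis
  moreover have "subgroup (conj_set G (inv g) Q) G" using conj_set_subgroup[OF inv_closed[OF g(1)] sQ] .
  ultimately have "prim_idem (QC (conj_set G (inv g) Q)) (brauer_map (conj_set G (inv g) Q) e)"
    using main by blast
  then show ?thesis using prim_brauer_map_if_conj[OF inv_closed[OF g(1)] Q] by blast
qed

end

section \<open>Modules of functions on a group and functions on cosets\<close>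

lemma lin_span_subspace: "lin_subspace (lin_span S)"
  unfolding lin_subspace_def lin_span_def by blast

lemma lin_span_superset: "S \<subseteq> lin_span S"
  unfolding lin_span_def by blast

lemma lin_span_least: "lin_subspace W \<Longrightarrow> S \<subseteq> W \<Longrightarrow> lin_span S \<subseteq> W"
  unfolding lin_span_def by blast

locale coset_space = group G for G :: "('g, 'b) monoid_scheme" (structure) +
  fixes P :: "'g set"
  assumes fin_carrier: "finite (carrier G)" and sub_P: "subgroup P G"
begin

abbreviation cosets :: "'g set set" where
  "cosets \<equiv> lcosets_in G (carrier G) P"

sublocale finite_action G cosets "l_coset G"
  by (rule lcosets_finite_action[OF fin_carrier sub_P])

notation mat_mult (infixl \<open>\<star>\<close> 70)

text \<open>Functions on H constant on cosets of \<open>H \<inter> P\<close> become functions on the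
  cosets hP with h in H, a part of G/P; thus modules induced from different subgroups are spaces of
  functions on one set. The representative is taken in \<open>C \<inter> H\<close> because such
  functions vanish off H.\<close>

definition coset_fun :: "'g set \<Rightarrow> ('g \<Rightarrow> 'k::field) \<Rightarrow> 'g set \<Rightarrow> 'k" where
  "coset_fun H f = (\<lambda>C. if C \<in> lcosets_in G H P then f (SOME x. x \<in> C \<inter> H) else 0)"

definition fun_of :: "'g set \<Rightarrow> ('g set \<Rightarrow> 'k::field) \<Rightarrow> 'g \<Rightarrow> 'k" where
  "fun_of H F = (\<lambda>x. if x \<in> H then F (x <# P) else 0)"

lemma P_closed: "P \<subseteq> carrier G" using sub_P subgroup.subset by blast

lemma lcosets_subset: "H \<subseteq> carrier G \<Longrightarrow> lcosets_in G H P \<subseteq> cosets"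
  by (auto simp: lcosets_in_def)

lemma act_coset: "g \<in> carrier G \<Longrightarrow> x \<in> carrier G \<Longrightarrow> g <# (x <# P) = (g \<otimes> x) <# P"
  by (rule lcos_m_assoc[OF P_closed])

text \<open>Two points of H in the same coset of P differ by an element of
  \<open>H \<inter> P\<close>, so the choice of the representative does not matter.\<close>

lemma coset_fun_apply:
  assumes H: "subgroup H G" and f: "f \<in> ind_triv G H (H \<inter> P)" and x: "x \<in> H"
  shows "coset_fun H f (x <# P) = f x"
proof -
  interpret H: subgroup H G by fact
  interpret P: subgroup P G by (rule sub_P)
  define y where "y = (SOME y. y \<in> (x <# P) \<inter> H)"
  have xG: "x \<in> carrier G" using x by simp
  have "x = x \<otimes> \<one>" using xG by simp
  then have "x \<in> (x <# P) \<inter> H" using x P.one_closed unfolding l_coset_def by blast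
  then have "y \<in> (x <# P) \<inter> H" unfolding y_def by (rule someI)
  then obtain r where r: "r \<in> P" "y = x \<otimes> r" and yH: "y \<in> H" unfolding l_coset_def by blast
  have "r = inv x \<otimes> y" using r xG P.mem_carrier[OF r(1)] by (simp add: m_assoc[symmetric])
  moreover have "inv x \<otimes> y \<in> H" using x yH by blast
  ultimately have "r \<in> H \<inter> P" using r(1) by blast
  then have "f y = f x" using f x r(2) unfolding ind_triv_def by blast
  moreover have "x <# P \<in> lcosets_in G H P" using x unfolding lcosets_in_def by blast
  ultimately show ?thesis by (simp add: coset_fun_def y_def)
qed

lemma coset_fun_supp: "C \<notin> lcosets_in G H P \<Longrightarrow> coset_fun H f C = 0"
  by (simp add: coset_fun_def)

lemma fun_of_ind_triv:
  assumes H: "subgroup H G"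
  shows "fun_of H F \<in> ind_triv G H (H \<inter> P)"
proof -
  interpret H: subgroup H G by fact
  interpret P: subgroup P G by (rule sub_P)
  have "(x \<otimes> r) <# P = x <# P" if "x \<in> H" "r \<in> H \<inter> P" for x r
    using that lcoset_eq_iff[OF sub_P, of "x \<otimes> r" x] by (simp add: m_assoc[symmetric])
  then show ?thesis unfolding ind_triv_def fun_of_def by auto
qed

lemma coset_fun_fun_of:
  assumes H: "subgroup H G" and F: "\<And>C. C \<notin> lcosets_in G H P \<Longrightarrow> F C = 0"
  shows "coset_fun H (fun_of H F) = F"
proof
  fix C
  show "coset_fun H (fun_of H F) C = F C"
  proof (cases "C \<in> lcosets_in G H P")
    case True
    then obtain x where "x \<in> H" "C = x <# P" unfolding lcosets_in_def by blast
    then show ?thesis using coset_fun_apply[OF H fun_of_ind_triv[OF H]] by (simp add: fun_of_def)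
  qed (simp add: coset_fun_supp F)
qed

lemma fun_of_coset_fun:
  assumes H: "subgroup H G" and f: "f \<in> ind_triv G H (H \<inter> P)"
  shows "fun_of H (coset_fun H f) = f"
proof
  fix x
  show "fun_of H (coset_fun H f) x = f x"
    using f coset_fun_apply[OF H f, of x] by (auto simp: fun_of_def ind_triv_def)
qed

lemma coset_fun_linear:
  "coset_fun H (f + f') = coset_fun H f + coset_fun H f'"
  "coset_fun H (\<lambda>x. c * f x) = (\<lambda>C. c * coset_fun H f C)"
  "coset_fun H 0 = 0"
  by (auto simp: coset_fun_def fun_eq_iff)

lemma fun_of_linear:
  "fun_of H (F + F') = fun_of H F + fun_of H F'"
  "fun_of H (\<lambda>C. c * F C) = (\<lambda>x. c * fun_of H F x)"
  "fun_of H 0 = 0"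
  by (auto simp: fun_of_def fun_eq_iff)

lemma gact_fun_of:
  assumes H: "subgroup H G" and h: "h \<in> H"
  shows "gact G h (fun_of H F) = fun_of H (transl h F)"
proof
  interpret H: subgroup H G by fact
  fix x
  show "gact G h (fun_of H F) x = fun_of H (transl h F) x"
  proof (cases "x \<in> carrier G")
    case True
    have "inv h \<otimes> x \<in> H \<longleftrightarrow> x \<in> H"
    proof
      assume "inv h \<otimes> x \<in> H"
      then have "h \<otimes> (inv h \<otimes> x) \<in> H" using h by blast
      then show "x \<in> H" using True h by (simp add: m_assoc[symmetric])
    qed (use h in simp)
    moreover have "x <# P \<in> cosets" using True unfolding lcosets_in_def by blast
    ultimately show ?thesis
      using True h by (simp add: gact_def fun_of_def transl_def act_coset)
  next
    case False
    then show ?thesis using H.mem_carrier by (auto simp: gact_def fun_of_def)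
  qed
qed

lemma transl_supp:
  assumes H: "subgroup H G" and h: "h \<in> H" and F: "\<And>C. C \<notin> lcosets_in G H P \<Longrightarrow> F C = 0"
    and C: "C \<notin> lcosets_in G H P"
  shows "transl h F C = 0"
proof (rule ccontr)
  interpret H: subgroup H G by fact
  assume "transl h F C \<noteq> 0"
  then have CX: "C \<in> cosets" and "F (inv h <# C) \<noteq> 0" by (auto simp: transl_def split: if_splits)
  then have "inv h <# C \<in> lcosets_in G H P" using F by blast
  then obtain x where x: "x \<in> H" "inv h <# C = x <# P" unfolding lcosets_in_def by blast
  have "C = h <# (inv h <# C)" using act_act_inv[OF H.mem_carrier[OF h] CX] by simp
  also have "\<dots> = (h \<otimes> x) <# P" unfolding x(2) using act_coset h x(1) by simp
  finally show False using C h x(1) unfolding lcosets_in_def by blast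
qed

lemma coset_fun_gact:
  assumes H: "subgroup H G" and h: "h \<in> H" and f: "f \<in> ind_triv G H (H \<inter> P)"
  shows "coset_fun H (gact G h f) = transl h (coset_fun H f)"
proof -
  have "gact G h f = fun_of H (transl h (coset_fun H f))"
    using gact_fun_of[OF H h, of "coset_fun H f"] fun_of_coset_fun[OF H f] by simp
  then show ?thesis
    using coset_fun_fun_of[OF H transl_supp[OF H h coset_fun_supp]] by simp
qed

lemma transl_fixed_iff:
  assumes H: "subgroup H G" and F: "\<And>C. C \<notin> cosets \<Longrightarrow> F C = 0"
  shows "(\<forall>h\<in>H. transl h F = F) \<longleftrightarrow> (\<forall>h\<in>H. \<forall>C\<in>cosets. F (h <# C) = F C)"
proof (intro iffI ballI)
  interpret H: subgroup H G by fact
  fix h C assume *: "\<forall>h\<in>H. transl h F = F" and h: "h \<in> H" and C: "C \<in> cosets"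
  have "F (h <# C) = transl h F (h <# C)" using * h by simp
  also have "\<dots> = F C" using h C act_closed[of h C] act_inv_act[of h C] by (simp add: transl_def)
  finally show "F (h <# C) = F C" .
next
  interpret H: subgroup H G by fact
  fix h assume *: "\<forall>h\<in>H. \<forall>C\<in>cosets. F (h <# C) = F C" and h: "h \<in> H"
  show "transl h F = F"
    using * H.m_inv_closed[OF h] F by (auto simp: transl_def fun_eq_iff)
qed

text \<open>The cosets hP form a single H-orbit through P, so an invariant function supported there
  is determined by its value at P. A fixed vector of a Scott module thereby becomes a multiple of
  the constant function.\<close>

lemma H_fixed_constant:
  assumes H: "subgroup H G" and F: "\<And>C. C \<notin> lcosets_in G H P \<Longrightarrow> F C = 0"
    and fixed: "\<And>h. h \<in> H \<Longrightarrow> transl h F = F"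
  shows "F = (\<lambda>C. F P * (if C \<in> lcosets_in G H P then 1 else 0))"
proof
  interpret H: subgroup H G by fact
  fix C
  show "F C = F P * (if C \<in> lcosets_in G H P then 1 else 0)"
  proof (cases "C \<in> lcosets_in G H P")
    case True
    then obtain h where h: "h \<in> H" "C = h <# P" unfolding lcosets_in_def by blast
    have FX: "F C = 0" if "C \<notin> cosets" for C using F lcosets_subset[OF H.subset] that by blast
    have "P = \<one> <# P" using lcos_mult_one[OF P_closed] by simp
    then have "P \<in> cosets" unfolding lcosets_in_def by blast
    then have "F (h <# P) = F P" using transl_fixed_iff[OF H, of F] FX fixed h(1) by blast
    then show ?thesis using True h(2) by simp
  qed (simp add: F)
qed

lemma ind_triv_subspace: "lin_subspace (ind_triv G H R)"
  by (rule lin_subspaceI) (auto simp: ind_triv_def)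

text \<open>The idempotent that cuts functions on all cosets down to Y; it stands for the whole
  induced module when Y is the H-orbit of P.\<close>

definition id_on :: "'g set set \<Rightarrow> 'g set \<Rightarrow> 'g set \<Rightarrow> 'k::field" where
  "id_on Y = (\<lambda>x y. if x = y \<and> x \<in> Y then 1 else 0)"

lemma id_on_app: "Y \<subseteq> cosets \<Longrightarrow> mat_app (id_on Y) F = (\<lambda>x. if x \<in> Y then F x else 0)"
  using finite_points
  by (auto simp: mat_app_def id_on_def fun_eq_iff if_distrib[of "\<lambda>t. t * _"] cong: if_cong)

lemma lcosets_stable:
  assumes H: "subgroup H G" and h: "h \<in> H" and C: "C \<in> cosets"
  shows "h <# C \<in> lcosets_in G H P \<longleftrightarrow> C \<in> lcosets_in G H P"
proof -
  interpret H: subgroup H G by fact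
  have 1: "k <# D \<in> lcosets_in G H P" if D: "k \<in> H" "D \<in> lcosets_in G H P" for k D
  proof -
    obtain x where x: "x \<in> H" "D = x <# P" using D(2) unfolding lcosets_in_def by blast
    then have "k <# D = (k \<otimes> x) <# P" using act_coset D(1) by simp
    then show ?thesis using x D(1) unfolding lcosets_in_def by blast
  qed
  show ?thesis using 1[OF h] 1[OF H.m_inv_closed[OF h], of "h <# C"] act_inv_act[OF H.mem_carrier[OF h] C] by metis
qed

lemma id_on_inv_mats:
  assumes H: "subgroup H G"
  shows "id_on (lcosets_in G H P) \<in> inv_mats H"
  unfolding inv_mats_def
proof (intro CollectI conjI allI impI ballI)
  interpret H: subgroup H G by fact
  fix x y assume "id_on (lcosets_in G H P) x y \<noteq> 0"
  then show "x \<in> cosets" "y \<in> cosets"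
    using lcosets_subset[OF H.subset] by (auto simp: id_on_def split: if_splits)
next
  interpret H: subgroup H G by fact
  fix h x y assume "h \<in> H" "x \<in> cosets" "y \<in> cosets"
  then show "id_on (lcosets_in G H P) (h <# x) (h <# y) = id_on (lcosets_in G H P) x y"
    using lcosets_stable[OF H] act_inject[of h x y] by (simp add: id_on_def)
qed

text \<open>Primitivity is kept separate, so that an idempotent of least rank can be sought among
  those satisfying these conditions.\<close>

definition scott_mat :: "'g set \<Rightarrow> ('g set \<Rightarrow> 'g set \<Rightarrow> 'k::field) \<Rightarrow> bool" where
  "scott_mat H f \<longleftrightarrow> f \<in> inv_mats H \<and> f \<star> f = f \<and>
     (\<forall>x y. f x y \<noteq> 0 \<longrightarrow> x \<in> lcosets_in G H P \<and> y \<in> lcosets_in G H P) \<and>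
     mat_app f (\<lambda>_. 1) = (\<lambda>x. if x \<in> lcosets_in G H P then 1 else 0)"

lemma mat_app_supp_row:
  assumes "\<And>x y. f x y \<noteq> 0 \<Longrightarrow> x \<in> Y" "x \<notin> Y"
  shows "mat_app f F x = 0"
proof -
  have "f x y = 0" for y using assms by blast
  then show ?thesis by (simp add: mat_app_def)
qed

lemma supp_of_id_on:
  assumes Y: "Y \<subseteq> cosets" and f: "id_on Y \<star> f = f" "f \<star> id_on Y = f" "f x y \<noteq> 0"
  shows "x \<in> Y \<and> y \<in> Y"
proof -
  have "(id_on Y \<star> f) x y = 0" if "x \<notin> Y"
    using that by (simp add: mat_mult_def id_on_def)
  moreover have "(f \<star> id_on Y) x y = 0" if "y \<notin> Y"
    using that by (auto simp: mat_mult_def id_on_def intro!: sum.neutral)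
  ultimately show ?thesis using f by metis
qed

text \<open>On S the map \<open>coset_fun H\<close> is injective, so the kernel in the general
  criterion is zero. The smaller group K allows indecomposability to be tested after
  restriction.\<close>

lemma indec_quot_iff_prim_scott:
  assumes H: "subgroup H G" and K: "K \<subseteq> H"
    and f: "f \<in> inv_mats H" "f \<star> f = f"
    and S: "submodule G H S" "S \<subseteq> ind_triv G H (H \<inter> P)" "coset_fun H ` S = range (mat_app f)"
  shows "indec_quot G K S {\<lambda>x. 0} \<longleftrightarrow> prim_idem K f"
proof (rule indec_quot_iff_prim_idem[where \<rho> = "coset_fun H"])
  interpret H: subgroup H G by fact
  show "f \<in> inv_mats K" using f inv_mats_mono[OF K] by blast
  show "f \<star> f = f" by fact
  show "K \<subseteq> carrier G" using K H.subset by blast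
  show "submodule G K S" using S(1) K unfolding submodule_def by blast
  show "coset_fun H (v + w) = coset_fun H v + coset_fun H w" for v w by (rule coset_fun_linear)
  show "coset_fun H (\<lambda>x. c * v x) = (\<lambda>x. c * coset_fun H v x)" for c v by (rule coset_fun_linear)
  show "coset_fun H (gact G h v) = transl h (coset_fun H v)" if "h \<in> K" "v \<in> S" for h v
    using coset_fun_gact[OF H] that K S(2) by blast
  show "coset_fun H ` S = range (mat_app f)" by fact
  have "v = 0" if v: "v \<in> S" "coset_fun H v = 0" for v
    using fun_of_coset_fun[OF H subsetD[OF S(2) v(1)]] v(2) by (simp add: fun_of_linear)
  moreover have "0 \<in> S" using S(1) lin_subspace_zero unfolding submodule_def by blast
  ultimately have "{v \<in> S. coset_fun H v = 0} = {0}" by (auto simp: coset_fun_linear)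
  then show "{\<lambda>x. 0} = {v \<in> S. coset_fun H v = 0}" by (simp add: zero_fun_def)
qed

lemma coset_fun_submodule:
  assumes H: "subgroup H G" and S: "submodule G H S" "S \<subseteq> ind_triv G H (H \<inter> P)"
  shows "lin_subspace (coset_fun H ` S)" "\<And>h F. h \<in> H \<Longrightarrow> F \<in> coset_fun H ` S \<Longrightarrow> transl h F \<in> coset_fun H ` S"
proof -
  have Ss: "lin_subspace S" using S(1) unfolding submodule_def by blast
  show "lin_subspace (coset_fun H ` S)"
  proof (rule lin_subspaceI)
    show "0 \<in> coset_fun H ` S"
      using lin_subspace_zero[OF Ss] by (intro image_eqI[where x = 0]) (simp_all add: coset_fun_linear)
  next
    fix F F' assume "F \<in> coset_fun H ` S" "F' \<in> coset_fun H ` S"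
    then obtain v w where vw: "v \<in> S" "w \<in> S" "F = coset_fun H v" "F' = coset_fun H w" by blast
    show "F + F' \<in> coset_fun H ` S"
      using lin_subspace_add[OF Ss vw(1,2)] unfolding vw(3,4)
      by (intro image_eqI[where x = "v + w"]) (simp_all only: coset_fun_linear)
  next
    fix c F assume "F \<in> coset_fun H ` S"
    then obtain v where v: "v \<in> S" "F = coset_fun H v" by blast
    show "(\<lambda>x. c * F x) \<in> coset_fun H ` S"
      using lin_subspace_scale[OF Ss v(1)] unfolding v(2)
      by (intro image_eqI[where x = "\<lambda>x. c * v x"]) (simp_all only: coset_fun_linear)
  qed
  fix h F assume h: "h \<in> H" and "F \<in> coset_fun H ` S"
  then obtain v where v: "v \<in> S" "F = coset_fun H v" by blast
  have "transl h F = coset_fun H (gact G h v)" using coset_fun_gact[OF H h subsetD[OF S(2) v(1)]] v(2) by simp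
  moreover have "gact G h v \<in> S" using S(1) h v(1) unfolding submodule_def by blast
  ultimately show "transl h F \<in> coset_fun H ` S" by blast
qed

text \<open>The projection onto S along a complement gives f. A nonzero fixed vector of S is a
  nonzero multiple of the constant function on the orbit, so f fixes that function.\<close>

lemma scott_imp_scott_mat:
  fixes S :: "('g \<Rightarrow> 'k::field) set"
  assumes H: "subgroup H G" and S: "scott G H (H \<inter> P) S"
  obtains f where "scott_mat H f" "coset_fun H ` S = range (mat_app f)" "prim_idem H f"
proof -
  interpret H: subgroup H G by fact
  let ?Y = "lcosets_in G H P"
  have YX: "?Y \<subseteq> cosets" by (rule lcosets_subset[OF H.subset])
  obtain S' where S1: "submodule G H S" "S \<subseteq> ind_triv G H (H \<inter> P)"
    and S': "submodule G H S'" "ssum S S' = ind_triv G H (H \<inter> P)" "S \<inter> S' = {\<lambda>x. 0}"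
    and ind: "indec_quot G H S {\<lambda>x. 0}"
    using S unfolding scott_def by blast
  obtain m where m: "m \<in> S" "m \<noteq> (\<lambda>x. 0)" "\<And>g. g \<in> H \<Longrightarrow> gact G g m = m"
    using S unfolding scott_def by blast
  have S'sub: "S' \<subseteq> ind_triv G H (H \<inter> P)"
  proof
    fix v assume "v \<in> S'"
    moreover have "0 \<in> S" using S1(1) lin_subspace_zero unfolding submodule_def by blast
    ultimately have "0 + v \<in> ssum S S'" unfolding ssum_eq by blast
    then show "v \<in> ind_triv G H (H \<inter> P)" using S'(2) by simp
  qed
  let ?b = "id_on ?Y :: 'g set \<Rightarrow> 'g set \<Rightarrow> 'k"
  have b: "?b \<in> inv_mats H" by (rule id_on_inv_mats[OF H])
  have bb: "?b \<star> ?b = ?b"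
    by (rule mat_eqI[OF mult_inv_mats[OF b b H.subset] b]) (simp add: app_mult id_on_app[OF YX] fun_eq_iff)
  have range_b: "range (mat_app ?b) = {F. \<forall>C. C \<notin> ?Y \<longrightarrow> F C = 0}"
  proof
    show "range (mat_app ?b) \<subseteq> {F. \<forall>C. C \<notin> ?Y \<longrightarrow> F C = 0}" by (auto simp: id_on_app[OF YX])
    show "{F. \<forall>C. C \<notin> ?Y \<longrightarrow> F C = 0} \<subseteq> range (mat_app ?b)"
    proof
      fix F :: "'g set \<Rightarrow> 'k" assume "F \<in> {F. \<forall>C. C \<notin> ?Y \<longrightarrow> F C = 0}"
      then have "F = mat_app ?b F" by (auto simp: id_on_app[OF YX] fun_eq_iff)
      then show "F \<in> range (mat_app ?b)" using rangeI[of "mat_app ?b" F] by simp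
    qed
  qed
  have sum: "ssum (coset_fun H ` S) (coset_fun H ` S') = range (mat_app ?b)"
  proof
    show "ssum (coset_fun H ` S) (coset_fun H ` S') \<subseteq> range (mat_app ?b)"
      unfolding range_b ssum_eq by (auto simp: coset_fun_supp)
    show "range (mat_app ?b) \<subseteq> ssum (coset_fun H ` S) (coset_fun H ` S')"
    proof
      fix F assume "F \<in> range (mat_app ?b)"
      then have "F = coset_fun H (fun_of H F)" using coset_fun_fun_of[OF H, of F] unfolding range_b by simp
      moreover obtain v w where "v \<in> S" "w \<in> S'" "fun_of H F = v + w"
        using fun_of_ind_triv[OF H, of F] unfolding S'(2)[symmetric] ssum_eq by blast
      ultimately have "F = coset_fun H v + coset_fun H w" "v \<in> S" "w \<in> S'" using coset_fun_linear(1)[of H v w] by simp_all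
      then show "F \<in> ssum (coset_fun H ` S) (coset_fun H ` S')" unfolding ssum_eq by blast
    qed
  qed
  have int: "coset_fun H ` S \<inter> coset_fun H ` S' = {0}"
  proof
    show "{0} \<subseteq> coset_fun H ` S \<inter> coset_fun H ` S'"
      using lin_subspace_zero[OF coset_fun_submodule(1)[OF H S1]]
        lin_subspace_zero[OF coset_fun_submodule(1)[OF H S'(1) S'sub]] by blast
    show "coset_fun H ` S \<inter> coset_fun H ` S' \<subseteq> {0}"
    proof
      fix F assume "F \<in> coset_fun H ` S \<inter> coset_fun H ` S'"
      then obtain v w where vw: "v \<in> S" "w \<in> S'" "F = coset_fun H v" "F = coset_fun H w" by blast
      have "v = fun_of H F" using fun_of_coset_fun[OF H subsetD[OF S1(2) vw(1)]] vw(3) by simp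
      moreover have "w = fun_of H F" using fun_of_coset_fun[OF H subsetD[OF S'sub vw(2)]] vw(4) by simp
      ultimately have "v \<in> S \<inter> S'" using vw by simp
      then have "v = 0" using S'(3) by (simp add: zero_fun_def)
      then show "F \<in> {0}" using vw(3) by (simp add: coset_fun_linear)
    qed
  qed
  obtain f where f: "f \<in> inv_mats H" "f \<star> f = f" "?b \<star> f = f" "f \<star> ?b = f" "range (mat_app f) = coset_fun H ` S"
    using idem_of_decomposition[OF b bb H.subset coset_fun_submodule[OF H S1] coset_fun_submodule[OF H S'(1) S'sub] sum int]
    by blast
  define F where "F = coset_fun H m"
  have mI: "m \<in> ind_triv G H (H \<inter> P)" using m(1) S1(2) by blast
  have Ffix: "transl h F = F" if "h \<in> H" for h using coset_fun_gact[OF H that mI] m(3)[OF that] by (simp add: F_def)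
  have Fsupp: "F C = 0" if "C \<notin> ?Y" for C using that by (simp add: F_def coset_fun_supp)
  have F1: "F = (\<lambda>C. F P * (if C \<in> ?Y then 1 else 0))" by (rule H_fixed_constant[OF H Fsupp Ffix])
  have FP: "F P \<noteq> 0"
  proof
    assume "F P = 0"
    then have "F = 0" using F1 by (auto simp: fun_eq_iff)
    then have "m = 0" using fun_of_coset_fun[OF H mI] by (simp add: F_def fun_of_linear)
    then show False using m(2) by (simp add: zero_fun_def)
  qed
  have "F \<in> range (mat_app f)" using m(1) f(5) by (simp add: F_def)
  then obtain F' where "F = mat_app f F'" by blast
  then have fF: "mat_app f F = F" using f(2) by (simp flip: app_mult)
  have "(\<lambda>C. F P * mat_app f (\<lambda>C. if C \<in> ?Y then 1 else 0) C) = F"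
    using fF app_scale[of f "F P" "\<lambda>C. if C \<in> ?Y then 1 else 0"] F1 by simp
  then have "F P * mat_app f (\<lambda>C. if C \<in> ?Y then 1 else 0) C = F P * (if C \<in> ?Y then 1 else 0)" for C
    using F1 by metis
  then have fY: "mat_app f (\<lambda>C. if C \<in> ?Y then 1 else 0) = (\<lambda>C. if C \<in> ?Y then 1 else 0)"
    using FP by (intro ext) simp
  have f_supp: "x \<in> ?Y \<and> y \<in> ?Y" if "f x y \<noteq> 0" for x y by (rule supp_of_id_on[OF YX f(3,4) that])
  have "mat_app f (\<lambda>_. 1) = mat_app f (\<lambda>C. if C \<in> ?Y then 1 else 0)"
    by (rule mat_app_cong_supp[of f ?Y]) (use f_supp in auto)
  then have "scott_mat H f" using f f_supp fY unfolding scott_mat_def by simp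
  moreover have "prim_idem H f"
    using indec_quot_iff_prim_scott[OF H order_refl f(1,2) S1 f(5)[symmetric]] ind by blast
  ultimately show thesis using that f(5) by simp
qed

lemma range_subspace: "lin_subspace (range (mat_app a))"
proof (rule lin_subspaceI)
  have "0 = mat_app a 0" by (simp add: app_zero)
  then show "0 \<in> range (mat_app a)" by blast
next
  fix g h assume "g \<in> range (mat_app a)" "h \<in> range (mat_app a)"
  then obtain F F' where "g = mat_app a F" "h = mat_app a F'" by blast
  then have "g + h = mat_app a (F + F')" by (simp only: app_add)
  then show "g + h \<in> range (mat_app a)" by blast
next
  fix c g assume "g \<in> range (mat_app a)"
  then obtain F where "g = mat_app a F" by blast
  then have "(\<lambda>x. c * g x) = mat_app a (\<lambda>x. c * F x)" by (simp only: app_scale)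
  then show "(\<lambda>x. c * g x) \<in> range (mat_app a)" by blast
qed

lemma fun_of_range_submodule:
  assumes H: "subgroup H G" and a: "a \<in> inv_mats H"
  shows "submodule G H (fun_of H ` range (mat_app a))" (is "submodule G H ?S")
  unfolding submodule_def
proof (intro conjI lin_subspaceI ballI)
  have "0 = fun_of H (mat_app a 0)" by (simp add: app_zero fun_of_linear)
  then show "0 \<in> ?S" by blast
next
  fix g h assume "g \<in> ?S" "h \<in> ?S"
  then obtain F F' where "g = fun_of H (mat_app a F)" "h = fun_of H (mat_app a F')" by blast
  then have "g + h = fun_of H (mat_app a (F + F'))" by (simp only: app_add fun_of_linear)
  then show "g + h \<in> ?S" by blast
next
  fix c g assume "g \<in> ?S"
  then obtain F where "g = fun_of H (mat_app a F)" by blast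
  then have "(\<lambda>x. c * g x) = fun_of H (mat_app a (\<lambda>x. c * F x))" by (simp only: app_scale fun_of_linear)
  then show "(\<lambda>x. c * g x) \<in> ?S" by blast
next
  fix h g assume h: "h \<in> H" and "g \<in> ?S"
  then obtain F where "g = fun_of H (mat_app a F)" by blast
  then have "gact G h g = fun_of H (mat_app a (transl h F))"
    by (simp only: gact_fun_of[OF H h] app_transl[OF a h subgroup.mem_carrier[OF H h]])
  then show "gact G h g \<in> ?S" by blast
qed

text \<open>The complement is the image of \<open>id_on\<close> of the orbit minus f, and the
  constant function on the orbit is the required fixed vector.\<close>

lemma scott_of_scott_mat:
  fixes f :: "'g set \<Rightarrow> 'g set \<Rightarrow> 'k::field"
  assumes H: "subgroup H G" and f: "scott_mat H f" and prim: "prim_idem H f"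
  shows "scott G H (H \<inter> P) (fun_of H ` range (mat_app f))"
    and "coset_fun H ` fun_of H ` range (mat_app f) = range (mat_app f)"
proof -
  interpret H: subgroup H G by fact
  let ?Y = "lcosets_in G H P"
  have f': "f \<in> inv_mats H" "f \<star> f = f" "\<And>x y. f x y \<noteq> 0 \<Longrightarrow> x \<in> ?Y \<and> y \<in> ?Y"
    "mat_app f (\<lambda>_. 1) = (\<lambda>x. if x \<in> ?Y then 1 else 0)" using f unfolding scott_mat_def by blast+
  have supp: "mat_app f F C = 0" if "C \<notin> ?Y" for F C
    by (rule mat_app_supp_row[of f ?Y]) (use f'(3) that in auto)
  let ?S = "fun_of H ` range (mat_app f)"
  show cf: "coset_fun H ` ?S = range (mat_app f)"
  proof -
    have "coset_fun H (fun_of H (mat_app f F)) = mat_app f F" for F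
      by (rule coset_fun_fun_of[OF H supp])
    then show ?thesis by (simp add: image_image)
  qed
  have YX: "?Y \<subseteq> cosets" by (rule lcosets_subset[OF H.subset])
  let ?b = "id_on ?Y :: 'g set \<Rightarrow> 'g set \<Rightarrow> 'k"
  let ?S' = "fun_of H ` range (mat_app (?b - f))"
  have fapp: "mat_app f (mat_app f F) = mat_app f F" for F using f'(2) by (simp flip: app_mult)
  have fb: "mat_app f (mat_app ?b F) = mat_app f F" for F
    by (rule mat_app_cong_supp[of f ?Y]) (use f'(3) in \<open>auto simp: id_on_app[OF YX]\<close>)
  have S: "submodule G H ?S" by (rule fun_of_range_submodule[OF H f'(1)])
  have S': "submodule G H ?S'"
    by (rule fun_of_range_submodule[OF H diff_inv_mats[OF id_on_inv_mats[OF H] f'(1)]])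
  show "scott G H (H \<inter> P) ?S"
    unfolding scott_def
  proof (intro conjI)
    show "submodule G H ?S" by (rule S)
    show sub: "?S \<subseteq> ind_triv G H (H \<inter> P)" using fun_of_ind_triv[OF H] by blast
    show "indec_quot G H ?S {\<lambda>x. 0}"
      using indec_quot_iff_prim_scott[OF H order_refl f'(1,2) S sub cf] prim by blast
    show "\<exists>M'. submodule G H M' \<and> ssum ?S M' = ind_triv G H (H \<inter> P) \<and> ?S \<inter> M' = {\<lambda>x. 0}"
    proof (intro exI[of _ ?S'] conjI S')
      show "ssum ?S ?S' = ind_triv G H (H \<inter> P)"
      proof
        show "ssum ?S ?S' \<subseteq> ind_triv G H (H \<inter> P)"
          unfolding ssum_eq using fun_of_ind_triv[OF H] lin_subspace_add[OF ind_triv_subspace] by blast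
        show "ind_triv G H (H \<inter> P) \<subseteq> ssum ?S ?S'"
        proof
          fix v :: "'g \<Rightarrow> 'k" assume v: "v \<in> ind_triv G H (H \<inter> P)"
          define F where "F = coset_fun H v"
          have "v = fun_of H F" using fun_of_coset_fun[OF H v] by (simp add: F_def)
          also have "F = mat_app f F + mat_app (?b - f) F"
            by (auto simp: app_diff_mat id_on_app[OF YX] F_def coset_fun_supp)
          finally have "v = fun_of H (mat_app f F) + fun_of H (mat_app (?b - f) F)" by (simp only: fun_of_linear)
          then show "v \<in> ssum ?S ?S'" unfolding ssum_eq by blast
        qed
      qed
      show "?S \<inter> ?S' = {\<lambda>x. 0}"
      proof
        have "0 \<in> ?S \<inter> ?S'" using S S' lin_subspace_zero unfolding submodule_def by blast
        then show "{\<lambda>x. 0} \<subseteq> ?S \<inter> ?S'" by (simp add: zero_fun_def)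
        show "?S \<inter> ?S' \<subseteq> {\<lambda>x. 0}"
        proof
          fix v assume "v \<in> ?S \<inter> ?S'"
          then obtain F F' where F: "v = fun_of H (mat_app f F)" "v = fun_of H (mat_app (?b - f) F')" by blast
          have "coset_fun H v = mat_app f F" unfolding F(1) by (rule coset_fun_fun_of[OF H supp])
          moreover have "coset_fun H v = mat_app (?b - f) F'"
            unfolding F(2) by (rule coset_fun_fun_of[OF H]) (simp add: app_diff_mat id_on_app[OF YX] supp)
          ultimately have "mat_app f F = mat_app f (mat_app (?b - f) F')" using fapp by metis
          also have "\<dots> = 0" by (simp add: app_diff_mat app_diff fapp fb)
          finally have "v = 0" using F(1) by (simp add: fun_of_linear)
          then show "v \<in> {\<lambda>x. 0}" by (simp add: zero_fun_def)
        qed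
      qed
    qed
    show "\<exists>m\<in>?S. m \<noteq> (\<lambda>x. 0) \<and> (\<forall>g\<in>H. gact G g m = m)"
    proof (intro bexI conjI ballI)
      let ?m = "fun_of H (mat_app f (\<lambda>_. 1))"
      show "?m \<in> ?S" by blast
      have "P = \<one> <# P" using lcos_mult_one[OF P_closed] by simp
      then have "P \<in> ?Y" using H.one_closed unfolding lcosets_in_def by blast
      then have "?m \<one> = 1" using lcos_mult_one[OF P_closed] by (simp add: fun_of_def f'(4))
      then show "?m \<noteq> (\<lambda>x. 0)" by (metis zero_neq_one)
      fix g assume g: "g \<in> H"
      have "transl g (mat_app f (\<lambda>_. 1)) = mat_app f (transl g (\<lambda>_. 1))"
        using app_transl[OF f'(1) g H.mem_carrier[OF g]] by simp
      also have "\<dots> = mat_app f (\<lambda>_. 1)" by (rule app_cong) (simp add: transl_def)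
      finally show "gact G g ?m = ?m" by (simp only: gact_fun_of[OF H g])
    qed
  qed
qed

text \<open>A Scott idempotent of minimal rank among those fixing the constant function is primitive,
  because the invariant functions on a single orbit form a line.\<close>

lemma scott_mat_exists:
  assumes H: "subgroup H G"
  obtains f :: "'g set \<Rightarrow> 'g set \<Rightarrow> 'k::field" where "scott_mat H f" "prim_idem H f"
proof -
  interpret H: subgroup H G by fact
  let ?Y = "lcosets_in G H P" and ?one = "\<lambda>_. 1 :: 'k" and ?ind = "\<lambda>x. if x \<in> lcosets_in G H P then 1 else 0 :: 'k"
  have YX: "?Y \<subseteq> cosets" by (rule lcosets_subset[OF H.subset])
  obtain d :: "('g set \<Rightarrow> 'k) set \<Rightarrow> nat" where
    d: "\<And>V W. lin_subspace V \<Longrightarrow> lin_subspace W \<Longrightarrow> V \<subset> W \<Longrightarrow>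
      (\<forall>f\<in>W. \<forall>x. x \<notin> cosets \<longrightarrow> f x = 0) \<Longrightarrow> d V < d W"
    using subspace_rank_exists[OF finite_points, where ?'k = 'k] by meson
  let ?b = "id_on ?Y :: 'g set \<Rightarrow> 'g set \<Rightarrow> 'k"
  have b: "?b \<in> inv_mats H" by (rule id_on_inv_mats[OF H])
  have "?b \<star> ?b = ?b"
    by (rule mat_eqI[OF mult_inv_mats[OF b b H.subset] b]) (simp add: app_mult id_on_app[OF YX] fun_eq_iff)
  then have "scott_mat H ?b" unfolding scott_mat_def using b by (simp add: id_on_app[OF YX]) (simp add: id_on_def)
  then obtain f where f: "scott_mat H f" and
    min: "\<And>a. scott_mat H a \<Longrightarrow> d (range (mat_app f)) \<le> d (range (mat_app a))"
    using ex_has_least_nat[of "scott_mat H" ?b "\<lambda>a. d (range (mat_app a))"] by blast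
  have f': "f \<in> inv_mats H" "f \<star> f = f" "\<And>x y. f x y \<noteq> 0 \<Longrightarrow> x \<in> ?Y \<and> y \<in> ?Y"
    "mat_app f ?one = ?ind" using f unfolding scott_mat_def by blast+
  \<comment> \<open>The image of such an a lies inside that of f; least rank makes the two images
    equal, and with \<open>a \<star> f = a\<close> the matrices agree.\<close>
  have eq: "a = f" if a: "scott_mat H a" "f \<star> a = a" "a \<star> f = a" for a
  proof -
    have aI: "a \<in> inv_mats H" "a \<star> a = a" using a(1) unfolding scott_mat_def by blast+
    have "range (mat_app a) \<subseteq> range (mat_app f)"
    proof
      fix F assume "F \<in> range (mat_app a)"
      then obtain F' where "F = mat_app a F'" by blast
      then have "F = mat_app f (mat_app a F')" using a(2) by (simp flip: app_mult)
      then show "F \<in> range (mat_app f)" by blast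
    qed
    moreover have "\<forall>g\<in>range (mat_app f). \<forall>x. x \<notin> cosets \<longrightarrow> g x = 0" using app_supp[OF f'(1)] by blast
    ultimately have r: "range (mat_app a) = range (mat_app f)"
      using d[OF range_subspace range_subspace, of a f] min[OF a(1)] by (meson not_le psubsetI)
    show ?thesis
    proof (rule mat_eqI[OF aI(1) f'(1)])
      fix F
      obtain F' where F': "mat_app f F = mat_app a F'" using r by (metis imageE rangeI)
      have "mat_app a F = mat_app a (mat_app f F)" using a(3) by (simp flip: app_mult)
      also have "\<dots> = mat_app f F" using aI(2) F' by (simp flip: app_mult)
      finally show "mat_app a F = mat_app f F" .
    qed
  qed
  have "prim_idem H f"
    unfolding prim_idem_def
  proof (intro conjI ballI impI f'(1,2))
    have "P = \<one> <# P" using lcos_mult_one[OF P_closed] by simp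
    then have PY: "P \<in> ?Y" using H.one_closed unfolding lcosets_in_def by blast
    show "f \<noteq> 0"
    proof
      assume "f = 0"
      then have "?ind P = 0" using f'(4) app_zero_mat[of ?one] by (metis zero_fun_apply)
      then show False using PY by simp
    qed
    fix a assume a: "a \<in> inv_mats H" "a \<star> a = a" "f \<star> a = a" "a \<star> f = a"
    have supp: "x \<in> ?Y \<and> y \<in> ?Y" if nz: "a x y \<noteq> 0" for x y
    proof -
      have "(f \<star> a) x y = 0" if "x \<notin> ?Y"
      proof -
        have "f x z = 0" for z using that f'(3) by blast
        then show ?thesis by (simp add: mat_mult_def)
      qed
      moreover have "(a \<star> f) x y = 0" if "y \<notin> ?Y"
      proof -
        have "f z y = 0" for z using that f'(3) by blast
        then show ?thesis by (simp add: mat_mult_def)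
      qed
      ultimately show ?thesis using nz a(3,4) by metis
    qed
    \<comment> \<open>The image of the constant function under a is an invariant function on one
      orbit, hence c times the constant function there; idempotency gives
      \<open>c = c * c\<close>.\<close>
    define F where "F = mat_app a ?one"
    have "transl h F = F" if h: "h \<in> H" for h
    proof -
      have "transl h F = mat_app a (transl h ?one)" using app_transl[OF a(1) h H.mem_carrier[OF h]] by (simp add: F_def)
      also have "\<dots> = F" unfolding F_def by (rule app_cong) (simp add: transl_def)
      finally show ?thesis .
    qed
    moreover have "F C = 0" if "C \<notin> ?Y" for C
      unfolding F_def by (rule mat_app_supp_row[of a ?Y]) (use supp that in auto)
    ultimately have "F = (\<lambda>C. F P * ?ind C)" by (intro H_fixed_constant[OF H]) auto
    then obtain c where F: "F = (\<lambda>C. c * ?ind C)" by blast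
    have a_ind: "mat_app a ?ind = F"
      unfolding F_def by (rule mat_app_cong_supp[of a ?Y]) (use supp in auto)
    have aF: "mat_app a F = F" using a(2) by (simp add: F_def flip: app_mult)
    have "mat_app a F = mat_app a (\<lambda>C. c * ?ind C)" using F by (rule arg_cong)
    also have "\<dots> = (\<lambda>C. c * F C)" unfolding a_ind[symmetric] by (rule app_scale)
    finally have "mat_app a F = (\<lambda>C. c * F C)" .
    then have "F P = c * F P" using fun_cong[OF aF, of P] by simp
    then have "c = c * c" using PY fun_cong[OF F, of P] by simp
    then have "c = 0 \<or> c = 1" by simp
    then show "a = 0 \<or> a = f"
    proof
      assume "c = 1"
      then have "mat_app a ?one = ?ind" using F unfolding F_def by simp
      then have "scott_mat H a" unfolding scott_mat_def using a supp by blast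
      then show ?thesis using eq a by blast
    next
      \<comment> \<open>Now the complementary idempotent fixes the constant function, so by
        minimality it is f.\<close>
      assume "c = 0"
      then have "mat_app a ?one = 0" using F unfolding F_def by (simp add: fun_eq_iff)
      then have "mat_app (f - a) ?one = ?ind" using f'(4) by (simp add: app_diff_mat)
      moreover have "(f - a) \<star> (f - a) = f - a" "f \<star> (f - a) = f - a" "(f - a) \<star> f = f - a"
        using a f'(2) by (simp_all add: mult_diff_left mult_diff_right)
      moreover have "x \<in> ?Y \<and> y \<in> ?Y" if "(f - a) x y \<noteq> 0" for x y
      proof -
        have "f x y \<noteq> 0 \<or> a x y \<noteq> 0" using that by auto
        then show ?thesis using supp f'(3) by blast
      qed
      ultimately have "f - a = f" using eq[of "f - a"] diff_inv_mats[OF f'(1) a(1)] unfolding scott_mat_def by blast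
      then show ?thesis by simp
    qed
  qed
  then show thesis using that f by blast
qed

end

section \<open>The Brauer construction of a summand of a permutation module\<close>

context coset_space
begin

lemma gact_gact:
  assumes "g \<in> carrier G" "h \<in> carrier G"
  shows "gact G g (gact G h f) = gact G (g \<otimes> h) f"
  using assms by (auto simp: gact_def fun_eq_iff inv_mult_group m_assoc)

lemma carrier_inter_P: "carrier G \<inter> P = P"
  using P_closed by blast

abbreviation \<rho> :: "('g \<Rightarrow> 'k::field) \<Rightarrow> 'g set \<Rightarrow> 'k" where
  "\<rho> \<equiv> coset_fun (carrier G)"

abbreviation \<tau> :: "('g set \<Rightarrow> 'k::field) \<Rightarrow> 'g \<Rightarrow> 'k" where
  "\<tau> \<equiv> fun_of (carrier G)"

text \<open>The trace on functions on cosets, with the same representatives as in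
  \<open>trace\<close>, so that the two correspond term by term.\<close>

definition coset_trace :: "'g set \<Rightarrow> 'g set \<Rightarrow> ('g set \<Rightarrow> 'k::field) \<Rightarrow> 'g set \<Rightarrow> 'k" where
  "coset_trace Q R F = (\<lambda>x. \<Sum>C\<in>lcosets_in G Q R. transl (SOME q. q \<in> C) F x)"

lemma trace_fun_of:
  assumes Q: "subgroup Q G" and R: "subgroup R G" "R \<subseteq> Q"
  shows "trace G Q R (\<tau> F) = \<tau> (coset_trace Q R F)"
proof
  fix y
  have rep: "(SOME q. q \<in> C) \<in> carrier G" if C: "C \<in> lcosets_in G Q R" for C
  proof -
    obtain x where x: "x \<in> Q" "C = x <# R" using C unfolding lcosets_in_def by blast
    have xG: "x \<in> carrier G" using subgroup.mem_carrier[OF Q x(1)] .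
    then have "x = x \<otimes> \<one>" by simp
    then have "x \<in> C" using subgroup.one_closed[OF R(1)] unfolding x(2) l_coset_def by blast
    then have "(SOME q. q \<in> C) \<in> C" by (rule someI)
    then show ?thesis using x(2) l_coset_subset_G[OF subgroup.subset[OF R(1)] xG] by blast
  qed
  have "trace G Q R (\<tau> F) y = (\<Sum>C\<in>lcosets_in G Q R. \<tau> (transl (SOME q. q \<in> C) F) y)"
    unfolding trace_def by (rule sum.cong[OF refl]) (simp only: gact_fun_of[OF subgroup_self rep])
  also have "\<dots> = \<tau> (coset_trace Q R F) y" by (simp add: fun_of_def coset_trace_def)
  finally show "trace G Q R (\<tau> F) y = \<tau> (coset_trace Q R F) y" .
qed

lemma coset_rep:
  assumes Q: "subgroup Q G" and R: "subgroup R G" "R \<subseteq> Q" and C: "C \<in> lcosets_in G Q R"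
  shows "(SOME q. q \<in> C) \<in> Q" "C = (SOME q. q \<in> C) <# R"
proof -
  interpret Q: subgroup Q G by fact
  interpret R: subgroup R G by fact
  obtain x where x: "x \<in> Q" "C = x <# R" using C unfolding lcosets_in_def by blast
  have "x = x \<otimes> \<one>" using x(1) by simp
  then have "x \<in> C" using R.one_closed unfolding x(2) l_coset_def by blast
  then have s: "(SOME q. q \<in> C) \<in> C" by (rule someI)
  then obtain r where r: "r \<in> R" "(SOME q. q \<in> C) = x \<otimes> r" unfolding x(2) l_coset_def by blast
  then show q: "(SOME q. q \<in> C) \<in> Q" using x(1) R(2) by auto
  have "inv x \<otimes> (x \<otimes> r) = r" using x(1) r(1) by (simp add: m_assoc[symmetric])
  then have "(x \<otimes> r) <# R = x <# R"
    using lcoset_eq_iff[OF R(1), of "x \<otimes> r" x] x(1) r(1) by simp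
  then show "C = (SOME q. q \<in> C) <# R" using r(2) x(2) by simp
qed

lemma transl_mult:
  assumes "g \<in> carrier G" "h \<in> carrier G"
  shows "transl g (transl h F) = transl (g \<otimes> h) F"
proof
  fix x
  show "transl g (transl h F) x = transl (g \<otimes> h) F x"
    using assms act_mult[of "inv h" "inv g" x] act_closed[of "inv g" x]
    by (simp add: transl_def inv_mult_group)
qed

text \<open>Left multiplication by q permutes Q/R, and because F is fixed by R the summand of a
  coset does not depend on its representative.\<close>

lemma transl_coset_trace:
  assumes Q: "subgroup Q G" and R: "subgroup R G" "R \<subseteq> Q" and F: "\<And>r. r \<in> R \<Longrightarrow> transl r F = F"
    and q: "q \<in> Q"
  shows "transl q (coset_trace Q R F) = coset_trace Q R F"
proof
  interpret Q: subgroup Q G by fact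
  interpret R: subgroup R G by fact
  let ?Z = "lcosets_in G Q R" and ?rep = "\<lambda>C. SOME q. q \<in> C"
  have qG: "q \<in> carrier G" using q by simp
  have wd: "transl g F = transl h F" if "g \<in> Q" "h \<in> Q" "g <# R = h <# R" for g h
  proof -
    have "inv h \<otimes> g \<in> R" using that lcoset_eq_iff[OF R(1), of g h] by simp
    then have "transl h (transl (inv h \<otimes> g) F) = transl h F" using F by simp
    moreover have "transl h (transl (inv h \<otimes> g) F) = transl g F"
      using transl_mult[of h "inv h \<otimes> g" F] that by (simp add: m_assoc[symmetric])
    ultimately show ?thesis by simp
  qed
  have closed: "k <# C \<in> ?Z" if kC: "k \<in> Q" "C \<in> ?Z" for k C
  proof -
    obtain x where x: "x \<in> Q" "C = x <# R" using kC(2) unfolding lcosets_in_def by blast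
    then have "k <# C = (k \<otimes> x) <# R" using kC(1) lcos_m_assoc[OF R.subset] by simp
    then show ?thesis using x kC(1) unfolding lcosets_in_def by blast
  qed
  have canc: "inv k <# (k <# C) = C" if kC: "k \<in> Q" "C \<in> ?Z" for k C
  proof -
    obtain x where x: "x \<in> Q" "C = x <# R" using kC(2) unfolding lcosets_in_def by blast
    then show ?thesis using kC(1) by (simp add: lcos_m_assoc[OF R.subset] m_assoc[symmetric])
  qed
  have canc': "k <# (inv k <# C) = C" if kC: "k \<in> Q" "C \<in> ?Z" for k C
    using canc[OF Q.m_inv_closed[OF kC(1)] kC(2)] kC(1) by simp
  have bij: "bij_betw (l_coset G q) ?Z ?Z"
    by (rule bij_betw_byWitness[where f' = "l_coset G (inv q)"])
      (use closed canc canc' q Q.m_inv_closed[OF q] in auto)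
  fix x
  show "transl q (coset_trace Q R F) x = coset_trace Q R F x"
  proof (cases "x \<in> cosets")
    case True
    have "transl q (coset_trace Q R F) x = (\<Sum>C\<in>?Z. transl q (transl (?rep C) F) x)"
      using True by (simp add: coset_trace_def transl_def)
    also have "\<dots> = (\<Sum>C\<in>?Z. transl (?rep (q <# C)) F x)"
    proof (rule sum.cong[OF refl])
      fix C assume C: "C \<in> ?Z"
      have rC: "?rep C \<in> Q" "C = ?rep C <# R" using coset_rep[OF Q R C] by auto
      have rqC: "?rep (q <# C) \<in> Q" "q <# C = ?rep (q <# C) <# R" using coset_rep[OF Q R closed[OF q C]] by auto
      have "(q \<otimes> ?rep C) <# R = q <# (?rep C <# R)" using lcos_m_assoc[OF R.subset qG] rC(1) by simp
      then have "(q \<otimes> ?rep C) <# R = ?rep (q <# C) <# R" using rC(2) rqC(2) by simp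
      then have "transl (q \<otimes> ?rep C) F = transl (?rep (q <# C)) F" using wd q rC(1) rqC(1) by blast
      then show "transl q (transl (?rep C) F) x = transl (?rep (q <# C)) F x"
        using transl_mult[OF qG, of "?rep C" F] rC(1) by simp
    qed
    also have "\<dots> = coset_trace Q R F x"
      unfolding coset_trace_def by (rule sum.reindex_bij_betw[OF bij])
    finally show ?thesis .
  next
    case False
    then show ?thesis by (simp add: transl_def coset_trace_def)
  qed
qed

lemma mat_app_coset_trace:
  assumes Q: "subgroup Q G" and R: "subgroup R G" "R \<subseteq> Q" and e: "e \<in> inv_mats (carrier G)"
  shows "mat_app e (coset_trace Q R F) = coset_trace Q R (mat_app e F)"
proof
  fix x
  let ?Z = "lcosets_in G Q R" and ?rep = "\<lambda>C. SOME q. q \<in> C"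
  have "mat_app e (coset_trace Q R F) x = (\<Sum>y\<in>cosets. \<Sum>C\<in>?Z. e x y * transl (?rep C) F y)"
    by (simp add: mat_app_def coset_trace_def sum_distrib_left)
  also have "\<dots> = (\<Sum>C\<in>?Z. \<Sum>y\<in>cosets. e x y * transl (?rep C) F y)" by (rule sum.swap)
  also have "\<dots> = (\<Sum>C\<in>?Z. mat_app e (transl (?rep C) F) x)" by (simp add: mat_app_def)
  also have "\<dots> = coset_trace Q R (mat_app e F) x"
    unfolding coset_trace_def
  proof (rule sum.cong[OF refl])
    fix C assume "C \<in> ?Z"
    then have "?rep C \<in> carrier G" using coset_rep(1)[OF Q R] subgroup.mem_carrier[OF Q] by blast
    then show "mat_app e (transl (?rep C) F) x = transl (?rep C) (mat_app e F) x"
      using app_transl[OF e] by simp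
  qed
  finally show "mat_app e (coset_trace Q R F) x = coset_trace Q R (mat_app e F) x" .
qed

text \<open>When R is the stabilizer of x, the cosets Q/R biject with the orbit of x. Orbit sums are
  thus traces, from a proper subgroup whenever x is not fixed by Q.\<close>

lemma coset_trace_delta:
  fixes c :: "'k::field"
  assumes Q: "subgroup Q G" and x: "x \<in> cosets" and R: "R = {q \<in> Q. q <# x = x}" and sR: "subgroup R G"
  shows "coset_trace Q R (\<lambda>z. if z = x then c else 0) = (\<lambda>y. if y \<in> (\<lambda>q. q <# x) ` Q then c else 0)"
proof
  interpret Q: subgroup Q G by fact
  have RQ: "R \<subseteq> Q" using R by blast
  let ?Z = "lcosets_in G Q R" and ?rep = "\<lambda>C. SOME q. q \<in> C"
  have finZ: "finite ?Z"
  proof -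
    have "?Z = (\<lambda>q. q <# R) ` Q" unfolding lcosets_in_def by blast
    moreover have "finite Q" using fin_carrier Q.subset finite_subset by blast
    ultimately show ?thesis by simp
  qed
  fix y
  have eq: "g <# x = h <# x \<longleftrightarrow> g <# R = h <# R" if gh: "g \<in> Q" "h \<in> Q" for g h
  proof -
    have "g <# x = h <# x \<longleftrightarrow> inv h <# (g <# x) = x"
      using act_inv_act[of h x] act_act_inv[of h "g <# x"] act_closed[of g x] gh x by (metis Q.mem_carrier)
    also have "\<dots> \<longleftrightarrow> (inv h \<otimes> g) <# x = x" using act_mult[of "inv h" g x] gh x by simp
    also have "\<dots> \<longleftrightarrow> inv h \<otimes> g \<in> R" unfolding R using gh by auto
    also have "\<dots> \<longleftrightarrow> g <# R = h <# R" using lcoset_eq_iff[OF sR, of g h] gh by simp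
    finally show ?thesis .
  qed
  have "coset_trace Q R (\<lambda>z. if z = x then c else 0) y = (\<Sum>C\<in>?Z. if y = ?rep C <# x then c else 0)"
    unfolding coset_trace_def
  proof (rule sum.cong[OF refl])
    fix C assume "C \<in> ?Z"
    then have "?rep C \<in> carrier G" using coset_rep(1)[OF Q sR RQ] by simp
    then show "transl (?rep C) (\<lambda>z. if z = x then c else 0) y = (if y = ?rep C <# x then c else 0)"
      using transl_delta[of "?rep C" x c] x by simp
  qed
  also have "\<dots> = (if y \<in> (\<lambda>q. q <# x) ` Q then c else 0)"
  proof (cases "y \<in> (\<lambda>q. q <# x) ` Q")
    case True
    then obtain q where q: "q \<in> Q" "y = q <# x" by blast
    have qZ: "q <# R \<in> ?Z" using q(1) unfolding lcosets_in_def by blast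
    have "y = ?rep C <# x \<longleftrightarrow> C = q <# R" if C: "C \<in> ?Z" for C
      using eq[OF q(1) coset_rep(1)[OF Q sR RQ C]] coset_rep(2)[OF Q sR RQ C] q(2) by auto
    then have "(\<Sum>C\<in>?Z. if y = ?rep C <# x then c else 0) = (\<Sum>C\<in>?Z. if C = q <# R then c else 0)"
      by (intro sum.cong) auto
    then show ?thesis using True finZ qZ by simp
  next
    case False
    then have "y \<noteq> ?rep C <# x" if "C \<in> ?Z" for C using coset_rep(1)[OF Q sR RQ that] by blast
    then show ?thesis using False by simp
  qed
  finally show "coset_trace Q R (\<lambda>z. if z = x then c else 0) y = (if y \<in> (\<lambda>q. q <# x) ` Q then c else 0)" .
qed

section \<open>Kernel and image of restriction to the fixed points\<close>

lemma fixed_pts_iff: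
  assumes Q: "subgroup Q G" and M: "M \<subseteq> ind_triv G (carrier G) P" and m: "m \<in> M"
  shows "m \<in> fixed_pts G Q M \<longleftrightarrow> (\<forall>q\<in>Q. transl q (\<rho> m) = \<rho> m)"
proof -
  have mI: "m \<in> ind_triv G (carrier G) (carrier G \<inter> P)" using M m carrier_inter_P by auto
  have "gact G q m = m \<longleftrightarrow> transl q (\<rho> m) = \<rho> m" if "q \<in> Q" for q
  proof -
    have qG: "q \<in> carrier G" using that subgroup.mem_carrier[OF Q] by blast
    show ?thesis
    proof
      assume "gact G q m = m"
      then show "transl q (\<rho> m) = \<rho> m" using coset_fun_gact[OF subgroup_self qG mI] by simp
    next
      assume t: "transl q (\<rho> m) = \<rho> m"
      have "gact G q m = gact G q (\<tau> (\<rho> m))" by (simp only: fun_of_coset_fun[OF subgroup_self mI])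
      also have "\<dots> = \<tau> (\<rho> m)" by (simp only: gact_fun_of[OF subgroup_self qG] t)
      also have "\<dots> = m" by (rule fun_of_coset_fun[OF subgroup_self mI])
      finally show "gact G q m = m" .
    qed
  qed
  then show ?thesis using m by (auto simp: fixed_pts_def)
qed

context
  fixes p :: nat and M :: "('g \<Rightarrow> 'k::field) set" and e :: "'g set \<Rightarrow> 'g set \<Rightarrow> 'k" and Q :: "'g set"
  assumes p: "prime p" "CHAR('k) = p" and pQ: "p_subgroup p G Q"
    and e: "e \<in> inv_mats (carrier G)" "e \<star> e = e"
    and M: "submodule G (carrier G) M" "M \<subseteq> ind_triv G (carrier G) P" "\<rho> ` M = range (mat_app e)"
begin

lemma M_coset: "m \<in> M \<Longrightarrow> \<tau> (\<rho> m) = m"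
  using fun_of_coset_fun[OF subgroup_self] M(2) carrier_inter_P by auto

lemma M_app: "m \<in> M \<Longrightarrow> mat_app e (\<rho> m) = \<rho> m"
proof -
  assume "m \<in> M"
  then obtain F where "\<rho> m = mat_app e F" using M(3) by blast
  then show ?thesis using e(2) by (simp flip: app_mult)
qed

lemma app_in_M: "\<tau> (mat_app e F) \<in> M" "\<rho> (\<tau> (mat_app e F)) = mat_app e F"
proof -
  obtain m where m: "m \<in> M" "\<rho> m = mat_app e F" using M(3) by (metis imageE rangeI)
  then show "\<tau> (mat_app e F) \<in> M" using M_coset[OF m(1)] by simp
  show "\<rho> (\<tau> (mat_app e F)) = mat_app e F" using m M_coset[OF m(1)] by simp
qed

lemma subgroup_Q: "subgroup Q G" using pQ by (simp add: p_subgroup_def)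

text \<open>At a fixed point of Q, a trace from a proper subgroup is the original value times the
  index, a multiple of p. Conversely, an invariant function vanishing at the fixed points is a
  combination of orbit sums, each a trace from a proper stabilizer.\<close>

lemma brauer_den_eq:
  "brauer_den G Q M = {m \<in> fixed_pts G Q M. \<forall>C\<in>fix_points Q. \<rho> m C = 0}" (is "_ = ?K")
proof
  note sQ = subgroup_Q
  interpret Q: subgroup Q G by (rule subgroup_Q)
  have Ms: "lin_subspace M" using M(1) unfolding submodule_def by blast
  have "lin_subspace ?K"
  proof (rule lin_subspaceI)
    show "0 \<in> ?K" using lin_subspace_zero[OF Ms]
      by (auto simp: fixed_pts_def coset_fun_linear gact_def fun_eq_iff)
    show "f + h \<in> ?K" if "f \<in> ?K" "h \<in> ?K" for f h
    proof -
      have "gact G q (f + h) = gact G q f + gact G q h" for q by (auto simp: gact_def fun_eq_iff)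
      then show ?thesis using that lin_subspace_add[OF Ms, of f h] by (simp add: fixed_pts_def coset_fun_linear)
    qed
    show "(\<lambda>x. c * f x) \<in> ?K" if "f \<in> ?K" for c f
    proof -
      have "gact G q (\<lambda>x. c * f x) = (\<lambda>x. c * gact G q f x)" for q by (auto simp: gact_def fun_eq_iff)
      then show ?thesis using that lin_subspace_scale[OF Ms, of f c] by (simp add: fixed_pts_def coset_fun_linear)
    qed
  qed
  moreover have "trace G Q R m \<in> ?K" if R: "subgroup R G" "R \<subset> Q" and m: "m \<in> fixed_pts G R M" for R m
  proof -
    have RQ: "R \<subseteq> Q" using R(2) by blast
    have mM: "m \<in> M" using m by (simp add: fixed_pts_def)
    define F where "F = \<rho> m"
    have mF: "m = \<tau> F" using M_coset[OF mM] by (simp add: F_def)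
    have eF: "mat_app e F = F" using M_app[OF mM] by (simp add: F_def)
    have Ffix: "transl r F = F" if "r \<in> R" for r
      using fixed_pts_iff[OF R(1) M(2) mM] m that by (simp add: F_def)
    define T where "T = coset_trace Q R F"
    have tr: "trace G Q R m = \<tau> T" unfolding mF T_def by (rule trace_fun_of[OF sQ R(1) RQ])
    have eT: "mat_app e T = T" unfolding T_def mat_app_coset_trace[OF sQ R(1) RQ e(1)] eF ..
    have tM: "\<tau> T \<in> M" and rt: "\<rho> (\<tau> T) = T" using app_in_M[of T] eT by simp_all
    have "transl q T = T" if "q \<in> Q" for q
      unfolding T_def by (rule transl_coset_trace[OF sQ R(1) RQ Ffix that])
    then have "\<tau> T \<in> fixed_pts G Q M" using fixed_pts_iff[OF sQ M(2) tM] rt by simp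
    moreover have "T C = 0" if C: "C \<in> fix_points Q" for C
    proof -
      let ?Z = "lcosets_in G Q R"
      have CX: "C \<in> cosets" "\<And>q. q \<in> Q \<Longrightarrow> q <# C = C" using C by (auto simp: fix_points_def)
      have "T C = (\<Sum>D\<in>?Z. F C)"
        unfolding T_def coset_trace_def
      proof (rule sum.cong[OF refl])
        fix D assume "D \<in> ?Z"
        then have "inv (SOME q. q \<in> D) \<in> Q" using coset_rep(1)[OF sQ R(1) RQ] by simp
        then show "transl (SOME q. q \<in> D) F C = F C" using CX by (simp add: transl_def)
      qed
      also have "\<dots> = of_nat (card ?Z) * F C" by simp
      also have "of_nat (card ?Z) = (0::'k)"
      proof -
        have cQ: "card Q = card ?Z * card R" by (rule card_lcosets_in[OF fin_carrier sQ R(1) RQ])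
        obtain n where n: "card Q = p ^ n" using pQ by (auto simp: p_subgroup_def)
        have "finite Q" using pQ by (simp add: p_subgroup_def)
        then have "card R < card Q" using R(2) psubset_card_mono by blast
        then have "card ?Z \<noteq> 1" using cQ by auto
        moreover have "card ?Z dvd p ^ n" using cQ n by (metis dvd_triv_left)
        ultimately have "p dvd card ?Z" using p(1) by (metis divides_primepow_nat dvd_power gr0I power_0)
        then show ?thesis using p(2) of_nat_eq_0_iff_char_dvd by blast
      qed
      finally show ?thesis by simp
    qed
    ultimately show ?thesis unfolding tr using rt by simp
  qed
  ultimately show "brauer_den G Q M \<subseteq> ?K"
    unfolding brauer_den_def by (intro lin_span_least) blast+
  have D: "lin_subspace (brauer_den G Q M)" unfolding brauer_den_def by (rule lin_span_subspace)
  have gen: "trace G Q R m \<in> brauer_den G Q M" if "subgroup R G" "R \<subset> Q" "m \<in> fixed_pts G R M" for R m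
    unfolding brauer_den_def by (rule subsetD[OF lin_span_superset]) (use that in blast)
  \<comment> \<open>The orbit pieces of F need not come from M, so e is applied to each of them: it
    commutes with traces, and at the end it fixes \<open>\<rho> m\<close>. The induction removes one
    orbit at a time from the support of F.\<close>
  have key: "\<tau> (mat_app e F) \<in> brauer_den G Q M"
    if "\<And>q C. q \<in> Q \<Longrightarrow> C \<in> cosets \<Longrightarrow> F (q <# C) = F C" "\<And>C. C \<in> fix_points Q \<Longrightarrow> F C = 0"
      "\<And>C. C \<notin> cosets \<Longrightarrow> F C = 0" for F
    using that
  proof (induction "card {C. F C \<noteq> 0}" arbitrary: F rule: less_induct)
    case less
    show ?case
    proof (cases "F = 0")
      case True
      then show ?thesis using lin_subspace_zero[OF D] by (simp add: app_zero fun_of_linear)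
    next
      case False
      then obtain x where x: "F x \<noteq> 0" by (metis ext zero_fun_apply)
      have xX: "x \<in> cosets" "x \<notin> fix_points Q" using x less.prems(2,3) by blast+
      define R where "R = {q \<in> Q. q <# x = x}"
      have inv_fix: "inv g <# x = x" if "g \<in> Q" "g <# x = x" for g
        using act_inv_act[of g x] that xX(1) by simp
      have sR: "subgroup R G"
      proof (rule subgroupI)
        show "R \<subseteq> carrier G" unfolding R_def using Q.subset by blast
        show "R \<noteq> {}" unfolding R_def using Q.one_closed act_one[OF xX(1)] by blast
        show "inv a \<in> R" if "a \<in> R" for a using that inv_fix unfolding R_def by simp
        show "a \<otimes> b \<in> R" if "a \<in> R" "b \<in> R" for a b
          using that act_mult[of a b x] xX(1) unfolding R_def by simp
      qed
      have RQ: "R \<subset> Q" using xX unfolding R_def fix_points_def by blast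
      let ?\<delta> = "\<lambda>z. if z = x then F x else 0"
      define O1 where "O1 = (\<lambda>q. q <# x) ` Q"
      define F1 where "F1 = (\<lambda>y. if y \<in> O1 then F x else 0)"
      have O1X: "O1 \<subseteq> cosets" unfolding O1_def using act_closed[OF _ xX(1)] Q.subset by blast
      have xO1: "x \<in> O1" unfolding O1_def using act_one[OF xX(1)] Q.one_closed by (metis image_eqI)
      have F1_eq: "coset_trace Q R ?\<delta> = F1"
        unfolding F1_def O1_def by (rule coset_trace_delta[OF subgroup_Q xX(1) R_def sR])
      let ?m = "\<tau> (mat_app e ?\<delta>)"
      have "?m \<in> fixed_pts G R M"
      proof -
        have "transl r (mat_app e ?\<delta>) = mat_app e ?\<delta>" if r: "r \<in> R" for r
        proof -
          have rG: "r \<in> carrier G" "r <# x = x" using r unfolding R_def by auto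
          then show ?thesis using app_transl[OF e(1) rG(1) rG(1), of ?\<delta>] transl_delta[OF rG(1) xX(1), of "F x"] by simp
        qed
        then show ?thesis using fixed_pts_iff[OF sR M(2) app_in_M(1)] app_in_M(2) by simp
      qed
      then have "trace G Q R ?m \<in> brauer_den G Q M" by (rule gen[OF sR RQ])
      then have part1: "\<tau> (mat_app e F1) \<in> brauer_den G Q M"
        using trace_fun_of[OF subgroup_Q sR psubset_imp_subset[OF RQ], of "mat_app e ?\<delta>"]
          mat_app_coset_trace[OF subgroup_Q sR psubset_imp_subset[OF RQ] e(1), of ?\<delta>] F1_eq by simp
      have O1_stable: "q <# C \<in> O1 \<longleftrightarrow> C \<in> O1" if qC: "q \<in> Q" "C \<in> cosets" for q C
      proof -
        have 1: "k <# D \<in> O1" if "k \<in> Q" "D \<in> O1" for k D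
        proof -
          obtain r where r: "r \<in> Q" "D = r <# x" using \<open>D \<in> O1\<close> unfolding O1_def by blast
          have "k <# D = (k \<otimes> r) <# x" using act_mult[of k r x] r \<open>k \<in> Q\<close> xX(1) by simp
          then show ?thesis unfolding O1_def using r \<open>k \<in> Q\<close> by blast
        qed
        show ?thesis using 1[OF qC(1), of C] 1[OF Q.m_inv_closed[OF qC(1)], of "q <# C"]
          act_inv_act[OF Q.mem_carrier[OF qC(1)] qC(2)] by auto
      qed
      have FO1: "F C = F x" if C: "C \<in> O1" for C
      proof -
        obtain q where "q \<in> Q" "C = q <# x" using C unfolding O1_def by blast
        then show ?thesis using less.prems(1)[of q x] xX(1) by simp
      qed
      have O1_nofix: "C \<notin> fix_points Q" if "C \<in> O1" for C using FO1[OF that] x less.prems(2) by metis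
      have part2: "\<tau> (mat_app e (F - F1)) \<in> brauer_den G Q M"
      proof (rule less.hyps)
        have "{C. (F - F1) C \<noteq> 0} = {C. F C \<noteq> 0} - O1" using FO1 x by (auto simp: F1_def)
        moreover have "finite {C. F C \<noteq> 0}"
          by (rule finite_subset[OF _ finite_points]) (use less.prems(3) in blast)
        moreover have "x \<in> {C. F C \<noteq> 0} \<inter> O1" using x xO1 by simp
        ultimately show "card {C. (F - F1) C \<noteq> 0} < card {C. F C \<noteq> 0}"
          by (intro psubset_card_mono) auto
        show "(F - F1) (q <# C) = (F - F1) C" if "q \<in> Q" "C \<in> cosets" for q C
          using less.prems(1)[OF that] O1_stable[OF that] by (simp add: F1_def)
        show "(F - F1) C = 0" if "C \<in> fix_points Q" for C
          using less.prems(2)[OF that] O1_nofix that by (auto simp: F1_def)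
        show "(F - F1) C = 0" if "C \<notin> cosets" for C
          using less.prems(3)[OF that] O1X that by (auto simp: F1_def)
      qed
      have "mat_app e F = mat_app e F1 + mat_app e (F - F1)" by (simp flip: app_add)
      then have "\<tau> (mat_app e F) = \<tau> (mat_app e F1) + \<tau> (mat_app e (F - F1))" by (simp only: fun_of_linear)
      then show ?thesis using lin_subspace_add[OF D part1 part2] by simp
    qed
  qed
  show "?K \<subseteq> brauer_den G Q M"
  proof
    fix m assume m: "m \<in> ?K"
    then have mM: "m \<in> M" and mf: "m \<in> fixed_pts G Q M" by (auto simp: fixed_pts_def)
    have supp: "\<rho> m C = 0" if "C \<notin> cosets" for C using that by (rule coset_fun_supp)
    have "\<forall>q\<in>Q. \<forall>C\<in>cosets. \<rho> m (q <# C) = \<rho> m C"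
      using fixed_pts_iff[OF subgroup_Q M(2) mM] mf transl_fixed_iff[OF subgroup_Q, of "\<rho> m", OF supp] by blast
    then have "\<tau> (mat_app e (\<rho> m)) \<in> brauer_den G Q M"
      by (intro key) (use m supp in auto)
    then show "m \<in> brauer_den G Q M" using M_app[OF mM] M_coset[OF mM] by simp
  qed
qed

definition brauer_restr :: "('g \<Rightarrow> 'k) \<Rightarrow> 'g set \<Rightarrow> 'k" where
  "brauer_restr m = (\<lambda>C. if C \<in> fix_points Q then \<rho> m C else 0)"

text \<open>A function on the fixed points, extended by zero, is invariant under Q; applying e to
  the extension gives a Q-fixed element of M whose restriction is the image under
  \<open>brauer_map Q e\<close>.\<close>

lemma brauer_restr_range: "brauer_restr ` fixed_pts G Q M = range (mat_app (brauer_map Q e))"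
proof
  have eQ: "e \<in> inv_mats Q" using e(1) inv_mats_mono[OF subgroup.subset[OF subgroup_Q]] by blast
  have nofix: "mat_app (brauer_map Q e) F C = 0" if "C \<notin> fix_points Q" for F C
    using that by (simp add: mat_app_def brauer_map_def)
  show "brauer_restr ` fixed_pts G Q M \<subseteq> range (mat_app (brauer_map Q e))"
  proof
    fix F' assume "F' \<in> brauer_restr ` fixed_pts G Q M"
    then obtain m where m: "m \<in> fixed_pts G Q M" "F' = brauer_restr m" by blast
    have mM: "m \<in> M" using m by (simp add: fixed_pts_def)
    have supp: "\<rho> m C = 0" if "C \<notin> cosets" for C using that by (rule coset_fun_supp)
    have inv: "\<forall>q\<in>Q. \<forall>C\<in>cosets. \<rho> m (q <# C) = \<rho> m C"
      using fixed_pts_iff[OF subgroup_Q M(2) mM] m(1) transl_fixed_iff[OF subgroup_Q, of "\<rho> m", OF supp] by blast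
    have "mat_app (brauer_map Q e) (\<rho> m) C = \<rho> m C" if "C \<in> fix_points Q" for C
      using mat_app_brauer_map[OF p pQ eQ _ that, of "\<rho> m"] inv M_app[OF mM] by simp
    then have "F' = mat_app (brauer_map Q e) (\<rho> m)"
      unfolding m(2) brauer_restr_def using nofix by (auto simp: fun_eq_iff)
    then show "F' \<in> range (mat_app (brauer_map Q e))" by blast
  qed
  show "range (mat_app (brauer_map Q e)) \<subseteq> brauer_restr ` fixed_pts G Q M"
  proof
    fix F' assume "F' \<in> range (mat_app (brauer_map Q e))"
    then obtain F where F: "F' = mat_app (brauer_map Q e) F" by blast
    define F0 where "F0 = (\<lambda>C. if C \<in> fix_points Q then F C else 0)"
    have F0X: "F0 C = 0" if "C \<notin> cosets" for C using that fix_points_subset by (auto simp: F0_def)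
    have inv: "F0 (q <# C) = F0 C" if q: "q \<in> Q" and C: "C \<in> cosets" for q C
    proof -
      have "q <# C \<in> fix_points Q \<longleftrightarrow> C \<in> fix_points Q"
        using fix_points_conj[OF subgroup.mem_carrier[OF subgroup_Q q] subgroup.subset[OF subgroup_Q] C]
          subgroup_self_normalizing[OF subgroup_Q q] by simp
      then show ?thesis using q by (auto simp: F0_def fix_points_def)
    qed
    have F'eq: "F' = mat_app (brauer_map Q e) F0"
      unfolding F by (rule mat_app_cong_supp[of _ "fix_points Q"]) (auto simp: brauer_map_def F0_def split: if_splits)
    have br: "mat_app (brauer_map Q e) F0 C = mat_app e F0 C" if "C \<in> fix_points Q" for C
      by (rule mat_app_brauer_map[OF p pQ eQ inv that])
    let ?m = "\<tau> (mat_app e F0)"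
    have "transl q (mat_app e F0) = mat_app e F0" if "q \<in> Q" for q
    proof -
      have qG: "q \<in> carrier G" using that subgroup.mem_carrier[OF subgroup_Q] by blast
      have "transl q F0 = F0" using transl_fixed_iff[OF subgroup_Q, of F0, OF F0X] inv that by blast
      then show ?thesis using app_transl[OF e(1) qG qG, of F0] by simp
    qed
    then have mf: "?m \<in> fixed_pts G Q M" using fixed_pts_iff[OF subgroup_Q M(2) app_in_M(1)] app_in_M(2) by simp
    have "brauer_restr ?m = F'"
      unfolding brauer_restr_def app_in_M(2) F'eq using br nofix by (auto simp: fun_eq_iff)
    then show "F' \<in> brauer_restr ` fixed_pts G Q M" using mf by blast
  qed
qed

lemma brauer_den_kernel: "brauer_den G Q M = {m \<in> fixed_pts G Q M. brauer_restr m = 0}"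
  unfolding brauer_den_eq brauer_restr_def by (auto simp: fun_eq_iff)

text \<open>Restriction to the fixed points of Q has \<open>brauer_den\<close> as its kernel, so the
  general criterion applies to the quotient. It is equivariant because the acting elements normalize
  Q and hence permute the fixed points.\<close>

lemma brauer_quot_indec_iff:
  "indec_quot G (set_prod G Q (centralizer_in G (carrier G) Q)) (brauer_num G Q M) (brauer_den G Q M)
    \<longleftrightarrow> prim_idem (set_prod G Q (centralizer_in G (carrier G) Q)) (brauer_map Q e)"
proof (rule indec_quot_iff_prim_idem[where \<rho> = brauer_restr])
  let ?H = "set_prod G Q (centralizer_in G (carrier G) Q)"
  have QG: "Q \<subseteq> carrier G" by (rule subgroup.subset[OF subgroup_Q])
  have Hn: "h \<in> carrier G \<and> conj_set G h Q = Q" if "h \<in> ?H" for h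
    by (rule set_prod_centralizer_normalizes[OF subgroup_Q that])
  show HG: "?H \<subseteq> carrier G" using Hn by blast
  show "brauer_map Q e \<in> inv_mats ?H"
    by (rule brauer_map_inv_mats[OF subsetD[OF inv_mats_mono[OF HG] e(1)] QG Hn])
  have eQ: "e \<in> inv_mats Q" using e(1) inv_mats_mono[OF QG] by blast
  show "brauer_map Q e \<star> brauer_map Q e = brauer_map Q e"
    using brauer_map_mult[OF p pQ eQ eQ] e(2) by simp
  have Ms: "lin_subspace M" using M(1) unfolding submodule_def by blast
  show "submodule G ?H (brauer_num G Q M)"
    unfolding submodule_def brauer_num_def
  proof (intro conjI lin_subspaceI ballI)
    show "0 \<in> fixed_pts G Q M" using lin_subspace_zero[OF Ms] by (auto simp: fixed_pts_def gact_def fun_eq_iff)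
    show "f + h \<in> fixed_pts G Q M" if "f \<in> fixed_pts G Q M" "h \<in> fixed_pts G Q M" for f h
    proof -
      have "gact G q (f + h) = gact G q f + gact G q h" for q by (auto simp: gact_def fun_eq_iff)
      then show ?thesis using that lin_subspace_add[OF Ms, of f h] by (simp add: fixed_pts_def)
    qed
    show "(\<lambda>x. c * f x) \<in> fixed_pts G Q M" if "f \<in> fixed_pts G Q M" for c f
    proof -
      have "gact G q (\<lambda>x. c * f x) = (\<lambda>x. c * gact G q f x)" for q by (auto simp: gact_def fun_eq_iff)
      then show ?thesis using that lin_subspace_scale[OF Ms, of f c] by (simp add: fixed_pts_def)
    qed
    show "gact G h f \<in> fixed_pts G Q M" if h: "h \<in> ?H" and f: "f \<in> fixed_pts G Q M" for h f
    proof -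
      have hG: "h \<in> carrier G" "conj_set G h Q = Q" using Hn[OF h] by auto
      have fM: "f \<in> M" "\<And>q. q \<in> Q \<Longrightarrow> gact G q f = f" using f by (auto simp: fixed_pts_def)
      have "gact G q (gact G h f) = gact G h f" if q: "q \<in> Q" for q
      proof -
        obtain r where r: "r \<in> Q" "q = conjg G h r" using q hG(2) unfolding conj_set_def by blast
        have rG: "r \<in> carrier G" and qG: "q \<in> carrier G" using r(1) q QG by auto
        have "q \<otimes> h = h \<otimes> r" using r(2) hG(1) rG by (simp add: conjg_def m_assoc)
        then have "gact G q (gact G h f) = gact G h (gact G r f)"
          using gact_gact[OF qG hG(1), of f] gact_gact[OF hG(1) rG, of f] by simp
        then show ?thesis using fM(2)[OF r(1)] by simp
      qed
      moreover have "gact G h f \<in> M" using M(1) hG(1) fM(1) unfolding submodule_def by blast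
      ultimately show ?thesis by (simp add: fixed_pts_def)
    qed
  qed
  show "brauer_restr (v + w) = brauer_restr v + brauer_restr w" for v w
    by (auto simp: brauer_restr_def coset_fun_linear fun_eq_iff)
  show "brauer_restr (\<lambda>x. c * v x) = (\<lambda>x. c * brauer_restr v x)" for c v
    by (auto simp: brauer_restr_def coset_fun_linear fun_eq_iff)
  show "brauer_restr (gact G h v) = transl h (brauer_restr v)" if h: "h \<in> ?H" and v: "v \<in> brauer_num G Q M" for h v
  proof
    have hG: "h \<in> carrier G" "conj_set G h Q = Q" using Hn[OF h] by auto
    have vI: "v \<in> ind_triv G (carrier G) (carrier G \<inter> P)"
      using v M(2) carrier_inter_P by (auto simp: brauer_num_def fixed_pts_def)
    have ig: "conj_set G (inv h) Q = Q" using conj_set_inv(1)[OF hG(1) QG] hG(2) by simp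
    fix C
    have "inv h <# C \<in> fix_points Q \<longleftrightarrow> C \<in> fix_points Q" if "C \<in> cosets"
      using fix_points_conj[OF inv_closed[OF hG(1)] QG that] ig by simp
    then show "brauer_restr (gact G h v) C = transl h (brauer_restr v) C"
      unfolding brauer_restr_def coset_fun_gact[OF subgroup_self hG(1) vI]
      using fix_points_subset[of Q] by (auto simp: transl_def)
  qed
  show "brauer_restr ` brauer_num G Q M = range (mat_app (brauer_map Q e))"
    unfolding brauer_num_def by (rule brauer_restr_range)
  show "brauer_den G Q M = {v \<in> brauer_num G Q M. brauer_restr v = 0}"
    unfolding brauer_num_def by (rule brauer_den_kernel)
qed

lemma brauer_quot_zero_iff: "brauer_num G Q M = brauer_den G Q M \<longleftrightarrow> brauer_map Q e = 0"
proof
  have bI: "brauer_map Q e \<in> inv_mats {}"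
    using brauer_map_inv_mats[OF subsetD[OF inv_mats_mono e(1)] subgroup.subset[OF subgroup_Q], of "{}"] by simp
  assume "brauer_num G Q M = brauer_den G Q M"
  then have "brauer_restr ` fixed_pts G Q M \<subseteq> {0}" unfolding brauer_num_def brauer_den_kernel by blast
  then have "mat_app (brauer_map Q e) F = mat_app 0 F" for F
    unfolding brauer_restr_range by (auto simp: app_zero_mat)
  moreover have "(0 :: 'g set \<Rightarrow> 'g set \<Rightarrow> 'k) \<in> inv_mats {}" by (simp add: inv_mats_def)
  ultimately show "brauer_map Q e = 0" using mat_eqI[OF bI] by blast
next
  assume "brauer_map Q e = 0"
  then have "brauer_restr ` fixed_pts G Q M \<subseteq> {0}" unfolding brauer_restr_range by (auto simp: app_zero_mat)
  then show "brauer_num G Q M = brauer_den G Q M" unfolding brauer_num_def brauer_den_kernel by blast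
qed

end

end

theorem theorem1p2:
  fixes p :: nat and G :: "'g monoid" and P :: "'g set" and M :: "('g \<Rightarrow> 'k::field) set"
  assumes "prime p"
    and "CHAR('k) = p"
    and "\<forall>q :: 'k poly. degree q > 0 \<longrightarrow> (\<exists>x. poly q x = 0)"
    and "group G" and "finite (carrier G)"
    and "p_subgroup p G P"
    and "saturated_fusion p G P"
    and "scott G (carrier G) P M"
  shows "brauer_indec p G M \<longleftrightarrow>
    (\<forall>Q. subgroup Q G \<and> core G P \<subseteq> Q \<and> Q \<subseteq> P \<and> fully_normalized G P Q \<longrightarrow>
       (\<forall>S :: ('g \<Rightarrow> 'k) set. scott G (normalizer_in G (carrier G) Q) (normalizer_in G P Q) S \<longrightarrow>
          indec_quot G (set_prod G Q (centralizer_in G (carrier G) Q)) S {\<lambda>x. 0}))"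
proof -
  have sP: "subgroup P G" using assms(6) by (simp add: p_subgroup_def)
  interpret coset_space G P
    by (intro coset_space.intro coset_space_axioms.intro assms(4,5) sP)
  note sG = subgroup_self
  have scM: "scott G (carrier G) (carrier G \<inter> P) M" using assms(8) by (simp only: carrier_inter_P)
  obtain e where e: "scott_mat (carrier G) e" "coset_fun (carrier G) ` M = range (mat_app e)"
    "prim_idem (carrier G) e"
    using scott_imp_scott_mat[OF sG scM] by blast
  have e': "e \<in> inv_mats (carrier G)" "mat_mult e e = e" using e(3) by (auto simp: prim_idem_def)
  have M: "submodule G (carrier G) M" "M \<subseteq> ind_triv G (carrier G) P"
    using assms(8) unfolding scott_def by blast+
  have one_P: "\<one>\<^bsub>G\<^esub> <#\<^bsub>G\<^esub> P = P" by (rule lcos_mult_one[OF P_closed])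
  \<comment> \<open>The coset P serves as base point; its stabilizer under left multiplication is P
    itself.\<close>
  interpret S: scott_action G "lcosets_in G (carrier G) P" "l_coset G" p P P e
  proof unfold_locales
    show "P \<in> lcosets_in G (carrier G) P"
      using one_P one_closed unfolding lcosets_in_def by blast
    show "\<exists>g\<in>carrier G. x = g <#\<^bsub>G\<^esub> P" if "x \<in> lcosets_in G (carrier G) P" for x
      using that unfolding lcosets_in_def by blast
    show "g <#\<^bsub>G\<^esub> P = P \<longleftrightarrow> g \<in> P" if "g \<in> carrier G" for g
      using lcoset_eq_iff[OF sP that one_closed] one_P that by simp
    show "mat_app e (\<lambda>_. 1) = (\<lambda>x. if x \<in> lcosets_in G (carrier G) P then 1 else 0)"
      using e(1) unfolding scott_mat_def by blast
  qed (use assms e(3) in auto)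
  have orbit: "S.base_orbit Q = lcosets_in G (S.NG Q) P" for Q
    unfolding lcosets_in_def by blast
  have idem_iff: "S.scott_idem Q f \<longleftrightarrow> scott_mat (S.NG Q) f \<and> prim_idem (S.NG Q) f" for Q f
    unfolding S.scott_idem_def scott_mat_def orbit prim_idem_def by blast
  have NP: "S.NG Q \<inter> P = normalizer_in G P Q" for Q
    using P_closed unfolding normalizer_in_def by blast
  have indec_iff: "indec_quot G (S.QC Q) T {\<lambda>x. 0} \<longleftrightarrow> prim_idem (S.QC Q) f"
    if Q: "subgroup Q G" and T: "scott G (S.NG Q) (normalizer_in G P Q) T"
      and f: "scott_mat (S.NG Q) f" "coset_fun (S.NG Q) ` T = range (mat_app f)"
    for Q f and T :: "('g \<Rightarrow> 'k) set"
  proof (rule indec_quot_iff_prim_scott)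
    show "subgroup (S.NG Q) G" by (rule normalizer_in_subgroup[OF sG subgroup.subset[OF Q]])
    show "S.QC Q \<subseteq> S.NG Q" by (rule S.QC_subset_NG[OF Q])
    show "f \<in> inv_mats (S.NG Q)" "mat_mult f f = f" using f(1) unfolding scott_mat_def by blast+
    show "submodule G (S.NG Q) T" "T \<subseteq> ind_triv G (S.NG Q) (S.NG Q \<inter> P)"
      using T unfolding scott_def NP by blast+
    show "coset_fun (S.NG Q) ` T = range (mat_app f)" by (rule f(2))
  qed
  show ?thesis
  proof
    assume brauer: "brauer_indec p G M"
    show "\<forall>Q. subgroup Q G \<and> core G P \<subseteq> Q \<and> Q \<subseteq> P \<and> fully_normalized G P Q \<longrightarrow>
       (\<forall>S :: ('g \<Rightarrow> 'k) set. scott G (normalizer_in G (carrier G) Q) (normalizer_in G P Q) S \<longrightarrow>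
          indec_quot G (set_prod G Q (centralizer_in G (carrier G) Q)) S {\<lambda>x. 0})"
    proof (intro allI impI)
      fix Q and T :: "('g \<Rightarrow> 'k) set"
      assume "subgroup Q G \<and> core G P \<subseteq> Q \<and> Q \<subseteq> P \<and> fully_normalized G P Q"
        and T: "scott G (S.NG Q) (normalizer_in G P Q) T"
      then have Q: "subgroup Q G" "Q \<subseteq> P" "fully_normalized G P Q" by blast+
      have pQ: "p_subgroup p G Q" by (rule S.p_subgroup_in_P[OF Q(1,2)])
      \<comment> \<open>The coset P is fixed by Q, so the Brauer quotient is nonzero and Brauer
        indecomposability leaves only the second alternative.\<close>
      have "fix_points Q \<noteq> {}" using S.x0_fix_points[OF Q(2)] by blast
      then have "brauer_map Q e \<noteq> 0" by (rule S.brauer_map_e_nonzero[OF pQ])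
      then have "brauer_num G Q M \<noteq> brauer_den G Q M"
        using brauer_quot_zero_iff[OF assms(1,2) pQ e' M e(2)] by blast
      then have "prim_idem (S.QC Q) (brauer_map Q e)"
        using brauer pQ brauer_quot_indec_iff[OF assms(1,2) pQ e' M e(2)] unfolding brauer_indec_def by blast
      moreover have NQ: "subgroup (S.NG Q) G" by (rule normalizer_in_subgroup[OF sG subgroup.subset[OF Q(1)]])
      obtain f where f: "scott_mat (S.NG Q) f" "coset_fun (S.NG Q) ` T = range (mat_app f)" "prim_idem (S.NG Q) f"
        using scott_imp_scott_mat[OF NQ] T NP by metis
      ultimately have "prim_idem (S.QC Q) f"
        using S.prim_scott_idem_if_prim_brauer_map[OF Q(3)] idem_iff by blast
      then show "indec_quot G (S.QC Q) T {\<lambda>x. 0}" using indec_iff[OF Q(1) T f(1,2)] by blast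
    qed
  next
    assume indec: "\<forall>Q. subgroup Q G \<and> core G P \<subseteq> Q \<and> Q \<subseteq> P \<and> fully_normalized G P Q \<longrightarrow>
       (\<forall>S :: ('g \<Rightarrow> 'k) set. scott G (normalizer_in G (carrier G) Q) (normalizer_in G P Q) S \<longrightarrow>
          indec_quot G (set_prod G Q (centralizer_in G (carrier G) Q)) S {\<lambda>x. 0})"
    have "\<exists>f. S.scott_idem Q f \<and> prim_idem (S.QC Q) f"
      if fn: "fully_normalized G P Q" and core: "core G P \<subseteq> Q" for Q
    proof -
      have Q: "subgroup Q G" "Q \<subseteq> P" using fn unfolding fully_normalized_def by blast+
      have NQ: "subgroup (S.NG Q) G" by (rule normalizer_in_subgroup[OF sG subgroup.subset[OF Q(1)]])
      \<comment> \<open>The hypothesis speaks about all realisations of the Scott module of the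
        normalizer; a concrete one has to be built before it yields anything.\<close>
      obtain f :: "'g set \<Rightarrow> 'g set \<Rightarrow> 'k" where f: "scott_mat (S.NG Q) f" "prim_idem (S.NG Q) f"
        using scott_mat_exists[OF NQ] by blast
      let ?T = "fun_of (S.NG Q) ` range (mat_app f)"
      have T: "scott G (S.NG Q) (normalizer_in G P Q) ?T"
        using scott_of_scott_mat(1)[OF NQ f] unfolding NP .
      then have "indec_quot G (S.QC Q) ?T {\<lambda>x. 0}" using indec Q fn core by blast
      then have "prim_idem (S.QC Q) f"
        using indec_iff[OF Q(1) T f(1) scott_of_scott_mat(2)[OF NQ f]] by blast
      then show ?thesis using f idem_iff by blast
    qed
    then have "brauer_map Q e = 0 \<or> prim_idem (S.QC Q) (brauer_map Q e)" if "p_subgroup p G Q" for Q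
      using S.brauer_map_zero_or_prim[OF S.prim_brauer_map_if_prim_scott_idem that] by blast
    then show "brauer_indec p G M"
      unfolding brauer_indec_def
      using brauer_quot_zero_iff[OF assms(1,2) _ e' M e(2)] brauer_quot_indec_iff[OF assms(1,2) _ e' M e(2)]
      by blast
  qed
qed

end
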